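(* Let $\Lambda$ be a domestic string algebra. Suppose $P,P'$ are paths in the arch bridge quiver $\mathcal{HQ}^{\mathrm{Ba}}$ with the same source and the same target such that $\mathfrak h(P)=\mathfrak h(P')$. Then $P=P'$.
   Context: STRINGS. $\mathcal K$ is an algebraically closed field. A string algebra is $\Lambda=\mathcal K\mathcal Q/\langle\rho\rangle$ with $\mathcal Q=(Q_0,Q_1,s,t)$ a finite quiver and $\rho$ a set of paths of length $\ge2$, none a subpath of another, such that: every vertex is the source of at most two and the target of at most two arrows; for every arrow $b$ there is at most one arrow $a$ with $s(a)=t(b)$, $ab\notin\rho$, and at most one arrow $c$ with $t(c)=s(b)$, $bc\notin\rho$; all sufficiently long paths have a subpath in $\rho$. Words are composed from right to left. Fix $\sigma,\varepsilon:Q_1\to\{1,-1\}$ with $\sigma(a)=-\sigma(b)$ for distinct arrows with the same source, $\varepsilon(a)=-\varepsilon(b)$ for distinct arrows with the same target, and $\sigma(a)=-\varepsilon(b)$ whenever $s(a)=t(b)$ and $ab\notin\rho$. Syllables are arrows (direct) and their formal inverses (inverse), with $s(a^{-1})=t(a)$, $t(a^{-1})=s(a)$, $\sigma(a^{-1})=\varepsilon(a)$, $\varepsilon(a^{-1})=\sigma(a)$. A string of length $n>0$ is a word $\alpha_n\cdots\alpha_1$ of syllables with $s(\alpha_{i+1})=t(\alpha_i)$, $\alpha_{i+1}\ne\alpha_i^{-1}$, and no subword in $\rho\cup\rho^{-1}$; its first syllable is $\alpha_1$ (determining $s,\sigma$) and its last is $\alpha_n$ (determining $t,\varepsilon$).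 For each vertex $v$ and $i\in\{1,-1\}$ there is a length-$0$ string $1_{(v,i)}$ with $s=t=v$, $\sigma=-i$, $\varepsilon=i$; $x1_{(v,i)}=x$ is defined iff $s(x)=v,\sigma(x)=-i$, and $1_{(v,i)}x=x$ is defined iff $t(x)=v,\varepsilon(x)=i$. A band is a string $b$ with $s(b)=t(b)$ whose first syllable is inverse and last syllable is direct, such that $b^n$ is a string for all $n\ge1$ and $b$ is not a proper power of a string. $\Lambda$ is domestic if it has only finitely many bands. A string is band-free if no substring of it is a cyclic permutation of a band. REDUCTIONS. For a band $b$ and a string $y$, $N(b,y)$ is the largest $n$ with $y=y_2(b')^ny_1$ for some strings $y_1,y_2$ and some cyclic permutation $b'$ of $b$; $\mathfrak B(y)$ is the set of bands $b$ (up to cyclic permutation) with $N(b,y)>0$. A 1-step $b$-reduction of $y$ is a string of the form $y_2y_1$ where $y=y_2b'y_1$ with $b'$ a cyclic permutation of $b$; when it exists it is denoted $\mathrm R_b(y)$. The skeleton $\{y\}$ of $y$ is obtained by applying, for every $b\in\mathfrak B(y)$, the operation $\mathrm R_b$ exactly $N(b,y)-1$ times. H-REDUCTIONS. Strings $y_1,y_2$ are H-equivalent, $y_1\equiv_H y_2$, if $t(y_1)=t(y_2)$ and for each string $x$ with $s(x)=t(y_1)$, $xy_1$ is a string iff $xy_2$ is a string. A 1-step H-reduction of $y$ is a string $y_2y_1$, where $y=y_2b'y_1$ with $b'$ a cyclic permutation of a band and $b'y_1\equiv_H y_1$. For a band $b$, set $\mathfrak h_b(y)=\mathrm R_b(y)$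 if $b\in\mathfrak B(y)$, $\mathrm R_b(y)$ exists and is a 1-step H-reduction of $y$; otherwise $\mathfrak h_b(y)=y$. WEAK BRIDGES. Fix a set $Q_0^{\mathrm{Ba}}$ of representatives of bands up to cyclic permutation. For $b_1,b_2\in Q_0^{\mathrm{Ba}}$, a weak bridge $u:b_1\to b_2$ is a band-free string $u$ such that $b_2ub_1$ is a string, excluding the trivial ones $1_{(t(b),\varepsilon(b))}:b\to b$; write $\mathfrak s(u)=b_1$, $\mathfrak t(u)=b_2$. The weak bridge quiver $\overline{\mathcal Q}^{\mathrm{Ba}}$ has vertex set $Q_0^{\mathrm{Ba}}$ and the weak bridges as arrows. (WEAK) ARCH BRIDGES. For a path $P=(u_1,\dots,u_n)$, $n\ge1$, in $\overline{\mathcal Q}^{\mathrm{Ba}}$ (so $\mathfrak t(u_j)=\mathfrak s(u_{j+1})$), with $\mathfrak s(P)=\mathfrak s(u_1)$ and $\mathfrak t(P)=\mathfrak t(u_n)$, the string $\mathfrak h(P)$ is defined by $$\mathfrak t(P)\,\mathfrak h(P)\,\mathfrak s(P)=\mathfrak h_{\mathfrak t(u_1)}\cdots\mathfrak h_{\mathfrak t(u_{n-1})}\big(\{\mathfrak t(u_n)u_n\cdots\mathfrak t(u_1)u_1\mathfrak s(u_1)\}\big).$$ A weak arch bridge $b_1\to b_2$ is a string $\mathfrak h(P)$ for some such path $P$ with $\mathfrak s(P)=b_1$, $\mathfrak t(P)=b_2$. A weak arch bridge $u:b_1\to b_2$ is an arch bridge if $u\ne\mathfrak h(P)$ for every path $P$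 of length at least $2$ from $b_1$ to $b_2$ in $\overline{\mathcal Q}^{\mathrm{Ba}}$. (Every arch bridge is therefore $\mathfrak h((u))=u$ for a single weak bridge $u$, so paths of arch bridges are paths in $\overline{\mathcal Q}^{\mathrm{Ba}}$.) The arch bridge quiver $\mathcal{HQ}^{\mathrm{Ba}}$ has vertex set $Q_0^{\mathrm{Ba}}$ and the arch bridges as arrows. *)

theory Defs
  imports
    "HOL-Library.Sublist"
    "HOL-Algebra.Algebraic_Closure"
    "Graph_Theory.Arc_Walk"
begin

text \<open>
  Words are composed from right to left: the list \<open>[\<alpha>\<^sub>n, \<dots>, \<alpha>\<^sub>1]\<close> stands for the word
  \<open>\<alpha>\<^sub>n \<dots> \<alpha>\<^sub>1\<close>, so concatenation of words is concatenation of lists, the head of the list is the last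
  syllable and the last element of the list is the first syllable.
\<close>

datatype 'a syllable = Direct 'a | Inverse 'a

fun inv_syl :: "'a syllable \<Rightarrow> 'a syllable" where
  "inv_syl (Direct a) = Inverse a"
| "inv_syl (Inverse a) = Direct a"

text \<open>
  \<open>Triv v i\<close> is the string \<open>1\<^bsub>(v,i)\<^esub>\<close> of length \<open>0\<close>; \<open>Undef\<close> is the value of an undefined
  composition, so that composition is a total operation and ``\<open>xy\<close> is a string'' can be
  stated literally. \<open>Word []\<close> and \<open>Undef\<close> are not strings.
\<close>

datatype ('v, 'a) word = Word "'a syllable list" | Triv 'v int | Undef

text \<open>An arrow \<open>u : b\<^sub>1 \<rightarrow> b\<^sub>2\<close> of a quiver on bands is the triple \<open>(b\<^sub>1, u, b\<^sub>2)\<close>; the same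
  string may be an arrow between different pairs of bands.\<close>

type_synonym ('v, 'a) bridge = "'a syllable list \<times> ('v, 'a) word \<times> 'a syllable list"

definition bridge_src :: "('v, 'a) bridge \<Rightarrow> 'a syllable list" where
  "bridge_src e = fst e"

definition bridge_str :: "('v, 'a) bridge \<Rightarrow> ('v, 'a) word" where
  "bridge_str e = fst (snd e)"

definition bridge_tgt :: "('v, 'a) bridge \<Rightarrow> 'a syllable list" where
  "bridge_tgt e = snd (snd e)"

definition list_pow :: "'a list \<Rightarrow> nat \<Rightarrow> 'a list" where
  "list_pow w n = concat (replicate n w)"

definition cyclic_perms :: "'a list \<Rightarrow> 'a list set" where
  "cyclic_perms w = range (\<lambda>k. rotate k w)"

definition quiver_path :: "('v, 'a) pre_digraph \<Rightarrow> 'a list \<Rightarrow> bool" where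
  "quiver_path Q p \<longleftrightarrow>
     p \<noteq> [] \<and> set p \<subseteq> arcs Q \<and> successively (\<lambda>a b. tail Q a = head Q b) p"

locale string_algebra = fin_digraph Q
  for K :: "('k, 'm) ring_scheme"
    and Q :: "('v, 'a) pre_digraph"
    and \<rho> :: "'a list set" +
  assumes alg_closed_field: "algebraically_closed K"
    and relation_path: "r \<in> \<rho> \<Longrightarrow> quiver_path Q r \<and> length r \<ge> 2"
    and relation_minimal: "\<lbrakk>r \<in> \<rho>; r' \<in> \<rho>; sublist r r'\<rbrakk> \<Longrightarrow> r = r'"
    and source_at_most_two: "v \<in> verts Q \<Longrightarrow> card {a \<in> arcs Q. tail Q a = v} \<le> 2"
    and target_at_most_two: "v \<in> verts Q \<Longrightarrow> card {a \<in> arcs Q. head Q a = v} \<le> 2"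
    and at_most_one_after:
      "b \<in> arcs Q \<Longrightarrow> card {a \<in> arcs Q. tail Q a = head Q b \<and> [a, b] \<notin> \<rho>} \<le> 1"
    and at_most_one_before:
      "b \<in> arcs Q \<Longrightarrow> card {c \<in> arcs Q. head Q c = tail Q b \<and> [b, c] \<notin> \<rho>} \<le> 1"
    and long_paths_vanish:
      "\<exists>N. \<forall>p. quiver_path Q p \<and> length p \<ge> N \<longrightarrow> (\<exists>r\<in>\<rho>. sublist r p)"
begin

fun src_syl :: "'a syllable \<Rightarrow> 'v" where
  "src_syl (Direct a) = tail Q a"
| "src_syl (Inverse a) = head Q a"

fun tgt_syl :: "'a syllable \<Rightarrow> 'v" where
  "tgt_syl (Direct a) = head Q a"
| "tgt_syl (Inverse a) = tail Q a"

definition relation_words :: "'a syllable list set" where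
  "relation_words = map Direct ` \<rho> \<union> (\<lambda>r. rev (map Inverse r)) ` \<rho>"

fun is_string :: "('v, 'a) word \<Rightarrow> bool" where
  "is_string (Word w) \<longleftrightarrow>
     w \<noteq> [] \<and>
     set w \<subseteq> Direct ` arcs Q \<union> Inverse ` arcs Q \<and>
     successively (\<lambda>\<alpha> \<beta>. src_syl \<alpha> = tgt_syl \<beta> \<and> \<alpha> \<noteq> inv_syl \<beta>) w \<and>
     \<not> (\<exists>r\<in>relation_words. sublist r w)"
| "is_string (Triv v i) \<longleftrightarrow> v \<in> verts Q \<and> i \<in> {1, -1}"
| "is_string Undef \<longleftrightarrow> False"

definition band :: "'a syllable list \<Rightarrow> bool" where
  "band b \<longleftrightarrow>
     is_string (Word b) \<and>
     src_syl (last b) = tgt_syl (hd b) \<and>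
     (\<exists>a. last b = Inverse a) \<and> (\<exists>a. hd b = Direct a) \<and>
     (\<forall>n\<ge>1. is_string (Word (list_pow b n))) \<and>
     \<not> (\<exists>w n. is_string (Word w) \<and> n \<ge> 2 \<and> b = list_pow w n)"

definition domestic :: bool where
  "domestic \<longleftrightarrow> finite {b. band b}"

end

locale signed_string_algebra = string_algebra K Q \<rho>
  for K :: "('k, 'm) ring_scheme"
    and Q :: "('v, 'a) pre_digraph"
    and \<rho> :: "'a list set" +
  fixes \<sigma> \<epsilon> :: "'a \<Rightarrow> int"
  assumes sigma_sign: "a \<in> arcs Q \<Longrightarrow> \<sigma> a \<in> {1, -1}"
    and epsilon_sign: "a \<in> arcs Q \<Longrightarrow> \<epsilon> a \<in> {1, -1}"
    and sigma_opposite: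
      "\<lbrakk>a \<in> arcs Q; b \<in> arcs Q; a \<noteq> b; tail Q a = tail Q b\<rbrakk> \<Longrightarrow> \<sigma> a = - \<sigma> b"
    and epsilon_opposite:
      "\<lbrakk>a \<in> arcs Q; b \<in> arcs Q; a \<noteq> b; head Q a = head Q b\<rbrakk> \<Longrightarrow> \<epsilon> a = - \<epsilon> b"
    and sigma_epsilon:
      "\<lbrakk>a \<in> arcs Q; b \<in> arcs Q; tail Q a = head Q b; [a, b] \<notin> \<rho>\<rbrakk> \<Longrightarrow> \<sigma> a = - \<epsilon> b"
begin

fun sigma_syl :: "'a syllable \<Rightarrow> int" where
  "sigma_syl (Direct a) = \<sigma> a"
| "sigma_syl (Inverse a) = \<epsilon> a"

fun epsilon_syl :: "'a syllable \<Rightarrow> int" where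
  "epsilon_syl (Direct a) = \<epsilon> a"
| "epsilon_syl (Inverse a) = \<sigma> a"

text \<open>The values of the following four functions on \<open>Word []\<close> and \<open>Undef\<close> are never used.\<close>

fun src :: "('v, 'a) word \<Rightarrow> 'v" where
  "src (Word w) = src_syl (last w)"
| "src (Triv v i) = v"
| "src Undef = undefined"

fun tgt :: "('v, 'a) word \<Rightarrow> 'v" where
  "tgt (Word w) = tgt_syl (hd w)"
| "tgt (Triv v i) = v"
| "tgt Undef = undefined"

fun sgn_src :: "('v, 'a) word \<Rightarrow> int" where
  "sgn_src (Word w) = sigma_syl (last w)"
| "sgn_src (Triv v i) = - i"
| "sgn_src Undef = undefined"

fun sgn_tgt :: "('v, 'a) word \<Rightarrow> int" where
  "sgn_tgt (Word w) = epsilon_syl (hd w)"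
| "sgn_tgt (Triv v i) = i"
| "sgn_tgt Undef = undefined"

text \<open>The composition of two words of positive length is a formal word, which need not be a string.\<close>

fun comp :: "('v, 'a) word \<Rightarrow> ('v, 'a) word \<Rightarrow> ('v, 'a) word"  (infixl "\<cdot>" 75) where
  "Word x \<cdot> Word y = Word (x @ y)"
| "Word x \<cdot> Triv v i = (if src (Word x) = v \<and> sgn_src (Word x) = - i then Word x else Undef)"
| "Triv v i \<cdot> Word y = (if tgt (Word y) = v \<and> sgn_tgt (Word y) = i then Word y else Undef)"
| "Triv v i \<cdot> Triv w j = (if v = w \<and> i = j then Triv v i else Undef)"
| "Undef \<cdot> y = Undef"
| "x \<cdot> Undef = Undef"

definition factorization ::
  "('v, 'a) word \<Rightarrow> ('v, 'a) word \<Rightarrow> 'a syllable list \<Rightarrow> ('v, 'a) word \<Rightarrow> bool" where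
  "factorization y y\<^sub>2 w y\<^sub>1 \<longleftrightarrow>
     is_string y \<and> is_string y\<^sub>2 \<and> is_string y\<^sub>1 \<and> y = y\<^sub>2 \<cdot> Word w \<cdot> y\<^sub>1"

definition band_free :: "('v, 'a) word \<Rightarrow> bool" where
  "band_free y \<longleftrightarrow>
     \<not> (\<exists>b b' y\<^sub>2 y\<^sub>1. band b \<and> b' \<in> cyclic_perms b \<and> factorization y y\<^sub>2 b' y\<^sub>1)"

definition N :: "'a syllable list \<Rightarrow> ('v, 'a) word \<Rightarrow> nat" where
  "N b y = Max (insert 0 {n. n \<ge> 1 \<and>
     (\<exists>b' y\<^sub>2 y\<^sub>1. b' \<in> cyclic_perms b \<and> factorization y y\<^sub>2 (list_pow b' n) y\<^sub>1)})"

definition band_reduction ::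
  "'a syllable list \<Rightarrow> ('v, 'a) word \<Rightarrow> ('v, 'a) word \<Rightarrow> bool" where
  "band_reduction b y z \<longleftrightarrow>
     is_string z \<and>
     (\<exists>b' y\<^sub>2 y\<^sub>1. b' \<in> cyclic_perms b \<and> factorization y y\<^sub>2 b' y\<^sub>1 \<and> z = y\<^sub>2 \<cdot> y\<^sub>1)"

text \<open>
  Over a domestic string algebra a 1-step \<open>b\<close>-reduction of \<open>y\<close> is unique if it exists;
  \<open>R b y\<close> is only used for strings \<open>y\<close> for which it exists.
\<close>

definition R :: "'a syllable list \<Rightarrow> ('v, 'a) word \<Rightarrow> ('v, 'a) word" where
  "R b y = (SOME z. band_reduction b y z)"

definition H_equivalent :: "('v, 'a) word \<Rightarrow> ('v, 'a) word \<Rightarrow> bool" where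
  "H_equivalent y\<^sub>1 y\<^sub>2 \<longleftrightarrow>
     is_string y\<^sub>1 \<and> is_string y\<^sub>2 \<and> tgt y\<^sub>1 = tgt y\<^sub>2 \<and>
     (\<forall>x. is_string x \<and> src x = tgt y\<^sub>1 \<longrightarrow> (is_string (x \<cdot> y\<^sub>1) \<longleftrightarrow> is_string (x \<cdot> y\<^sub>2)))"

definition H_reduction :: "('v, 'a) word \<Rightarrow> ('v, 'a) word \<Rightarrow> bool" where
  "H_reduction y z \<longleftrightarrow>
     is_string z \<and>
     (\<exists>b b' y\<^sub>2 y\<^sub>1. band b \<and> b' \<in> cyclic_perms b \<and> factorization y y\<^sub>2 b' y\<^sub>1 \<and>
        z = y\<^sub>2 \<cdot> y\<^sub>1 \<and> H_equivalent (Word b' \<cdot> y\<^sub>1) y\<^sub>1)"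

end

locale string_algebra_bands = signed_string_algebra K Q \<rho> \<sigma> \<epsilon>
  for K :: "('k, 'm) ring_scheme"
    and Q :: "('v, 'a) pre_digraph"
    and \<rho> :: "'a list set"
    and \<sigma> \<epsilon> :: "'a \<Rightarrow> int" +
  fixes Q0Ba :: "'a syllable list set"
  assumes representatives_band: "b \<in> Q0Ba \<Longrightarrow> band b"
    and representatives_unique: "band b \<Longrightarrow> \<exists>!b'. b' \<in> Q0Ba \<and> b' \<in> cyclic_perms b"
begin

definition bands_of :: "('v, 'a) word \<Rightarrow> 'a syllable list set" where
  "bands_of y = {b \<in> Q0Ba. N b y > 0}"

text \<open>
  The reductions for the different bands in \<^term>\<open>bands_of y\<close> are applied in some order;
  the exponents \<open>N(b,y) - 1\<close> refer to the original string \<open>y\<close>.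
\<close>

definition skeleton :: "('v, 'a) word \<Rightarrow> ('v, 'a) word" where
  "skeleton y =
     (let bs = (SOME bs. distinct bs \<and> set bs = bands_of y)
      in foldr (\<lambda>b z. (R b ^^ (N b y - 1)) z) bs y)"

definition h_red :: "'a syllable list \<Rightarrow> ('v, 'a) word \<Rightarrow> ('v, 'a) word" where
  "h_red b y =
     (if b \<in> bands_of y \<and> (\<exists>z. band_reduction b y z) \<and> H_reduction y (R b y)
      then R b y else y)"

definition weak_bridge :: "('v, 'a) bridge \<Rightarrow> bool" where
  "weak_bridge e \<longleftrightarrow> (case e of (b\<^sub>1, u, b\<^sub>2) \<Rightarrow>
     b\<^sub>1 \<in> Q0Ba \<and> b\<^sub>2 \<in> Q0Ba \<and> is_string u \<and> band_free u \<and>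
     is_string (Word b\<^sub>2 \<cdot> u \<cdot> Word b\<^sub>1) \<and>
     \<not> (b\<^sub>1 = b\<^sub>2 \<and> u = Triv (tgt (Word b\<^sub>1)) (sgn_tgt (Word b\<^sub>1))))"

definition weak_bridge_quiver :: "('a syllable list, ('v, 'a) bridge) pre_digraph" where
  "weak_bridge_quiver =
     \<lparr>verts = Q0Ba, arcs = {e. weak_bridge e}, tail = bridge_src, head = bridge_tgt\<rparr>"

text \<open>
  Paths of bridges are arc walks: the list \<open>[u\<^sub>1, \<dots>, u\<^sub>n]\<close> is traversed from left to right.
  \<open>path_string P\<close> is \<open>\<tt>(u\<^sub>n) u\<^sub>n \<dots> \<tt>(u\<^sub>1) u\<^sub>1 \<ss>(u\<^sub>1)\<close>.
\<close>

definition path_string :: "('v, 'a) bridge list \<Rightarrow> ('v, 'a) word" where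
  "path_string P =
     foldl (\<lambda>z e. Word (bridge_tgt e) \<cdot> bridge_str e \<cdot> z) (Word (bridge_src (hd P))) P"

definition h_path :: "('v, 'a) bridge list \<Rightarrow> ('v, 'a) word" where
  "h_path P =
     (THE u. is_string u \<and>
        Word (bridge_tgt (last P)) \<cdot> u \<cdot> Word (bridge_src (hd P)) =
        foldr (\<lambda>e z. h_red (bridge_tgt e) z) (butlast P) (skeleton (path_string P)))"

definition weak_arch_bridge :: "('v, 'a) bridge \<Rightarrow> bool" where
  "weak_arch_bridge e \<longleftrightarrow> (case e of (b\<^sub>1, u, b\<^sub>2) \<Rightarrow>
     \<exists>P. P \<noteq> [] \<and> pre_digraph.awalk weak_bridge_quiver b\<^sub>1 P b\<^sub>2 \<and> u = h_path P)"

definition arch_bridge :: "('v, 'a) bridge \<Rightarrow> bool" where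
  "arch_bridge e \<longleftrightarrow> weak_arch_bridge e \<and> (case e of (b\<^sub>1, u, b\<^sub>2) \<Rightarrow>
     \<not> (\<exists>P. length P \<ge> 2 \<and> pre_digraph.awalk weak_bridge_quiver b\<^sub>1 P b\<^sub>2 \<and> u = h_path P))"

definition arch_bridge_quiver :: "('a syllable list, ('v, 'a) bridge) pre_digraph" where
  "arch_bridge_quiver =
     \<lparr>verts = Q0Ba, arcs = {e. arch_bridge e}, tail = bridge_src, head = bridge_tgt\<rparr>"

end

end

theory Submission
  imports Defs
begin

text \<open>
  Strings are paths in the deterministic automaton of residual languages (classes of H-equivalent
  strings). A band labels a cycle of this automaton, and since two loops at one state generate
  infinitely many bands unless they commute, over a domestic algebra distinct cycles are disjoint and
  no path returns to a cycle it has left. Reductions of a string, those forming the skeleton as well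
  as the H-reductions, remove loops of the path, hence keep the list of edges lying on no cycle.
  If a bridge visited a cycle other than those of its two end bands, it would be \<open>h\<close> of the path
  of two bridges obtained by splitting it there. Hence the bridges of a path of arch bridges can be read
  off from its string: the list of non-cyclic edges is cut at the edges starting on a cycle, and each piece
  determines its bridge.
\<close>

section \<open>Powers and rotations of words\<close>

text \<open>The reductions are given through choices: \<open>R\<close> picks some result, the
  skeleton fixes no order of the bands, and an H-reduction may be witnessed by any band. Three facts
  remove this freedom. A turn around a cycle can be slid past any stretch of path along that cycle,
  so all deletions of one band give the same word. Deleting one of two adjacent copies of a band
  changes the exponent of no other band, so the order in a skeleton does not matter. Two deletions
  with equal results delete conjugate words. The other obstacle is that non-cyclic edges do not show
  the number of turns made around a cycle. A single bridge is nevertheless determined by them,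
  because it admits no loops except around its final band, and band-freeness fixes the number of
  those. The argument about states uses only that strings are closed under factors, can be joined at
  a change of direction, and have bounded length when purely direct or purely inverse. It is
  therefore carried out for abstract languages of lists; trivial strings and signs enter only at the
  translation.\<close>

lemma list_pow_0 [simp]: "list_pow w 0 = []"
  and list_pow_Suc [simp]: "list_pow w (Suc n) = w @ list_pow w n"
  by (simp_all add: list_pow_def)

lemma list_pow_1 [simp]: "list_pow w (Suc 0) = w"
  by simp

lemma list_pow_add: "list_pow w (m + n) = list_pow w m @ list_pow w n"
  by (induction m) auto

lemma list_pow_commute: "list_pow w n @ w = w @ list_pow w n"
  by (induction n) auto

lemma list_pow_mult: "list_pow w (m * n) = list_pow (list_pow w m) n"
  by (induction n) (auto simp: list_pow_add)

lemma length_list_pow [simp]: "length (list_pow w n) = n * length w"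
  by (induction n) auto

lemma list_pow_Nil [simp]: "list_pow [] n = []"
  by (induction n) auto

lemma list_pow_eq_Nil [simp]: "list_pow w n = [] \<longleftrightarrow> w = [] \<or> n = 0"
  by (cases n) auto

lemma list_pow_rotate: "list_pow (r @ s) n @ r = r @ list_pow (s @ r) n"
  by (induction n) auto

lemma list_pow_rotate_append: "list_pow (r @ s) n @ r @ x = r @ list_pow (s @ r) n @ x"
  using list_pow_rotate[of r s n] by (metis append.assoc)

text \<open>Requiring \<open>s \<noteq> []\<close> makes the remainder canonical: a suffix
  consisting of full periods gets \<open>r = []\<close>. Only then can two such decompositions be
  compared by \<open>primitive_rotation_unique\<close>.\<close>

lemma suffix_of_list_pow:
  assumes "x @ y = list_pow c k" "c \<noteq> []"
  shows "\<exists>r s m. c = s @ r \<and> s \<noteq> [] \<and> y = r @ list_pow c m"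
  using assms
proof (induction k arbitrary: x)
  case 0
  then show ?case by (intro exI[of _ "[]"] exI[of _ c] exI[of _ 0]) auto
next
  case (Suc k)
  from Suc.prems(1) have "x @ y = c @ list_pow c k" by simp
  then consider us where "x = c @ us" "us @ y = list_pow c k"
    | us where "c = x @ us" "y = us @ list_pow c k"
    by (auto simp: append_eq_append_conv2)
  then show ?case
  proof cases
    case 1
    then show ?thesis using Suc.IH Suc.prems(2) by blast
  next
    case 2
    show ?thesis
    proof (cases "x = []")
      case True
      with 2 show ?thesis
        by (intro exI[of _ "[]"] exI[of _ c] exI[of _ "Suc k"]) (use Suc.prems in auto)
    next
      case False
      with 2 show ?thesis by blast
    qed
  qed
qed

definition primitive :: "'l list \<Rightarrow> bool" where
  "primitive c \<longleftrightarrow> c \<noteq> [] \<and> (\<forall>w n. c = list_pow w n \<longrightarrow> n = 1)"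

lemma primitive_root:
  assumes "w \<noteq> []"
  shows "\<exists>v k. primitive v \<and> w = list_pow v k"
  using assms
proof (induction w rule: length_induct)
  case (1 w)
  show ?case
  proof (cases "primitive w")
    case True
    then show ?thesis by (intro exI[of _ w] exI[of _ 1]) auto
  next
    case False
    with 1 obtain x n where x: "w = list_pow x n" "n \<noteq> 1" by (auto simp: primitive_def)
    with 1 have "x \<noteq> []" "n \<noteq> 0" by auto
    then have "length x < length w" using x by simp
    with 1 \<open>x \<noteq> []\<close> obtain v k where "primitive v" "x = list_pow v k" by blast
    with x show ?thesis using list_pow_mult by metis
  qed
qed

lemma primitive_commute:
  assumes "x @ y = y @ x" "primitive x"
  shows "\<exists>k. y = list_pow x k"
proof -
  obtain m n zs where "list_pow zs m = x" "list_pow zs n = y"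
    using comm_append_are_replicate[OF assms(1)] unfolding list_pow_def by blast
  with assms(2) show ?thesis unfolding primitive_def by (metis One_nat_def list_pow_1)
qed

lemma cyclic_perms_iff: "e \<in> cyclic_perms c \<longleftrightarrow> (\<exists>r s. c = s @ r \<and> e = r @ s)"
proof
  assume "e \<in> cyclic_perms c"
  then obtain k where "e = rotate k c" by (auto simp: cyclic_perms_def)
  then have "e = drop (k mod length c) c @ take (k mod length c) c"
    by (simp add: rotate_drop_take)
  then show "\<exists>r s. c = s @ r \<and> e = r @ s" by (metis append_take_drop_id)
next
  assume "\<exists>r s. c = s @ r \<and> e = r @ s"
  then obtain r s where "c = s @ r" "e = r @ s" by blast
  then have "e = rotate (length s) c" by (simp add: rotate_append)
  then show "e \<in> cyclic_perms c" by (auto simp: cyclic_perms_def)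
qed

lemma cyclic_perms_refl [simp]: "c \<in> cyclic_perms c"
  unfolding cyclic_perms_iff by (metis append_Nil append_Nil2)

lemma cyclic_perms_sym: "e \<in> cyclic_perms c \<Longrightarrow> c \<in> cyclic_perms e"
  unfolding cyclic_perms_iff by metis

lemma cyclic_perms_trans: "d \<in> cyclic_perms e \<Longrightarrow> e \<in> cyclic_perms c \<Longrightarrow> d \<in> cyclic_perms c"
  unfolding cyclic_perms_def by (auto simp: rotate_rotate)

lemma cyclic_perms_length: "e \<in> cyclic_perms c \<Longrightarrow> length e = length c"
  by (auto simp: cyclic_perms_iff)

lemma cyclic_perms_set: "e \<in> cyclic_perms c \<Longrightarrow> set e = set c"
  by (auto simp: cyclic_perms_iff)

text \<open>Rotation commutes with taking powers, so a root of the rotated word rotates back to a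
  root of the original one.\<close>

lemma primitive_cyclic_perm:
  assumes "primitive c" "e \<in> cyclic_perms c"
  shows "primitive e"
proof -
  have rot1: "rotate1 (list_pow w n) = list_pow (rotate1 w) n" for w :: "'a list" and n
  proof (cases w)
    case (Cons a v)
    show ?thesis
    proof (cases n)
      case (Suc m)
      have "list_pow (v @ [a]) m @ v = v @ list_pow ([a] @ v) m" by (rule list_pow_rotate)
      then show ?thesis using Cons Suc
        by (metis append.assoc append_Cons append_Nil list_pow_Suc list_pow_commute list_pow_rotate rotate1.simps(2))
    qed simp
  qed simp
  have rot: "rotate k (list_pow w n) = list_pow (rotate k w) n" for w :: "'a list" and n k
    by (induction k) (auto simp: rot1)
  from assms(2) have "c \<in> cyclic_perms e" by (rule cyclic_perms_sym)
  then obtain k where "c = rotate k e" by (auto simp: cyclic_perms_def)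
  then show ?thesis using assms(1) unfolding primitive_def by (metis rot rotate_is_Nil_conv)
qed

text \<open>Two cuts giving the same rotation differ by a word \<open>t\<close> that commutes with a
  conjugate of \<open>c\<close>. Being a power of this primitive word and shorter than it,
  \<open>t\<close> is empty.\<close>

lemma primitive_rotation_unique:
  assumes "primitive c" "c = s @ r" "c = s' @ r'" "r @ s = r' @ s'" "s \<noteq> []" "s' \<noteq> []"
  shows "r = r' \<and> s = s'"
proof -
  have aux: "r = r'" if le: "length r \<le> length r'" and c: "c = s @ r" "c = s' @ r'"
      and rs: "r @ s = r' @ s'" and ne: "s' \<noteq> []" for r r' s s'
  proof -
    from c have "s @ r = s' @ r'" by simp
    then obtain t where "s = s' @ t \<and> t @ r = r' \<or> s @ t = s' \<and> r = t @ r'"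
      unfolding append_eq_append_conv2 by blast
    with le have t: "r' = t @ r" "s = s' @ t" by auto
    have "r @ s' @ t = t @ r @ s'" using rs t by simp
    then have "(r @ s') @ t = t @ (r @ s')" by simp
    moreover have "primitive (t @ r @ s')"
    proof (rule primitive_cyclic_perm[OF assms(1)])
      show "t @ r @ s' \<in> cyclic_perms c"
        unfolding cyclic_perms_iff c(2) t(1)
        by (intro exI[of _ "t @ r"] exI[of _ s']) auto
    qed
    moreover have "(t @ r @ s') @ t = t @ (t @ r @ s')" using calculation(1) by simp
    ultimately obtain k where k: "t = list_pow (t @ r @ s') k" using primitive_commute by blast
    then have "length t = k * length (t @ r @ s')" by (metis length_list_pow)
    moreover have "length t < length (t @ r @ s')" using ne by auto
    ultimately have "k = 0 \<or> t = []" by (cases k) auto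
    then have "t = []" using k by auto
    with t show "r = r'" by simp
  qed
  have "r = r'"
    using aux[of r r' s s'] aux[of r' r s' s] assms by (metis nat_le_linear)
  then show ?thesis using assms by simp
qed

lemma append_eq_shorter_suffix:
  assumes "xs @ ys = us @ vs" "length ys \<le> length vs"
  obtains t where "vs = t @ ys" "xs = us @ t"
proof -
  obtain t where "xs = us @ t \<and> t @ ys = vs \<or> xs @ t = us \<and> ys = t @ vs"
    using assms(1) unfolding append_eq_append_conv2 by blast
  with assms(2) have "vs = t @ ys" "xs = us @ t" by auto
  then show thesis by (rule that)
qed

lemma strip_prefix_power:
  assumes "d \<noteq> []"
  shows "\<exists>i u. w = list_pow d i @ u \<and> \<not> prefix d u"
proof (induction w rule: length_induct)
  case (1 w)
  show ?case
  proof (cases "prefix d w")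
    case True
    then obtain v where v: "w = d @ v" by (auto simp: prefix_def)
    then have "length v < length w" using assms by simp
    with 1 obtain i u where "v = list_pow d i @ u" "\<not> prefix d u" by blast
    with v show ?thesis by (intro exI[of _ "Suc i"] exI[of _ u]) simp
  next
    case False
    then show ?thesis by (intro exI[of _ 0] exI[of _ w]) simp
  qed
qed

lemma conjugate_of_commute:
  assumes "e @ p = p @ g" shows "g \<in> cyclic_perms e"
  using assms
proof (induction p rule: length_induct)
  case (1 p)
  then consider us where "e = p @ us" "us @ p = g" | us where "e @ us = p" "p = us @ g"
    unfolding append_eq_append_conv2 by blast
  then show ?case
  proof cases
    case 1
    then show ?thesis unfolding cyclic_perms_iff by blast
  next
    case (2 us)
    show ?thesis
    proof (cases "e = []")
      case True
      then show ?thesis using 1 by simp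
    next
      case False
      then have "length us < length p" "e @ us = us @ g" using 2 by auto
      then show ?thesis using 1 by blast
    qed
  qed
qed

text \<open>Cancelling the common ends leaves \<open>e @ p = p @ g\<close>, the equation of
  conjugate words. This identifies the band behind an H-reduction from its result alone.\<close>

lemma equal_removals_conjugate:
  fixes e g :: "'b list"
  assumes "l2 @ e @ l1 = k2 @ g @ k1" "l2 @ l1 = k2 @ k1"
  shows "g \<in> cyclic_perms e"
proof -
  have aux: "g \<in> cyclic_perms e"
    if eq: "l2 @ e @ l1 = k2 @ g @ k1" "l2 @ l1 = k2 @ k1" and le: "length k1 \<le> length l1"
    for l2 e l1 k2 g k1 :: "'b list"
  proof -
    obtain p where p: "l1 = p @ k1" "k2 = l2 @ p"
      using append_eq_shorter_suffix[OF eq(2)[symmetric] le] by metis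
    then have "e @ p = p @ g" using eq(1) by simp
    then show ?thesis by (rule conjugate_of_commute)
  qed
  show ?thesis
    using aux[OF assms] aux[OF assms[symmetric]] cyclic_perms_sym by (metis nat_le_linear)
qed

section \<open>Languages glued at turns\<close>

text \<open>For strings, \<open>dir\<close> marks the direct syllables. Relations consist of direct
  syllables only or of inverse syllables only, so none crosses a change of direction, which gives
  \<open>S_turn\<close>; \<open>pure_bounded\<close> comes from the vanishing of long paths.\<close>

locale turn_language =
  fixes S :: "'l list \<Rightarrow> bool" and dir :: "'l \<Rightarrow> bool"
  assumes S_factor: "S (x @ y @ z) \<Longrightarrow> y \<noteq> [] \<Longrightarrow> S y"
    and not_S_Nil: "\<not> S []"
    and S_turn: "S x \<Longrightarrow> S y \<Longrightarrow> S [last x, hd y] \<Longrightarrow> dir (last x) \<noteq> dir (hd y) \<Longrightarrow> S (x @ y)"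
    and pure_bounded: "\<exists>n. \<forall>w. S w \<and> ((\<forall>a\<in>set w. dir a) \<or> (\<forall>a\<in>set w. \<not> dir a)) \<longrightarrow> length w < n"
begin

definition turn_band :: "'l list \<Rightarrow> bool" where
  "turn_band b \<longleftrightarrow> S b \<and> dir (hd b) \<and> \<not> dir (last b) \<and> (\<forall>n\<ge>1. S (list_pow b n)) \<and>
     \<not> (\<exists>w n. S w \<and> n \<ge> 2 \<and> b = list_pow w n)"

definition cband :: "'l list \<Rightarrow> bool" where
  "cband c \<longleftrightarrow> (\<exists>b. turn_band b \<and> c \<in> cyclic_perms b)"

definition mixed :: "'l list \<Rightarrow> bool" where
  "mixed w \<longleftrightarrow> (\<exists>a\<in>set w. dir a) \<and> (\<exists>a\<in>set w. \<not> dir a)"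

text \<open>Read from the first syllable on, a string is a path in a deterministic automaton whose states are the
  residual languages; \<open>on_cycle c y\<close> says that the state of \<open>y\<close> is the one at which \<open>c\<close> is a loop.\<close>

definition Res :: "'l list \<Rightarrow> 'l list set" where
  "Res y = {x. S (x @ y)}"

definition on_cycle :: "'l list \<Rightarrow> 'l list \<Rightarrow> bool" where
  "on_cycle c y \<longleftrightarrow> cband c \<and> Res y = Res c"

lemma S_prefix: "S (x @ y) \<Longrightarrow> x \<noteq> [] \<Longrightarrow> S x"
  using S_factor[of "[]" x y] by simp

lemma S_suffix: "S (x @ y) \<Longrightarrow> y \<noteq> [] \<Longrightarrow> S y"
  using S_factor[of x y "[]"] by simp

lemma mixed_split:
  "mixed m \<Longrightarrow> \<exists>m1 m2. m = m1 @ m2 \<and> m1 \<noteq> [] \<and> m2 \<noteq> [] \<and> dir (last m1) \<noteq> dir (hd m2)"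
proof (induction m)
  case Nil
  then show ?case by (simp add: mixed_def)
next
  case (Cons a m)
  show ?case
  proof (cases "mixed m")
    case True
    with Cons.IH obtain m1 m2 where "m = m1 @ m2" "m1 \<noteq> []" "m2 \<noteq> []" "dir (last m1) \<noteq> dir (hd m2)"
      by blast
    then show ?thesis by (intro exI[of _ "a # m1"] exI[of _ m2]) auto
  next
    case False
    have "m \<noteq> []" using Cons.prems by (auto simp: mixed_def)
    with False Cons.prems have "dir a \<noteq> dir (hd m)"
      by (cases m) (auto simp: mixed_def)
    with \<open>m \<noteq> []\<close> show ?thesis by (intro exI[of _ "[a]"] exI[of _ m]) auto
  qed
qed

text \<open>A mixed overlap contains a change of direction; cutting there leaves one part inside
  \<open>x @ m\<close> and the other inside \<open>m @ y\<close>, and the two may be joined again at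
  the turn.\<close>

lemma glue:
  assumes "mixed m" "S (x @ m)" "S (m @ y)"
  shows "S (x @ m @ y)"
proof -
  obtain m1 m2 where m: "m = m1 @ m2" "m1 \<noteq> []" "m2 \<noteq> []" "dir (last m1) \<noteq> dir (hd m2)"
    using mixed_split[OF assms(1)] by blast
  have 1: "S (x @ m1)" using S_prefix[of "x @ m1" m2] assms(2) m by simp
  have 2: "S (m2 @ y)" using S_suffix[of m1 "m2 @ y"] assms(3) m by simp
  have "x @ m = (x @ butlast m1) @ [last m1, hd m2] @ tl m2" using m by simp
  then have "S [last m1, hd m2]" using S_factor assms(2) by (metis list.distinct(1))
  then have "S ((x @ m1) @ (m2 @ y))" by (intro S_turn[OF 1 2]) (use m in auto)
  then show ?thesis using m by simp
qed

section \<open>Bands and the states on their cycles\<close>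

lemma turn_band_primitive: "turn_band b \<Longrightarrow> primitive b"
  unfolding primitive_def
proof (intro conjI allI impI)
  assume b: "turn_band b"
  then show "b \<noteq> []" using not_S_Nil unfolding turn_band_def by auto
  fix w n assume w: "b = list_pow w n"
  with \<open>b \<noteq> []\<close> have "w \<noteq> []" "n \<noteq> 0" by auto
  then have "b = w @ list_pow w (n - 1)" using w by (cases n) auto
  then have "S w" using b \<open>w \<noteq> []\<close> S_prefix unfolding turn_band_def by metis
  then have "\<not> n \<ge> 2" using b w unfolding turn_band_def by blast
  then show "n = 1" using \<open>n \<noteq> 0\<close> by linarith
qed

lemma turn_band_cband: "turn_band b \<Longrightarrow> cband b"
  unfolding cband_def by (metis cyclic_perms_refl)

lemma cband_cyclic: "cband c \<Longrightarrow> e \<in> cyclic_perms c \<Longrightarrow> cband e"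
  unfolding cband_def by (metis cyclic_perms_trans)

lemma cband_rotate: "cband (s @ r) \<Longrightarrow> cband (r @ s)"
  by (erule cband_cyclic) (auto simp: cyclic_perms_iff)

lemma cband_primitive: "cband c \<Longrightarrow> primitive c"
  unfolding cband_def using turn_band_primitive primitive_cyclic_perm by metis

lemma cband_not_Nil: "cband c \<Longrightarrow> c \<noteq> []"
  using cband_primitive by (auto simp: primitive_def)

lemma turn_band_mixed: "turn_band b \<Longrightarrow> mixed b"
  unfolding turn_band_def mixed_def using not_S_Nil by (metis hd_in_set last_in_set)

lemma cband_mixed: "cband c \<Longrightarrow> mixed c"
  unfolding cband_def mixed_def by (metis cyclic_perms_set mixed_def turn_band_mixed)

lemma cband_S_pow: assumes "cband c" "n \<ge> 1" shows "S (list_pow c n)"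
proof -
  obtain s r where c: "c = r @ s" and b: "turn_band (s @ r)"
    using assms(1) unfolding cband_def cyclic_perms_iff by blast
  have "S (list_pow (s @ r) (Suc n))" using b unfolding turn_band_def by auto
  moreover have "list_pow (s @ r) (Suc n) = s @ list_pow (r @ s) n @ r"
    by (metis append.assoc list_pow_Suc list_pow_commute list_pow_rotate)
  ultimately show ?thesis using c S_factor assms cband_not_Nil by (metis list_pow_eq_Nil not_one_le_zero)
qed

lemma cband_S: "cband c \<Longrightarrow> S c" and cband_SS: "cband c \<Longrightarrow> S (c @ c)"
  using cband_S_pow[of c 1] cband_S_pow[of c 2] by (auto simp: numeral_2_eq_2)

text \<open>A band contains a change of direction, so by \<open>glue\<close> reading it erases the
  memory of everything read before: all words of the language with head \<open>c\<close> are in one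
  state.\<close>

lemma cband_Res: "cband c \<Longrightarrow> S (c @ y) \<Longrightarrow> Res (c @ y) = Res c"
proof -
  assume c: "cband c" "S (c @ y)"
  have "S (x @ c @ y) \<longleftrightarrow> S (x @ c)" for x
    using glue[of c x y] S_prefix[of "x @ c" y] cband_mixed cband_not_Nil c by auto
  then show ?thesis unfolding Res_def by auto
qed

lemma Res_append: "Res y = Res y' \<Longrightarrow> Res (x @ y) = Res (x @ y')"
  unfolding Res_def by (metis (mono_tags, lifting) append.assoc mem_Collect_eq subset_antisym subsetI)

lemma Res_S: "Res y = Res y' \<Longrightarrow> S (x @ y) \<longleftrightarrow> S (x @ y')"
  unfolding Res_def by auto

lemma on_cycleD: assumes "on_cycle c y" shows "cband c" "Res y = Res c" "S y" "S (c @ y)" "y \<noteq> []" "S (x @ c) = S (x @ y)"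
proof -
  show c: "cband c" "Res y = Res c" using assms unfolding on_cycle_def by auto
  then show "S y" "S (c @ y)" "S (x @ c) = S (x @ y)"
    using Res_S[of y c "[]"] Res_S[of y c c] Res_S[of y c x] cband_S cband_SS by auto
  then show "y \<noteq> []" using not_S_Nil by auto
qed

lemma on_cycle_append: "cband c \<Longrightarrow> S (c @ y) \<Longrightarrow> on_cycle c (c @ y)"
  unfolding on_cycle_def by (simp add: cband_Res)

lemma on_cycle_self: "cband c \<Longrightarrow> on_cycle c c"
  unfolding on_cycle_def by simp

lemma on_cycle_cong: "Res y = Res y' \<Longrightarrow> on_cycle c y = on_cycle c y'"
  unfolding on_cycle_def by simp

lemma on_cycle_rotate: assumes "on_cycle (s @ r) y" shows "on_cycle (r @ s) (r @ y)"
proof -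
  note a = on_cycleD[OF assms]
  have "Res (r @ y) = Res (r @ s @ r)" using Res_append[OF a(2)] .
  moreover have "S ((r @ s) @ r)" using cband_SS[OF a(1)] S_suffix[of s "r @ s @ r"]
    cband_not_Nil[OF a(1)] by auto
  then have "Res ((r @ s) @ r) = Res (r @ s)" using cband_Res cband_rotate[OF a(1)] by blast
  ultimately show ?thesis using cband_rotate[OF a(1)] unfolding on_cycle_def by simp
qed

lemma on_cycle_pow: "on_cycle c y \<Longrightarrow> on_cycle c (list_pow c n @ y)"
proof (induction n)
  case (Suc n)
  then show ?case using on_cycle_rotate[of "[]" c "list_pow c n @ y"] by simp
qed simp

lemma on_cycle_loop: "on_cycle c y \<Longrightarrow> Res (c @ y) = Res y"
  using on_cycle_rotate[of "[]" c y] unfolding on_cycle_def by simp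

text \<open>The place where a band in normal form closes up is itself a change of direction, so any
  word arriving there can be joined to any word departing from there. An arbitrary cyclic
  permutation lacks this property.\<close>

lemma turn_band_turn:
  assumes "turn_band b" "S x" "S y" "last x = last b" "hd y = hd b"
  shows "S (x @ y)"
proof -
  have b: "b \<noteq> []" "S (b @ b)" using assms(1) cband_not_Nil cband_SS turn_band_cband by auto
  have "b @ b = butlast b @ [last b, hd b] @ tl b" using b(1) by simp
  then have "S [last b, hd b]" using S_factor b(2) by (metis list.distinct(1))
  then show ?thesis using S_turn assms unfolding turn_band_def by auto
qed

end

section \<open>Domestic languages: commuting loops and disjoint cycles\<close>

locale domestic_turn_language = turn_language S dir
  for S :: "'l list \<Rightarrow> bool" and dir :: "'l \<Rightarrow> bool" +
  assumes finite_bands: "finite {b. turn_band b}"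
begin

lemma mixed_rotate_turn:
  assumes "mixed w"
  shows "\<exists>v \<in> cyclic_perms w. dir (hd v) \<and> \<not> dir (last v)"
proof -
  obtain x where "x \<in> set w" "\<not> dir x" using assms by (auto simp: mixed_def)
  then obtain p q where w: "w = p @ x # q" by (meson split_list)
  \<comment> \<open>With \<open>x\<close> as the last entry, the leading block of inverse syllables
    can be moved behind it, and the last entry stays inverse.\<close>
  define v where "v = q @ p @ [x]"
  have v: "v \<in> cyclic_perms w" unfolding cyclic_perms_iff v_def w
    by (intro exI[of _ q] exI[of _ "p @ [x]"]) auto
  have mv: "mixed v" using assms cyclic_perms_set[OF v] by (simp add: mixed_def)
  define v1 where "v1 = takeWhile (\<lambda>a. \<not> dir a) v"
  define v2 where "v2 = dropWhile (\<lambda>a. \<not> dir a) v"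
  have vv: "v = v1 @ v2" by (simp add: v1_def v2_def)
  have v2: "v2 \<noteq> []" using mv by (auto simp: v2_def mixed_def)
  then have h: "dir (hd v2)" unfolding v2_def using hd_dropWhile by metis
  have "\<not> dir (last (v2 @ v1))"
  proof (cases "v1 = []")
    case True
    then have "last (v2 @ v1) = last v" using vv by simp
    then have "last (v2 @ v1) = x" by (simp add: v_def)
    then show ?thesis using \<open>\<not> dir x\<close> by simp
  next
    case False
    then show ?thesis using set_takeWhileD[of "last v1" "\<lambda>a. \<not> dir a" v] v1_def last_in_set by auto
  qed
  moreover have "v2 @ v1 \<in> cyclic_perms w"
    by (rule cyclic_perms_trans[OF _ v]) (auto simp: cyclic_perms_iff vv)
  ultimately show ?thesis using h v2 by (metis hd_append2)
qed

text \<open>A pure word would have pure powers of unbounded length, against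
  \<open>pure_bounded\<close>; a mixed one can be rotated so that it closes up at a turn.\<close>

lemma primitive_cband:
  assumes "primitive v" "\<And>n. n \<ge> 1 \<Longrightarrow> S (list_pow v n)"
  shows "cband v"
proof -
  have ne: "v \<noteq> []" using assms(1) by (simp add: primitive_def)
  have "mixed v"
  proof (rule ccontr)
    assume "\<not> mixed v"
    then have pure: "(\<forall>a\<in>set v. dir a) \<or> (\<forall>a\<in>set v. \<not> dir a)" by (auto simp: mixed_def)
    have sp: "set (list_pow v n) \<subseteq> set v" for n by (induction n) auto
    obtain n where n: "\<And>w. S w \<Longrightarrow> (\<forall>a\<in>set w. dir a) \<or> (\<forall>a\<in>set w. \<not> dir a) \<Longrightarrow> length w < n"
      using pure_bounded by blast
    have "length (list_pow v (Suc n)) < n" 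
    proof (rule n)
      show "S (list_pow v (Suc n))" by (rule assms(2)) simp
      show "(\<forall>a\<in>set (list_pow v (Suc n)). dir a) \<or> (\<forall>a\<in>set (list_pow v (Suc n)). \<not> dir a)"
        using pure sp[of "Suc n"] by blast
    qed
    moreover have "length (list_pow v (Suc n)) \<ge> Suc n" using ne by (cases v) auto
    ultimately show False by simp
  qed
  then obtain u where u: "u \<in> cyclic_perms v" "dir (hd u)" "\<not> dir (last u)"
    using mixed_rotate_turn by blast
  have pu: "primitive u" using primitive_cyclic_perm assms(1) u by blast
  obtain r s where rs: "v = s @ r" "u = r @ s" using u(1) cyclic_perms_iff by blast
  have Su: "S (list_pow u n)" if "n \<ge> 1" for n
  proof -
    have "S (list_pow v (Suc n))" using assms(2)[of "Suc n"] by simp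
    moreover have "list_pow v (Suc n) = s @ list_pow u n @ r"
      unfolding rs by (metis append.assoc list_pow_Suc list_pow_commute list_pow_rotate)
    moreover have "list_pow u n \<noteq> []" using that ne rs by auto
    ultimately show ?thesis using S_factor by metis
  qed
  have "turn_band u" unfolding turn_band_def
    using Su[of 1] Su u pu unfolding primitive_def
    by (metis One_nat_def Suc_1 list_pow_1 not_less_eq_eq order_refl)
  then show ?thesis unfolding cband_def using cyclic_perms_sym u(1) by blast
qed

lemma cband_length_bounded: "\<exists>M. \<forall>c. cband c \<longrightarrow> length c \<le> M"
proof -
  obtain M where "\<forall>n\<in>length ` {b. turn_band b}. n \<le> M"
    using finite_bands finite_nat_set_iff_bounded_le finite_imageI by metis
  then have "length c \<le> M" if "cband c" for c
    using that cyclic_perms_length[of c] unfolding cband_def by auto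
  then show ?thesis by blast
qed

text \<open>If \<open>x\<close> and \<open>y\<close> did not commute, the cyclic words \<open>x\<^sup>n y\<close> would have primitive roots of
  unbounded length.\<close>

lemma loops_commute:
  assumes loops: "\<And>ws. set ws \<subseteq> {x, y} \<Longrightarrow> ws \<noteq> [] \<Longrightarrow> S (concat ws)"
    and ne: "x \<noteq> []" "y \<noteq> []"
  shows "x @ y = y @ x"
proof -
  obtain M where M: "\<And>c. cband c \<Longrightarrow> length c \<le> M" using cband_length_bounded by blast
  \<comment> \<open>The exponent makes \<open>list_pow x M\<close> at least as long as any band, in
    particular as the primitive root of \<open>w\<close>, and leaves one more copy of
    \<open>x\<close> in front of it.\<close>
  define w where "w = list_pow x (Suc M) @ y"
  obtain v k where v: "primitive v" "w = list_pow v k"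
    using primitive_root[of w] ne unfolding w_def by auto
  have k: "k \<ge> 1" using v ne w_def by (cases k) auto
  have Sw: "S (list_pow w n)" if "n \<ge> 1" for n
  proof -
    have *: "list_pow w n = concat (concat (replicate n (replicate (Suc M) x @ [y])))"
      by (induction n) (auto simp: w_def list_pow_def)
    show ?thesis unfolding * by (rule loops) (use that in auto)
  qed
  have "cband v"
  proof (rule primitive_cband[OF v(1)])
    fix n :: nat assume n: "n \<ge> 1"
    have "list_pow w n = list_pow v (n + (k - 1) * n)"
      unfolding v(2) list_pow_mult[symmetric] using k by (simp add: diff_mult_distrib)
    then have "list_pow w n = list_pow v n @ list_pow v ((k - 1) * n)" by (simp add: list_pow_add)
    moreover have "list_pow v n \<noteq> []" using v(1) n by (auto simp: primitive_def)
    ultimately show "S (list_pow v n)" using Sw[OF n] S_prefix by metis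
  qed
  then have lv: "length v \<le> M" using M by blast
  have lx: "length (list_pow x M) \<ge> M" using ne by (cases x) auto
  have wv: "w = v @ list_pow v (k - 1)" using v(2) k by (cases k) auto
  have wv': "w = list_pow v (k - 1) @ v" using wv by (simp add: list_pow_commute)
  have wx: "w = x @ list_pow x M @ y" by (simp add: w_def)
  have wx': "w = list_pow x M @ x @ y" by (metis append.assoc list_pow_commute wx)
  \<comment> \<open>Since \<open>v\<close> is a prefix of \<open>list_pow x M\<close> and
    \<open>x\<close> one of \<open>list_pow v (k - 1)\<close>, both \<open>x @ v\<close> and
    \<open>v @ x\<close> are prefixes of \<open>w\<close>; having equal length they
    coincide.\<close>
  have "prefix v (list_pow x M)"
    by (rule prefix_length_prefix[OF prefixI[OF wv] prefixI[OF wx']]) (use lv lx in linarith)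
  then have 1: "prefix (x @ v) w" unfolding wx by auto
  have "length w = length x + length (list_pow x M) + length y" by (subst wx) simp
  then have lw: "length w \<ge> length x + length v" using lv lx by linarith
  then have "length (list_pow v (k - 1)) \<ge> length x" using arg_cong[OF wv, of length] by simp
  then have "prefix x (list_pow v (k - 1))"
    by (rule prefix_length_prefix[OF prefixI[OF wx] prefixI[OF wv']])
  then have 2: "prefix (v @ x) w" unfolding wv by auto
  have "x @ v = v @ x" 
  proof (rule prefix_order.antisym)
    show "prefix (x @ v) (v @ x)" "prefix (v @ x) (x @ v)"
      by (rule prefix_length_prefix[OF 1 2], simp) (rule prefix_length_prefix[OF 2 1], simp)
  qed
  then have xv: "x @ list_pow v n = list_pow v n @ x" for n
    by (induction n) (simp_all, metis append.assoc)
  have "x @ list_pow x (Suc M) @ y = list_pow x (Suc M) @ y @ x"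
    using xv[of k] unfolding v(2)[symmetric] w_def by simp
  then have "list_pow x (Suc M) @ x @ y = list_pow x (Suc M) @ y @ x"
    by (metis append.assoc list_pow_commute)
  then show ?thesis by simp
qed

lemma loops_commute_on_cycle:
  assumes "on_cycle c y" "Res (u @ y) = Res y" "Res (v @ y) = Res y" "u \<noteq> []" "v \<noteq> []"
  shows "u @ v = v @ u"
proof (rule loops_commute)
  fix ws assume ws: "set ws \<subseteq> {u, v}" "ws \<noteq> []"
  have "Res (concat ws' @ y) = Res y" if "set ws' \<subseteq> {u, v}" for ws'
    using that
  proof (induction ws')
    case (Cons a ws')
    then have "Res (a @ concat ws' @ y) = Res (a @ y)" by (intro Res_append) auto
    then show ?case using Cons.prems assms by auto
  qed simp
  then have "S (concat ws @ y)" using Res_S[of "concat ws @ y" y "[]"] ws on_cycleD(3)[OF assms(1)] by simp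
  moreover have "concat ws \<noteq> []" using ws assms by (cases ws) auto
  ultimately show "S (concat ws)" using S_prefix by blast
qed (use assms in auto)

lemma on_cycle_unique: assumes "on_cycle c y" "on_cycle e y" shows "c = e"
proof -
  have "c @ e = e @ c"
    using loops_commute_on_cycle[OF assms(1) on_cycle_loop[OF assms(1)] on_cycle_loop[OF assms(2)]]
      on_cycleD(1)[OF assms(1)] on_cycleD(1)[OF assms(2)] cband_not_Nil by blast
  then obtain k where "e = list_pow c k"
    using primitive_commute[of c e] cband_primitive on_cycleD(1)[OF assms(1)] by blast
  moreover then have "k = 1" using cband_primitive[OF on_cycleD(1)[OF assms(2)]] unfolding primitive_def by metis
  ultimately show ?thesis by simp
qed

text \<open>The closed path \<open>x2 @ x1\<close> commutes with the loop \<open>c\<close>, hence is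
  a power of the primitive word \<open>c\<close>. Its intermediate state therefore lies on the cycle
  of \<open>c\<close>, and only one cycle passes through a state.\<close>

lemma on_cycle_return_aux:
  assumes "on_cycle c y" "on_cycle e (x1 @ y)" "on_cycle c (x2 @ x1 @ y)"
  shows "\<exists>r s m. c = s @ r \<and> s \<noteq> [] \<and> e = r @ s \<and> x1 = r @ list_pow c m"
proof -
  have c: "cband c" using assms on_cycleD by blast
  have "\<exists>k. x2 @ x1 = list_pow c k"
  proof (cases "x2 @ x1 = []")
    case True
    then show ?thesis by (intro exI[of _ 0]) auto
  next
    case False
    have "Res ((x2 @ x1) @ y) = Res y" using assms unfolding on_cycle_def by simp
    from loops_commute_on_cycle[OF assms(1) on_cycle_loop[OF assms(1)] this cband_not_Nil[OF c] False]
    show ?thesis using primitive_commute cband_primitive[OF c] by blast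
  qed
  then obtain k where "x2 @ x1 = list_pow c k" by blast
  from suffix_of_list_pow[OF this cband_not_Nil[OF c]]
  obtain r s m where rs: "c = s @ r" "s \<noteq> []" "x1 = r @ list_pow c m" by blast
  have "on_cycle (s @ r) (list_pow c m @ y)" using on_cycle_pow[OF assms(1)] rs(1) by metis
  from on_cycle_rotate[OF this] have "on_cycle (r @ s) (x1 @ y)" using rs by simp
  then have "e = r @ s" using on_cycle_unique assms(2) by blast
  with rs show ?thesis by blast
qed

lemma on_cycle_reaches_rotation:
  assumes "on_cycle e y" "e \<in> cyclic_perms c"
  shows "\<exists>x. on_cycle c (x @ y)"
proof -
  obtain r s where "e = s @ r" "c = r @ s" using cyclic_perms_sym[OF assms(2)] unfolding cyclic_perms_iff by blast
  then show ?thesis using on_cycle_rotate assms(1) by blast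
qed

lemma on_cycle_stay:
  assumes "on_cycle c y" "on_cycle e (x @ y)" "e \<in> cyclic_perms c"
  obtains r s m where "c = s @ r" "s \<noteq> []" "e = r @ s" "x = r @ list_pow c m"
  using on_cycle_return_aux[OF assms(1,2)] on_cycle_reaches_rotation[OF assms(2,3)] by blast

lemma on_cycle_no_return:
  assumes "on_cycle c y" "on_cycle e (x1 @ y)" "on_cycle c' (x2 @ x1 @ y)" "c' \<in> cyclic_perms c"
  shows "e \<in> cyclic_perms c"
proof -
  obtain x3 where "on_cycle c (x3 @ x2 @ x1 @ y)" using on_cycle_reaches_rotation[OF assms(3,4)] by blast
  then have "on_cycle c ((x3 @ x2) @ x1 @ y)" by simp
  from on_cycle_return_aux[OF assms(1,2) this] show ?thesis unfolding cyclic_perms_iff by blast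
qed

text \<open>The last two hypotheses say that the two occurrences share a syllable. In each of their
  four relative positions one finds a path that starts at the state of \<open>b\<close>, meets the
  cycle of \<open>e\<close> (up to rotation) and returns to the cycle of \<open>b\<close>; then
  \<open>on_cycle_no_return\<close> applies. For a proper overlap the path is put together at the
  turn where \<open>b\<close> closes up.\<close>

lemma touching_band:
  assumes b: "turn_band b" and e: "cband e" and f: "S (A @ b @ B)" "A @ b @ B = C @ e @ D"
    and ov: "length D < length (b @ B)" "length B < length (e @ D)"
  shows "e \<in> cyclic_perms b"
proof -
  note bS = turn_band_cband[OF b] cband_S[OF turn_band_cband[OF b]] cband_SS[OF turn_band_cband[OF b]]
    cband_not_Nil[OF turn_band_cband[OF b]]
  note eS = cband_S[OF e] cband_SS[OF e] cband_not_Nil[OF e]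
  note nr = on_cycle_no_return[OF on_cycle_self[OF bS(1)] _ _ cyclic_perms_refl]
  show ?thesis
  proof (cases "length B \<le> length D")
    case True
    have "(A @ b) @ B = (C @ e) @ D" using f(2) by simp
    from append_eq_shorter_suffix[OF this True]
    obtain q where q: "D = q @ B" "A @ b = (C @ e) @ q" by metis
    have q': "A @ b = C @ (e @ q)" using q(2) by simp
    show ?thesis
    proof (cases "length (e @ q) \<le> length b")
      case True
      have "C @ (e @ q) = A @ b" using q' by simp
      from append_eq_shorter_suffix[OF this True]
      obtain q2 where q2: "b = q2 @ e @ q" by metis
      have "S (e @ q @ b)" using S_suffix[of q2 "e @ q @ b"] bS eS q2 by auto
      then have "on_cycle e ((e @ q) @ b)" using on_cycle_append[OF e] by auto
      moreover have "on_cycle b (q2 @ (e @ q) @ b)" using on_cycle_append[of b b] bS q2 by simp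
      ultimately show ?thesis by (rule nr)
    next
      case False
      then have "length b \<le> length (e @ q)" by simp
      from append_eq_shorter_suffix[OF q' this]
      obtain x where x: "e @ q = x @ b" "A = C @ x" by metis
      have "length q \<le> length b" using ov q by simp
      from append_eq_shorter_suffix[OF x(1) this]
      obtain p where p: "b = p @ q" "e = x @ p" by metis
      have "p \<noteq> []" using p x ov q by auto
      have "S (C @ (e @ q) @ B)" using f q(1) by simp
      then have sx: "S (e @ q)" using S_factor[of C "e @ q" B] eS(3) by simp
      have on_e: "on_cycle e (x @ b)" using on_cycle_append[OF e sx] p by simp
      have "S (p @ e)" using S_suffix[of x "p @ e"] eS p by auto
      then have "S (p @ e @ q)" using glue[OF cband_mixed[OF e] _ sx] by blast
      then have "S (b @ p @ e @ q)" using turn_band_turn[OF b bS(2)] p \<open>p \<noteq> []\<close> by simp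
      then have "on_cycle b ((b @ p) @ x @ b)" using on_cycle_append[OF bS(1)] p by simp
      from nr[OF on_e this] show ?thesis .
    qed
  next
    case False
    then have "length D \<le> length B" by simp
    moreover have "(C @ e) @ D = (A @ b) @ B" using f(2) by simp
    ultimately obtain x where x: "B = x @ D" "C @ e = (A @ b) @ x" using append_eq_shorter_suffix by metis
    have x': "C @ e = A @ (b @ x)" using x(2) by simp
    show ?thesis
    proof (cases "length (b @ x) \<le> length e")
      case True
      have "A @ (b @ x) = C @ e" using x' by simp
      from append_eq_shorter_suffix[OF this True]
      obtain x2 where x2: "e = x2 @ b @ x" by metis
      \<comment> \<open>Here \<open>b\<close> lies inside \<open>e\<close>. After rotating
        \<open>e\<close> so that \<open>b\<close> is at its head, \<open>e2 @ b\<close> has both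
        \<open>e2\<close> and \<open>b\<close> as heads, so its state lies on both cycles.\<close>
      define e2 where "e2 = b @ x @ x2"
      have e2: "cband e2" using cband_rotate[of x2 "b @ x"] e x2 unfolding e2_def by simp
      have "e2 \<in> cyclic_perms e" unfolding cyclic_perms_iff x2 e2_def
        by (intro exI[of _ "b @ x"] exI[of _ x2]) simp
      have S: "S (e2 @ b)" using S_factor[of x2 "e2 @ b" x] eS(2) bS(4) x2 unfolding e2_def by simp
      have "on_cycle e2 (e2 @ b)" using on_cycle_append[OF e2 S] .
      moreover have "on_cycle b ([] @ e2 @ b)" using on_cycle_append[OF bS(1), of "x @ x2 @ b"] S unfolding e2_def by simp
      ultimately have "e2 \<in> cyclic_perms b" by (rule nr)
      then show ?thesis using \<open>e2 \<in> cyclic_perms e\<close> cyclic_perms_sym cyclic_perms_trans by metis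
    next
      case False
      then have "length e \<le> length (b @ x)" by simp
      from append_eq_shorter_suffix[OF x' this]
      obtain q where q: "b @ x = q @ e" by metis
      have "length x \<le> length e" using ov x by simp
      from append_eq_shorter_suffix[OF q this]
      obtain p where p: "e = p @ x" "b = q @ p" by metis
      have "p \<noteq> []" using p x ov by auto
      have "S (b @ x)" using S_factor[of A "b @ x" D] f(1) x(1) bS(4) by simp
      then have sx: "S (q @ e)" using q by simp
      have "S (e @ p)" using S_prefix[of "e @ p" x] eS p by auto
      then have "S ((e @ p) @ b)" using turn_band_turn[OF b _ bS(2), of "e @ p"] p \<open>p \<noteq> []\<close> by simp
      then have sb: "S (e @ p @ b)" by simp
      have on_e: "on_cycle e ((e @ p) @ b)" using on_cycle_append[OF e sb] by simp
      have "S (q @ e @ p @ b)" using glue[OF cband_mixed[OF e] sx sb] by simp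
      then have "on_cycle b (q @ (e @ p) @ b)" using on_cycle_append[OF bS(1), of "x @ p @ b"] p by simp
      from nr[OF on_e this] show ?thesis .
    qed
  qed
qed

text \<open>The word \<open>q @ d @ p @ c\<close> starts at the state of \<open>c\<close>, inserts
  the loop \<open>d\<close> at the inner state of a second turn and then completes this turn, so the
  cycle of \<open>d\<close> is met between two visits to that of \<open>c\<close>.\<close>

lemma cycle_inside_band:
  assumes c: "turn_band c" and S: "S (c @ y)" and qp: "c = q @ p" "p \<noteq> []" and d: "on_cycle d (p @ y)"
  shows "d \<in> cyclic_perms c"
proof -
  note cS = turn_band_cband[OF c] cband_S[OF turn_band_cband[OF c]]
  note D = on_cycleD[OF d]
  have "S (d @ p)" using S_prefix[of "d @ p" y] D(4) qp(2) by simp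
  then have "S ((d @ p) @ c)" using turn_band_turn[OF c _ cS(2), of "d @ p"] qp by simp
  then have S1: "S (d @ p @ c)" by simp
  have on_d: "on_cycle d ((d @ p) @ c)" using on_cycle_append[OF D(1) S1] by simp
  have "S (q @ d)" using D(6)[of q] S qp by simp
  then have "S (q @ d @ p @ c)" using glue[OF cband_mixed[OF D(1)] _ S1] by blast
  have "Res (q @ d @ p @ c) = Res (q @ p @ y)"
    using Res_append[of "d @ p @ c" "p @ y" q] cband_Res[OF D(1) S1] D(2) by simp
  also have "\<dots> = Res c" using cband_Res[OF cS(1) S] qp by simp
  finally have "on_cycle c (q @ (d @ p) @ c)" unfolding on_cycle_def using cS by simp
  from on_cycle_no_return[OF on_cycle_self[OF cS(1)] on_d this cyclic_perms_refl] show ?thesis .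
qed

section \<open>Edges that lie on no cycle\<close>

definition cycle_edge :: "'l list \<Rightarrow> 'l \<Rightarrow> bool" where
  "cycle_edge y a \<longleftrightarrow> (\<exists>c. on_cycle (c @ [a]) y)"

text \<open>The edges of the state path of \<open>w\<close>, started at \<open>y\<close>, that lie on no cycle. Like the
  syllables of a word, the edge traversed last is the head.\<close>

fun trace :: "'l list \<Rightarrow> 'l list \<Rightarrow> ('l list set \<times> 'l) list" where
  "trace y [] = []"
| "trace y (a # w) = (if cycle_edge (w @ y) a then [] else [(Res (w @ y), a)]) @ trace y w"

definition loop :: "'l list \<Rightarrow> 'l list \<Rightarrow> 'l list \<Rightarrow> bool" where
  "loop y w e \<longleftrightarrow> (\<exists>w2 w1. w = w2 @ e @ w1 \<and> on_cycle e (w1 @ y))"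

lemma trace_append: "trace y (w2 @ w1) = trace (w1 @ y) w2 @ trace y w1"
  by (induction w2) auto

lemma trace_cong: assumes "Res y = Res y'" shows "trace y w = trace y' w"
proof (induction w)
  case (Cons a w)
  have "Res (w @ y) = Res (w @ y')" using Res_append assms .
  moreover from this have "cycle_edge (w @ y) a = cycle_edge (w @ y') a"
    unfolding cycle_edge_def using on_cycle_cong by blast
  ultimately show ?case using Cons by simp
qed simp

lemma trace_cycle_part: "on_cycle (s @ r) y \<Longrightarrow> trace y r = []"
proof (induction r arbitrary: s y rule: rev_induct)
  case (snoc a r)
  have "on_cycle ((s @ r) @ [a]) y" using snoc.prems by simp
  then have "cycle_edge y a" "on_cycle (([a] @ s) @ r) ([a] @ y)"
    unfolding cycle_edge_def by blast (use on_cycle_rotate[of "s @ r" "[a]" y] snoc.prems in simp)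
  then have "trace y [a] = []" "trace ([a] @ y) r = []" using snoc.IH by (simp, blast)
  then show ?case by (simp only: trace_append append_Nil)
qed simp

lemma trace_cycle: "on_cycle c y \<Longrightarrow> trace y c = []"
  using trace_cycle_part[of "[]"] by simp

lemma trace_cycle_pow: "on_cycle c y \<Longrightarrow> trace y (list_pow c n) = []"
proof (induction n)
  case (Suc n)
  then have "trace (list_pow c n @ y) c = []" using on_cycle_pow trace_cycle by blast
  then show ?case using Suc by (simp add: trace_append)
qed simp

lemma trace_stay:
  assumes "on_cycle c y" "on_cycle e (x @ y)" "e \<in> cyclic_perms c"
  shows "trace y x = []"
proof -
  obtain r s m where *: "c = s @ r" "x = r @ list_pow c m" using on_cycle_stay[OF assms] by metis
  have "on_cycle (s @ r) (list_pow c m @ y)" using on_cycle_pow[OF assms(1), of m] unfolding *(1) .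
  then have "trace (list_pow c m @ y) r = []" by (rule trace_cycle_part)
  then show ?thesis using trace_cycle_pow[OF assms(1)] * by (simp add: trace_append)
qed

lemma trace_remove_loop:
  assumes "on_cycle c (w1 @ y)"
  shows "trace y (w2 @ c @ w1) = trace y (w2 @ w1)"
proof -
  have "trace ((c @ w1) @ y) w2 = trace (w1 @ y) w2"
    by (rule trace_cong) (use on_cycle_loop[OF assms] in simp)
  then show ?thesis
    unfolding trace_append[of y w2] trace_append[of y c w1] using trace_cycle[OF assms] by simp
qed

text \<open>Consecutive cyclic edges share a state, and only one cycle passes through a state, so a
  path made of cyclic edges stays on a single cycle.\<close>

lemma trace_Nil_cycle:
  assumes "trace y w = []" "w \<noteq> []"
  shows "\<exists>c e. on_cycle c y \<and> e \<in> cyclic_perms c \<and> on_cycle e (w @ y)"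
  using assms
proof (induction w)
  case (Cons a w)
  then have "cycle_edge (w @ y) a" "trace y w = []" by (auto split: if_splits)
  then obtain d where d: "on_cycle (d @ [a]) (w @ y)" by (auto simp: cycle_edge_def)
  then have d': "on_cycle ([a] @ d) ((a # w) @ y)" using on_cycle_rotate by fastforce
  have dd: "[a] @ d \<in> cyclic_perms (d @ [a])" unfolding cyclic_perms_iff by blast
  show ?case
  proof (cases "w = []")
    case True
    then show ?thesis using d d' dd by auto
  next
    case False
    then obtain c e where c: "on_cycle c y" "e \<in> cyclic_perms c" "on_cycle e (w @ y)"
      using Cons.IH \<open>trace y w = []\<close> by blast
    then have "e = d @ [a]" using on_cycle_unique d by blast
    then show ?thesis using c d' dd cyclic_perms_trans by blast
  qed
qed simp

text \<open>Lifts a cut of the trace to a cut of the word. The cut is placed directly before the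
  first traversed edge of \<open>xs\<close>, which is its last entry, so cyclic edges between the
  two pieces are counted to \<open>v\<close>.\<close>

lemma trace_split:
  assumes "trace y w = xs @ t" "xs \<noteq> []"
  shows "\<exists>x a v. w = x @ (a # v) \<and> last xs = (Res (v @ y), a) \<and> trace y v = t \<and>
    \<not> (cycle_edge (v @ y) a)"
  using assms
proof (induction w arbitrary: xs)
  case (Cons a w)
  show ?case
  proof (cases "cycle_edge (w @ y) a")
    case True
    then have "trace y w = xs @ t" using Cons.prems by simp
    with Cons.IH Cons.prems(2) obtain x a' v where "w = x @ a' # v" "last xs = (Res (v @ y), a')"
      "trace y v = t" "\<not> cycle_edge (v @ y) a'" by blast
    then show ?thesis by (intro exI[of _ "a # x"]) auto
  next
    case False
    then obtain xs' where xs': "xs = (Res (w @ y), a) # xs'" "trace y w = xs' @ t"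
      using Cons.prems by (cases xs) auto
    show ?thesis
    proof (cases "xs' = []")
      case True
      then show ?thesis using xs' False by (intro exI[of _ "[]"]) auto
    next
      case nonempty: False
      with Cons.IH xs' obtain x a' v where "w = x @ a' # v" "last xs' = (Res (v @ y), a')"
        "trace y v = t" "\<not> cycle_edge (v @ y) a'" by blast
      then show ?thesis using xs' nonempty by (intro exI[of _ "a # x"]) auto
    qed
  qed
qed simp

lemma trace_Cons_split:
  assumes "trace y w = t # T"
  obtains x a v where "w = x @ a # v" "t = (Res (v @ y), a)" "trace y v = T"
    "trace (a # v @ y) x = []" "\<not> cycle_edge (v @ y) a"
proof -
  obtain x a v where *: "w = x @ a # v" "t = (Res (v @ y), a)" "trace y v = T" "\<not> cycle_edge (v @ y) a"
    using trace_split[of y w "[t]" T] assms by auto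
  then have "trace (a # v @ y) x = []"
    using assms trace_append[of y x "a # v"] by simp
  with * show thesis using that by blast
qed

text \<open>Both words run along the one cycle through their source between the same two states.
  Primitivity makes the incomplete turn \<open>r\<close> the same for both, so only the number of
  full turns can differ.\<close>

lemma traceless_unique:
  assumes "trace y x = []" "trace y x' = []" "Res (x @ y) = Res (x' @ y)"
  shows "x = x' \<or> (\<exists>c k. on_cycle c (x @ y) \<and> (x = list_pow c (Suc k) @ x' \<or> x' = list_pow c (Suc k) @ x))"
proof (cases "x = [] \<and> x' = []")
  case False
  obtain c e where c: "on_cycle c y" "e \<in> cyclic_perms c" "on_cycle e (x @ y)" "on_cycle e (x' @ y)"
    using False trace_Nil_cycle[OF assms(1)] trace_Nil_cycle[OF assms(2)] on_cycle_cong[OF assms(3)] by blast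
  obtain r s m where 1: "c = s @ r" "s \<noteq> []" "e = r @ s" "x = r @ list_pow c m"
    using on_cycle_stay[OF c(1,3,2)] .
  obtain r' s' m' where 2: "c = s' @ r'" "s' \<noteq> []" "e = r' @ s'" "x' = r' @ list_pow c m'"
    using on_cycle_stay[OF c(1,4,2)] .
  have r: "r' = r" using primitive_rotation_unique[of c s r s' r'] cband_primitive[OF on_cycleD(1)[OF c(1)]] 1 2
    by metis
  have *: "r @ list_pow c (k + n) = list_pow e k @ r @ list_pow c n" for k n
    unfolding 1(1,3) list_pow_add by (simp add: list_pow_rotate_append)
  consider "m = m'" | k where "m = Suc k + m'" | k where "m' = Suc k + m"
    by (metis add.commute less_imp_Suc_add linorder_neqE_nat add_Suc_right)
  then show ?thesis
  proof cases
    case 1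
    then show ?thesis using \<open>x = _\<close> \<open>x' = _\<close> r by simp
  next
    case (2 k)
    have "x = list_pow e (Suc k) @ x'" using \<open>x = _\<close> \<open>x' = _\<close> r 2 * by metis
    then show ?thesis using c(3) by blast
  next
    case (3 k)
    have "x' = list_pow e (Suc k) @ x" using \<open>x = _\<close> \<open>x' = _\<close> r 3 * by metis
    then show ?thesis using c(3) by blast
  qed
qed simp

section \<open>Recovering a word from its non-cyclic edges\<close>

lemma loop_append: assumes "loop y v e" shows "loop y (x @ v) e"
proof -
  obtain w2 w1 where "v = w2 @ e @ w1" "on_cycle e (w1 @ y)" using assms unfolding loop_def by blast
  then show ?thesis unfolding loop_def by (intro exI[of _ "x @ w2"] exI[of _ w1]) simp
qed

lemma loop_append_base: assumes "loop (v @ y) x e" shows "loop y (x @ v) e"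
proof -
  obtain w2 w1 where "x = w2 @ e @ w1" "on_cycle e (w1 @ v @ y)" using assms unfolding loop_def by blast
  then show ?thesis unfolding loop_def by (intro exI[of _ w2] exI[of _ "w1 @ v"]) simp
qed

lemma loop_pow: "on_cycle c (x @ y) \<Longrightarrow> loop y (list_pow c (Suc k) @ x) c"
  unfolding loop_def by (intro exI[of _ "[]"] exI[of _ "list_pow c k @ x"]) (auto simp: on_cycle_pow)

lemma traceless_loop_free_unique:
  assumes "trace y x = []" "trace y x' = []" "Res (x @ y) = Res (x' @ y)"
    and "\<And>e. \<not> loop y x e" "\<And>e. \<not> loop y x' e"
  shows "x = x'"
proof -
  have False if c: "on_cycle c (x @ y)" and k: "x = list_pow c (Suc k) @ x' \<or> x' = list_pow c (Suc k) @ x" for c k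
  proof -
    have "on_cycle c (x' @ y)" using c on_cycle_cong[OF assms(3)] by blast
    then show False using loop_pow[of c x' y k] loop_pow[OF c, of k] k assms(4,5) by auto
  qed
  then show ?thesis using traceless_unique[OF assms(1-3)] by blast
qed

text \<open>Between two non-cyclic edges the words can differ only by full turns around a cycle, and
  each full turn would be a loop.\<close>

lemma loop_free_unique:
  assumes "trace y w = trace y w'" "Res (w @ y) = Res (w' @ y)"
    and "\<And>e. \<not> loop y w e" "\<And>e. \<not> loop y w' e"
  shows "w = w'"
  using assms
proof (induction "trace y w" arbitrary: w w')
  case Nil
  then show ?case using traceless_loop_free_unique[of y w w'] by metis
next
  case (Cons t T)
  obtain x a v where 1: "w = x @ a # v" "t = (Res (v @ y), a)" "trace y v = T" "trace (a # v @ y) x = []"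
    using trace_Cons_split[of y w t T] Cons.hyps by metis
  obtain x' a' v' where 2: "w' = x' @ a' # v'" "t = (Res (v' @ y), a')" "trace y v' = T" "trace (a' # v' @ y) x' = []"
    using trace_Cons_split[of y w' t T] Cons.hyps Cons.prems by metis
  have w: "w = (x @ [a]) @ v" "w' = (x' @ [a']) @ v'" "w = x @ ([a] @ v)" "w' = x' @ ([a'] @ v')" using 1 2 by auto
  have v: "v = v'"
  proof (rule Cons.hyps(1))
    show "\<And>e. \<not> loop y v e" "\<And>e. \<not> loop y v' e" using loop_append w Cons.prems by metis+
  qed (use 1 2 in auto)
  have a: "a = a'" using 1 2 by simp
  have "x = x'"
  proof (rule traceless_loop_free_unique)
    show "trace ([a] @ v @ y) x = []" "trace ([a] @ v @ y) x' = []" using 1 2 a v by auto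
    show "Res (x @ [a] @ v @ y) = Res (x' @ [a] @ v @ y)" using Cons.prems w a v by simp
    show "\<not> loop ([a] @ v @ y) x e" "\<not> loop ([a] @ v @ y) x' e" for e
      using loop_append_base[of "[a] @ v" y x e] loop_append_base[of "[a] @ v" y x' e] w a v
        Cons.prems(3)[of e] Cons.prems(4)[of e] by auto
  qed
  then show ?case using 1 2 a v by simp
qed

lemma loop_free_but_last_unique:
  assumes tr: "trace y w = trace y w'" and c: "on_cycle c (w @ y)" "on_cycle c (w' @ y)"
    and loops: "\<And>e. loop y w e \<Longrightarrow> e \<in> cyclic_perms c" "\<And>e. loop y w' e \<Longrightarrow> e \<in> cyclic_perms c"
  shows "\<exists>k. w = list_pow c k @ w' \<or> w' = list_pow c k @ w"
proof -
  have Req: "Res (w @ y) = Res (w' @ y)" using c unfolding on_cycle_def by simp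
  show ?thesis
  proof (cases "trace y w")
    case Nil
    then have "w = w' \<or> (\<exists>k. w = list_pow c (Suc k) @ w' \<or> w' = list_pow c (Suc k) @ w)"
      using traceless_unique[of y w w'] tr Req on_cycle_unique[OF c(1)] by (auto simp del: list_pow_Suc)
    then show ?thesis by (metis append_Nil list_pow_0)
  next
    case (Cons t T)
    obtain x a v where 1: "w = x @ a # v" "t = (Res (v @ y), a)" "trace y v = T"
      "trace (a # v @ y) x = []" "\<not> cycle_edge (v @ y) a"
      using trace_Cons_split[of y w t T] Cons by metis
    obtain x' a' v' where 2: "w' = x' @ a' # v'" "t = (Res (v' @ y), a')" "trace y v' = T"
      "trace (a' # v' @ y) x' = []" "\<not> cycle_edge (v' @ y) a'"
      using trace_Cons_split[of y w' t T] Cons tr by metis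
    have a: "a = a'" using 1 2 by simp
    \<comment> \<open>A rotated \<open>c\<close> occurring as a loop before the non-cyclic edge
      \<open>a\<close> would mean that the path is on the cycle of \<open>c\<close> before
      \<open>a\<close> and again at its end; it then never leaves this cycle, contrary to
      \<open>a\<close>.\<close>
    have no_loop: "\<not> loop y v e" if w: "w = x @ a # v" and on_c: "on_cycle c (w @ y)"
      and loops: "\<And>e. loop y w e \<Longrightarrow> e \<in> cyclic_perms c" and na: "\<not> cycle_edge (v @ y) a" for w x a v e
    proof
      assume l: "loop y v e"
      then have "loop y w e" using loop_append[of y v e "x @ [a]"] w by simp
      then have ce: "c \<in> cyclic_perms e" using loops cyclic_perms_sym by blast
      obtain v2 v1 where v: "v = v2 @ e @ v1" "on_cycle e (v1 @ y)" using l unfolding loop_def by blast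
      have "on_cycle c ((x @ a # v2 @ e) @ v1 @ y)" using on_c w v by simp
      from trace_stay[OF v(2) this ce] have "trace (v1 @ y) (x @ a # v2 @ e) = []" .
      then show False using na v by (simp add: trace_append)
    qed
    have v: "v = v'"
      by (rule loop_free_unique[of y])
        (use 1 2 in simp, use 1 2 in simp, rule no_loop[OF 1(1) c(1) loops(1) 1(5)],
          assumption, rule no_loop[OF 2(1) c(2) loops(2) 2(5)], assumption)
    have "Res (x @ [a] @ v @ y) = Res (x' @ [a] @ v @ y)" using Req 1 2 a v by simp
    moreover have "trace ([a] @ v @ y) x = []" "trace ([a] @ v @ y) x' = []" using 1 2 a v by auto
    ultimately have "x = x' \<or> (\<exists>c k. on_cycle c (x @ [a] @ v @ y) \<and>
      (x = list_pow c (Suc k) @ x' \<or> x' = list_pow c (Suc k) @ x))"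
      using traceless_unique[of "[a] @ v @ y" x x'] by simp
    moreover have "on_cycle c (x @ [a] @ v @ y)" using c 1 by simp
    ultimately have "x = x' \<or> (\<exists>k. x = list_pow c (Suc k) @ x' \<or> x' = list_pow c (Suc k) @ x)"
      using on_cycle_unique by blast
    then show ?thesis
    proof
      assume "x = x'"
      then show ?thesis using 1(1) 2(1) a v by (intro exI[of _ 0]) simp
    next
      assume "\<exists>k. x = list_pow c (Suc k) @ x' \<or> x' = list_pow c (Suc k) @ x"
      then obtain k where "x = list_pow c (Suc k) @ x' \<or> x' = list_pow c (Suc k) @ x" by blast
      then show ?thesis using 1(1) 2(1) a v by (intro exI[of _ "Suc k"]) auto
    qed
  qed
qed

text \<open>Loops of the last band \<open>c\<close> have to be admitted, because its occurrence at the end is kept even if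
  it is removable; the condition \<open>\<not> prefix c w\<close> then fixes the number of turns around \<open>c\<close>.\<close>

lemma reduced_unique:
  assumes "trace y (c @ w) = trace y (c @ w')" "on_cycle c (c @ w @ y)" "on_cycle c (c @ w' @ y)"
    and "\<And>e. loop y (c @ w) e \<Longrightarrow> e \<in> cyclic_perms c" "\<And>e. loop y (c @ w') e \<Longrightarrow> e \<in> cyclic_perms c"
    and np: "\<not> prefix c w" "\<not> prefix c w'"
  shows "w = w'"
proof -
  obtain k where k: "c @ w = list_pow c k @ c @ w' \<or> c @ w' = list_pow c k @ c @ w"
    using loop_free_but_last_unique[OF assms(1) _ _ assms(4,5)] assms(2,3) by auto
  show ?thesis
  proof (cases k)
    case (Suc m)
    have "list_pow c m @ c @ u = c @ list_pow c m @ u" for u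
      by (metis append.assoc list_pow_commute)
    with k Suc have "w = c @ list_pow c m @ w' \<or> w' = c @ list_pow c m @ w" by auto
    then show ?thesis using np by auto
  qed (use k in auto)
qed

section \<open>Counting and removing bands\<close>

text \<open>The path \<open>x\<close> stays on a single cycle, so a full turn made before it and a
  full turn made after it give the same word.\<close>

lemma on_cycle_shift:
  assumes "on_cycle c y" "on_cycle e (x @ y)" "e \<in> cyclic_perms c"
  shows "x @ c = e @ x"
proof -
  obtain r s m where *: "c = s @ r" "e = r @ s" "x = r @ list_pow c m" using on_cycle_stay[OF assms] by metis
  have "x @ c = r @ list_pow (s @ r) (Suc m)" unfolding * by (simp add: list_pow_commute[of "s @ r", simplified])
  also have "\<dots> = list_pow (r @ s) (Suc m) @ r" by (rule list_pow_rotate[symmetric])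
  also have "\<dots> = e @ x" unfolding * by (simp add: list_pow_rotate)
  finally show ?thesis .
qed

lemma removal_unique_aux:
  assumes "S (y2 @ c @ y1)" "y2 @ c @ y1 = z2 @ e @ z1" "cband c" "e \<in> cyclic_perms c" "length y1 \<le> length z1"
  shows "y2 @ y1 = z2 @ z1"
proof -
  have e: "cband e" "length e = length c" using assms cband_cyclic cyclic_perms_length by auto
  have "S (c @ y1)" "S (e @ z1)" using S_suffix assms(1,2) cband_not_Nil assms(3) e by (metis Nil_is_append_conv)+
  obtain x where x: "e @ z1 = x @ c @ y1" "y2 = z2 @ x"
    using append_eq_shorter_suffix[OF assms(2)] assms(5) e(2) by auto
  have "on_cycle c (c @ y1)" "on_cycle e (x @ c @ y1)"
    using on_cycle_append assms(3) e \<open>S (c @ y1)\<close> \<open>S (e @ z1)\<close> x by metis+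
  from on_cycle_shift[OF this assms(4)] have "x @ c = e @ x" .
  with x(1) have "e @ z1 = e @ x @ y1" by (metis append.assoc)
  then have "z1 = x @ y1" by simp
  then show ?thesis using x(2) by simp
qed

text \<open>Between two occurrences of one band the path never leaves its cycle, so the deleted turn
  can be slid from one to the other. This makes the choice in \<open>R\<close> harmless.\<close>

lemma removal_unique:
  assumes "S (y2 @ c @ y1)" "y2 @ c @ y1 = z2 @ e @ z1" "cband c" "e \<in> cyclic_perms c"
  shows "y2 @ y1 = z2 @ z1"
  using removal_unique_aux[OF assms] removal_unique_aux[of z2 e z1 y2 c y1] assms cband_cyclic cyclic_perms_sym
  by (metis nat_le_linear)

text \<open>The counterpart of the exponent N(b,y) on plain lists, identified with it in
  \<open>N_eq_power_count\<close>.\<close>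

definition power_count :: "'l list \<Rightarrow> 'l list \<Rightarrow> nat" where
  "power_count b y = Max (insert 0 {n. n \<ge> 1 \<and> (\<exists>b'\<in>cyclic_perms b. sublist (list_pow b' n) y)})"

lemma power_count_ge:
  assumes "b \<noteq> []" "n \<ge> 1"
  shows "n \<le> power_count b y \<longleftrightarrow> (\<exists>b'\<in>cyclic_perms b. sublist (list_pow b' n) y)"
proof -
  let ?N = "{n. n \<ge> 1 \<and> (\<exists>b'\<in>cyclic_perms b. sublist (list_pow b' n) y)}"
  have "m \<le> length y" if m: "m \<in> ?N" for m
  proof -
    obtain b' where b': "b' \<in> cyclic_perms b" "sublist (list_pow b' m) y" using m by blast
    have "m * length b \<le> length y" using sublist_length_le[OF b'(2)] cyclic_perms_length[OF b'(1)] by simp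
    moreover have "m * 1 \<le> m * length b" using assms(1) by (intro mult_le_mono) (auto simp: Suc_le_eq)
    ultimately show ?thesis by linarith
  qed
  then have fin: "finite ?N" by (meson finite_nat_set_iff_bounded_le)
  show ?thesis
  proof
    assume "n \<le> power_count b y"
    moreover have "power_count b y \<in> insert 0 ?N" unfolding power_count_def using fin by (intro Max_in) auto
    ultimately obtain b' where b': "b' \<in> cyclic_perms b" "sublist (list_pow b' (power_count b y)) y"
      using assms(2) by auto
    have "power_count b y = n + (power_count b y - n)" using \<open>n \<le> _\<close> by simp
    then have "sublist (list_pow b' n) (list_pow b' (power_count b y))"
      by (metis list_pow_add sublist_append_rightI)
    then show "\<exists>b'\<in>cyclic_perms b. sublist (list_pow b' n) y" using b' sublist_order.order.trans by blast
  next
    assume "\<exists>b'\<in>cyclic_perms b. sublist (list_pow b' n) y"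
    then show "n \<le> power_count b y" unfolding power_count_def using fin assms(2) by (intro Max_ge) auto
  qed
qed

text \<open>By \<open>on_cycle_shift\<close> the inserted turn can be slid to a power of the same
  band elsewhere in the word, which it lengthens by one.\<close>

lemma power_count_insert:
  assumes b: "cband b'" "b' \<in> cyclic_perms b" and y: "S (y2 @ b' @ y1)" "on_cycle b' y1"
    and n: "n \<ge> 1" "n \<le> power_count b (y2 @ y1)"
  shows "Suc n \<le> power_count b (y2 @ b' @ y1)"
proof -
  have bne: "b \<noteq> []" using b cband_not_Nil cyclic_perms_length by fastforce
  obtain c z2 z1 where c: "c \<in> cyclic_perms b" "y2 @ y1 = z2 @ list_pow c n @ z1"
    using n power_count_ge[OF bne n(1)] unfolding sublist_def by blast
  have cc: "c \<in> cyclic_perms b'" "b' \<in> cyclic_perms c" using c(1) b(2) cyclic_perms_sym cyclic_perms_trans by blast+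
  then have cb: "cband c" using b(1) cband_cyclic by blast
  have "S (y2 @ y1)" using S_prefix[of "y2 @ b'" y1] y on_cycleD(6)[OF y(2), of y2] cband_not_Nil[OF b(1)] by simp
  then have "S (list_pow c n @ z1)" using S_suffix c(2) cband_not_Nil[OF cb] n(1)
    by (metis Nil_is_append_conv list_pow_eq_Nil not_one_le_zero)
  moreover have p: "list_pow c n = c @ list_pow c (n - 1)" using n(1) by (cases n) auto
  ultimately have on_c: "on_cycle c (list_pow c n @ z1)" using on_cycle_append[OF cb, of "list_pow c (n - 1) @ z1"] by simp
  have "\<exists>u v. y2 @ b' @ y1 = u @ c @ list_pow c n @ v"
  proof (cases "length y1 \<le> length (list_pow c n @ z1)")
    case True
    obtain x where x: "list_pow c n @ z1 = x @ y1" "y2 = z2 @ x"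
      using append_eq_shorter_suffix[OF c(2) True] by metis
    have "x @ b' = c @ x" using on_cycle_shift[OF y(2) _ cc(1)] on_c x by metis
    then have "y2 @ b' @ y1 = z2 @ c @ list_pow c n @ z1" using x by (metis append.assoc)
    then show ?thesis by blast
  next
    case False
    then have "length (list_pow c n @ z1) \<le> length y1" by simp
    from append_eq_shorter_suffix[OF c(2)[symmetric] this]
    obtain x where x: "y1 = x @ list_pow c n @ z1" by metis
    have "x @ c = b' @ x" using on_cycle_shift[OF on_c _ cc(2)] y(2) x by metis
    then have "y2 @ b' @ y1 = (y2 @ x) @ c @ list_pow c n @ z1" using x by (metis append.assoc)
    then show ?thesis by blast
  qed
  then have "sublist (list_pow c (Suc n)) (y2 @ b' @ y1)" unfolding sublist_def by auto
  then show ?thesis using power_count_ge[OF bne, of "Suc n"] c(1) by auto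
qed

lemma power_count_remove:
  assumes b: "cband b'" "b' \<in> cyclic_perms b" and y: "S (y2 @ b' @ y1)"
    and n: "n \<ge> 1" "Suc n \<le> power_count b (y2 @ b' @ y1)"
  shows "n \<le> power_count b (y2 @ y1)"
proof -
  have bne: "b \<noteq> []" using b cband_not_Nil cyclic_perms_length by fastforce
  obtain c z2 z1 where c: "c \<in> cyclic_perms b" "y2 @ b' @ y1 = z2 @ list_pow c (Suc n) @ z1"
    using n power_count_ge[OF bne, of "Suc n"] unfolding sublist_def by auto
  have "c \<in> cyclic_perms b'" using c(1) b(2) cyclic_perms_sym cyclic_perms_trans by blast
  then have "y2 @ y1 = z2 @ list_pow c n @ z1"
    using removal_unique[OF y _ b(1), of z2 c "list_pow c n @ z1"] c(2) by simp
  then show ?thesis using power_count_ge[OF bne n(1)] c(1) unfolding sublist_def by blast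
qed

lemma power_count_double:
  assumes b: "cband b'" "b' \<in> cyclic_perms b" and y: "S (y2 @ b' @ b' @ y1)"
  shows "power_count b (y2 @ b' @ b' @ y1) = Suc (power_count b (y2 @ b' @ y1))"
proof -
  have bne: "b \<noteq> []" using b cband_not_Nil cyclic_perms_length by fastforce
  let ?n = "power_count b (y2 @ b' @ y1)"
  have "sublist (list_pow b' 1) (y2 @ b' @ y1)" by simp
  then have n: "?n \<ge> 1" using power_count_ge[OF bne, of 1] b(2) by blast
  have "S (b' @ y1)" using S_suffix[of "y2 @ b'" "b' @ y1"] y cband_not_Nil[OF b(1)] by simp
  then have "on_cycle b' (b' @ y1)" using on_cycle_append b by blast
  then have "Suc ?n \<le> power_count b (y2 @ b' @ b' @ y1)" using power_count_insert[OF b y _ n] by simp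
  moreover have "\<not> Suc (Suc ?n) \<le> power_count b (y2 @ b' @ b' @ y1)"
    using power_count_remove[OF b y, of "Suc ?n"] by auto
  ultimately show ?thesis by simp
qed

lemma band_in_power:
  assumes "cband c" "cband e" "list_pow c n = t2 @ e @ t1"
  shows "e \<in> cyclic_perms c"
proof -
  have on: "on_cycle c (list_pow c n @ c)" using on_cycle_pow[OF on_cycle_self[OF assms(1)]] .
  have "S ((t2 @ e @ t1) @ c)" using on_cycleD(3)[OF on] assms(3) by simp
  then have "S (e @ t1 @ c)" using S_suffix[of t2 "e @ t1 @ c"] cband_not_Nil[OF assms(2)] by simp
  then have "on_cycle e ((e @ t1) @ c)" using on_cycle_append[OF assms(2)] by simp
  moreover have "on_cycle c (t2 @ (e @ t1) @ c)" using on assms(3) by simp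
  ultimately show ?thesis by (rule on_cycle_no_return[OF on_cycle_self[OF assms(1)] _ _ cyclic_perms_refl])
qed

text \<open>An occurrence of the power that spans the doubled place would either contain a copy of
  \<open>b\<close> or end on the cycle of \<open>b\<close>; both would make \<open>e\<close> a
  rotation of \<open>b\<close>. Every other occurrence lies on one side and survives.\<close>

lemma power_sublist_double:
  assumes b: "cband b" and e: "cband e" "e \<notin> cyclic_perms b" and y: "S (y2 @ b @ b @ y1)" and n: "n \<ge> 1"
  shows "sublist (list_pow e n) (y2 @ b @ b @ y1) \<longleftrightarrow> sublist (list_pow e n) (y2 @ b @ y1)"
proof
  let ?p = "list_pow e n"
  have nested: "\<not> (\<exists>t u. ?p = t @ b @ u)" using band_in_power[OF e(1) b] e(2) cyclic_perms_sym by blast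
  { assume "sublist ?p (y2 @ b @ b @ y1)"
    then obtain z2 z1 where z: "z2 @ ?p @ z1 = y2 @ b @ b @ y1" unfolding sublist_def by metis
    consider "length (?p @ z1) \<le> length (b @ y1)" | "length (b @ y1) \<le> length z1"
      | "length z1 \<le> length (b @ y1)" "length (b @ y1) \<le> length (?p @ z1)" "length (?p @ z1) \<le> length (b @ b @ y1)"
      | "length z1 \<le> length (b @ y1)" "length (b @ b @ y1) \<le> length (?p @ z1)" by linarith
    then show "sublist ?p (y2 @ b @ y1)"
    proof cases
      case 1
      have "z2 @ (?p @ z1) = (y2 @ b) @ (b @ y1)" using z by simp
      from append_eq_shorter_suffix[OF this 1] obtain t where "b @ y1 = t @ ?p @ z1" by metis
      then have "y2 @ b @ y1 = (y2 @ t) @ ?p @ z1" by simp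
      then show ?thesis unfolding sublist_def by blast
    next
      case 2
      have "(y2 @ b) @ (b @ y1) = (z2 @ ?p) @ z1" using z by simp
      from append_eq_shorter_suffix[OF this 2] obtain t where "y2 @ b = (z2 @ ?p) @ t" by metis
      then have "y2 @ b @ y1 = z2 @ ?p @ (t @ y1)" by (metis append.assoc)
      then show ?thesis unfolding sublist_def by blast
    next
      case 3
      have "(y2 @ b) @ (b @ y1) = z2 @ (?p @ z1)" using z by simp
      from append_eq_shorter_suffix[OF this 3(2)] obtain t where t: "?p @ z1 = t @ b @ y1" "y2 @ b = z2 @ t" by metis
      have "y2 @ b = z2 @ t" by (rule t)
      moreover have "length t \<le> length b" using arg_cong[OF t(1), of length] 3(3) by simp
      ultimately obtain t' where t': "b = t' @ t" using append_eq_shorter_suffix[of z2 t y2 b] by metis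
      have Sb: "S (b @ y1)" "S (?p @ z1)"
        using S_suffix[of "y2 @ b" "b @ y1"] S_suffix[of z2 "?p @ z1"] y z cband_not_Nil b e n by auto
      have "on_cycle (t' @ t) (b @ y1)" using on_cycle_append[OF b Sb(1)] t' by simp
      then have "on_cycle (t @ t') (?p @ z1)" using on_cycle_rotate t(1) by metis
      moreover have "on_cycle e (?p @ z1)"
        using on_cycle_append[OF e(1), of "list_pow e (n - 1) @ z1"] Sb(2) n by (cases n) auto
      ultimately have "e = t @ t'" using on_cycle_unique by blast
      then have "e \<in> cyclic_perms b" using t' unfolding cyclic_perms_iff by blast
      then show ?thesis using e by simp
    next
      case 4
      have "y2 @ (b @ b @ y1) = z2 @ (?p @ z1)" using z by simp
      from append_eq_shorter_suffix[OF this 4(2)] obtain t where t: "?p @ z1 = t @ b @ b @ y1" by metis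
      have "(y2 @ b) @ (b @ y1) = (z2 @ ?p) @ z1" using z by simp
      from append_eq_shorter_suffix[OF this[symmetric] 4(1)] obtain u where u: "b @ y1 = u @ z1" by metis
      have "?p = t @ b @ u" using t u by (metis append.assoc append_same_eq)
      then show ?thesis using nested by blast
    qed }
  { assume "sublist ?p (y2 @ b @ y1)"
    then obtain z2 z1 where z: "z2 @ ?p @ z1 = y2 @ b @ y1" unfolding sublist_def by metis
    consider "length y1 \<le> length z1" | "length (?p @ z1) \<le> length (b @ y1)"
      | "length z1 \<le> length y1" "length (b @ y1) \<le> length (?p @ z1)" by linarith
    then show "sublist ?p (y2 @ b @ b @ y1)"
    proof cases
      case 1
      have "(y2 @ b) @ y1 = (z2 @ ?p) @ z1" using z by simp
      from append_eq_shorter_suffix[OF this 1] obtain t where "y2 @ b = (z2 @ ?p) @ t" by metis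
      then have "y2 @ b @ b @ y1 = z2 @ ?p @ (t @ b @ y1)" by (metis append.assoc)
      then show ?thesis unfolding sublist_def by blast
    next
      case 2
      have "z2 @ (?p @ z1) = y2 @ (b @ y1)" using z by simp
      from append_eq_shorter_suffix[OF this 2] obtain t where "b @ y1 = t @ ?p @ z1" by metis
      then have "y2 @ b @ b @ y1 = (y2 @ b @ t) @ ?p @ z1" by simp
      then show ?thesis unfolding sublist_def by blast
    next
      case 3
      have "y2 @ (b @ y1) = z2 @ (?p @ z1)" using z by simp
      from append_eq_shorter_suffix[OF this 3(2)] obtain t where t: "?p @ z1 = t @ b @ y1" by metis
      have "(z2 @ ?p) @ z1 = (y2 @ b) @ y1" using z by simp
      from append_eq_shorter_suffix[OF this 3(1)] obtain u where u: "y1 = u @ z1" by metis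
      have "?p = t @ b @ u" using t u by (metis append.assoc append_same_eq)
      then show ?thesis using nested by blast
    qed }
qed

lemma power_count_double_other:
  assumes b: "cband b" and c: "cband c" "c \<notin> cyclic_perms b" and y: "S (y2 @ b @ b @ y1)"
  shows "power_count c (y2 @ b @ b @ y1) = power_count c (y2 @ b @ y1)"
proof -
  have "e \<notin> cyclic_perms b" "cband e" if "e \<in> cyclic_perms c" for e
    using c cyclic_perms_trans cyclic_perms_sym cband_cyclic that by blast+
  then have "(n \<ge> 1 \<and> (\<exists>b'\<in>cyclic_perms c. sublist (list_pow b' n) (y2 @ b @ b @ y1))) \<longleftrightarrow>
    (n \<ge> 1 \<and> (\<exists>b'\<in>cyclic_perms c. sublist (list_pow b' n) (y2 @ b @ y1)))" for n
    using power_sublist_double[OF b _ _ y, of _ n] by blast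
  then show ?thesis unfolding power_count_def by simp
qed

lemma loop_remove:
  assumes c: "on_cycle c (w1 @ y)" and l: "loop y (w2 @ w1) e"
  shows "loop y (w2 @ c @ w1) e"
proof -
  obtain v2 v1 where v: "w2 @ w1 = v2 @ e @ v1" "on_cycle e (v1 @ y)" using l unfolding loop_def by blast
  consider "length w1 \<le> length v1" | "length (e @ v1) \<le> length w1"
    | "length v1 \<le> length w1" "length w1 \<le> length (e @ v1)" by linarith
  then show ?thesis
  proof cases
    case 1
    have "w2 @ w1 = (v2 @ e) @ v1" using v by simp
    from append_eq_shorter_suffix[OF this 1] obtain t where t: "v1 = t @ w1" "w2 = (v2 @ e) @ t" by metis
    have "Res (t @ c @ w1 @ y) = Res (t @ w1 @ y)" using Res_append[OF on_cycle_loop[OF c]] .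
    then have "on_cycle e ((t @ c @ w1) @ y)" using v(2) t unfolding on_cycle_def by simp
    then show ?thesis unfolding loop_def using t(2) by (intro exI[of _ v2] exI[of _ "t @ c @ w1"]) simp
  next
    case 2
    from append_eq_shorter_suffix[OF v(1)[symmetric] 2] obtain t where t: "w1 = t @ e @ v1" by metis
    show ?thesis unfolding loop_def using t v(2) by (intro exI[of _ "w2 @ c @ t"] exI[of _ v1]) simp
  next
    case 3
    \<comment> \<open>The place of deletion lies inside \<open>e\<close>, so \<open>c\<close> is a
      rotation of \<open>e\<close>. Before the deletion there were two consecutive turns
      \<open>e @ e\<close>, of which the second is the required loop.\<close>
    from append_eq_shorter_suffix[OF v(1) 3(2)] obtain t2 where t2: "e @ v1 = t2 @ w1" "w2 = v2 @ t2" by metis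
    from append_eq_shorter_suffix[OF t2(1) 3(1)] obtain t1 where t1: "w1 = t1 @ v1" "e = t2 @ t1" by metis
    have "on_cycle (t1 @ t2) (w1 @ y)" using on_cycle_rotate[of t2 t1 "v1 @ y"] v(2) t1 by simp
    then have "c = t1 @ t2" using on_cycle_unique c by blast
    moreover have "on_cycle e ((e @ v1) @ y)" using on_cycle_rotate[of "[]" e "v1 @ y"] v(2) by simp
    ultimately show ?thesis unfolding loop_def using t1 t2(2)
      by (intro exI[of _ v2] exI[of _ "e @ v1"]) simp
  qed
qed

text \<open>The starting band supplies a second turn: sliding it along \<open>w1\<close> changes
  \<open>e @ w1 @ b\<close> into \<open>e @ e @ w1\<close>.\<close>

lemma loop_on_start:
  assumes "cband b" "loop b w e" "e \<in> cyclic_perms b"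
  shows "sublist (e @ e) (w @ b)"
proof -
  obtain w2 w1 where w: "w = w2 @ e @ w1" "on_cycle e (w1 @ b)" using assms(2) unfolding loop_def by blast
  have "w1 @ b = e @ w1" by (rule on_cycle_shift[OF on_cycle_self[OF assms(1)] w(2) assms(3)])
  then have "w @ b = w2 @ (e @ e) @ w1" using w by simp
  then show ?thesis unfolding sublist_def by blast
qed

section \<open>Bands near the two ends of a string, and reductions that keep the ends\<close>

definition loop_free_word :: "'l list \<Rightarrow> bool" where
  "loop_free_word l \<longleftrightarrow> \<not> (\<exists>e. cband e \<and> sublist e l)"

lemma band_occurrence:
  assumes "turn_band b" "cband e" "S (x @ b @ y)" "sublist e (x @ b @ y)"
  shows "e \<in> cyclic_perms b \<or> sublist e x \<or> sublist e y"
proof -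
  obtain C D where C: "x @ b @ y = C @ e @ D" using assms(4) unfolding sublist_def by blast
  consider "length (e @ D) \<le> length y" | "length (b @ y) \<le> length D"
    | "length D < length (b @ y)" "length y < length (e @ D)" by linarith
  then show ?thesis
  proof cases
    case 1
    have "C @ (e @ D) = (x @ b) @ y" using C by simp
    from append_eq_shorter_suffix[OF this 1] obtain t where "y = t @ e @ D" by metis
    then show ?thesis unfolding sublist_def by blast
  next
    case 2
    have "x @ (b @ y) = (C @ e) @ D" using C by simp
    from append_eq_shorter_suffix[OF this 2] obtain t where "x = (C @ e) @ t" by metis
    then show ?thesis unfolding sublist_def by auto
  next
    case 3
    then show ?thesis using touching_band[OF assms(1-3) C] by blast
  qed
qed

lemma band_square_occurrence:
  assumes "turn_band b" "cband e" "S (x @ b @ y)" "sublist (e @ e) (x @ b @ y)" "e \<notin> cyclic_perms b"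
  shows "sublist (e @ e) x \<or> sublist (e @ e) y"
proof -
  obtain C D where C: "x @ b @ y = C @ e @ e @ D" using assms(4) unfolding sublist_def by auto
  consider "length (e @ e @ D) \<le> length y" | "length (b @ y) \<le> length D"
    | "length (e @ D) < length (b @ y)" "length y < length (e @ e @ D)"
    | "length D < length (b @ y)" "length y < length (e @ D)"
    using cband_not_Nil[OF turn_band_cband[OF assms(1)]] by (cases b) (auto, linarith)
  then show ?thesis
  proof cases
    case 1
    have "C @ (e @ e @ D) = (x @ b) @ y" using C by simp
    from append_eq_shorter_suffix[OF this 1] obtain t where "y = t @ e @ e @ D" by metis
    then show ?thesis unfolding sublist_def by auto
  next
    case 2
    have "x @ (b @ y) = (C @ e @ e) @ D" using C by simp
    from append_eq_shorter_suffix[OF this 2] obtain t where "x = (C @ e @ e) @ t" by metis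
    then show ?thesis unfolding sublist_def by auto
  next
    case 3
    then show ?thesis using touching_band[OF assms(1-3) C] assms(5) by simp
  next
    case 4
    have "x @ b @ y = (C @ e) @ e @ D" using C by simp
    from touching_band[OF assms(1-3) this] 4 show ?thesis using assms(5) by simp
  qed
qed

lemma disjoint_from_start:
  assumes "turn_band b" "cband e" "e \<notin> cyclic_perms b" "S (w @ b)" "w @ b = y2 @ e @ y1"
  obtains x where "y1 = x @ b" "w = y2 @ e @ x"
proof -
  have "\<not> length y1 < length (b @ [])"
    using touching_band[of b e w "[]" y2 y1] assms cband_not_Nil[OF assms(2)] by auto
  then have "length b \<le> length y1" by simp
  moreover have "w @ b = (y2 @ e) @ y1" using assms(5) by simp
  ultimately obtain x where "y1 = x @ b" "w = (y2 @ e) @ x" using append_eq_shorter_suffix by metis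
  then show thesis using that by simp
qed

lemma disjoint_from_end:
  assumes "turn_band c" "cband e" "e \<notin> cyclic_perms c" "S (c @ v)" "c @ v = y2 @ e @ y1"
  obtains x where "y2 = c @ x" "v = x @ e @ y1"
proof -
  have "length y1 < length (c @ v)" using assms(5) cband_not_Nil[OF assms(2)] by simp
  then have "\<not> length v < length (e @ y1)"
    using touching_band[of c e "[]" v y2 y1] assms by auto
  then have "length (e @ y1) \<le> length v" by simp
  moreover have "y2 @ (e @ y1) = c @ v" using assms(5) by simp
  ultimately obtain x where "v = x @ e @ y1" "y2 = c @ x" using append_eq_shorter_suffix by metis
  then show thesis using that by simp
qed

text \<open>The invariant carried through all reductions of a string from \<open>b\<close> to
  \<open>c\<close>. Besides the trace it records that no new loop arises, which is needed when the
  result is compared with a single bridge in \<open>refined_unique\<close>.\<close>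

definition shrinks :: "'l list \<Rightarrow> 'l list \<Rightarrow> 'l list \<Rightarrow> 'l list \<Rightarrow> bool" where
  "shrinks b c y z \<longleftrightarrow> S z \<and> (\<exists>w w'. y = c @ w @ b \<and> z = c @ w' @ b \<and> trace b (c @ w') = trace b (c @ w) \<and>
     (\<forall>e. loop b (c @ w') e \<longrightarrow> loop b (c @ w) e))"

lemma shrinks_refl: "S (c @ w @ b) \<Longrightarrow> shrinks b c (c @ w @ b) (c @ w @ b)"
  unfolding shrinks_def by blast

lemma shrinks_trans: "shrinks b c x y \<Longrightarrow> shrinks b c y z \<Longrightarrow> shrinks b c x z"
  unfolding shrinks_def by (metis append_same_eq same_append_eq)

lemma shrinks_removal:
  assumes "on_cycle e (x @ b)" "S (y2 @ e @ x @ b)" "y2 @ e @ x = c @ w" "y2 @ x = c @ w'"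
  shows "shrinks b c (y2 @ e @ x @ b) (y2 @ x @ b)"
proof -
  have "S (y2 @ x @ b)"
    using S_prefix[of "y2 @ e" "x @ b"] assms(2) on_cycleD(1,6)[OF assms(1)] cband_not_Nil by auto
  moreover have "y2 @ e @ x @ b = c @ w @ b" "y2 @ x @ b = c @ w' @ b"
    using assms(3,4) by (metis append.assoc)+
  moreover have "trace b (c @ w') = trace b (c @ w)"
    using trace_remove_loop[OF assms(1)] assms(3,4) by metis
  moreover have "loop b (c @ w') e' \<Longrightarrow> loop b (c @ w) e'" for e'
    using loop_remove[OF assms(1)] assms(3,4) by metis
  ultimately show ?thesis unfolding shrinks_def by blast
qed

lemma shrinks_removal_other:
  assumes bc: "turn_band b" "turn_band c" and e: "e \<notin> cyclic_perms b" "e \<notin> cyclic_perms c" "on_cycle e y1"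
    and y: "S (c @ w @ b)" "c @ w @ b = y2 @ e @ y1"
  shows "shrinks b c (y2 @ e @ y1) (y2 @ y1)"
proof -
  have ce: "cband e" using on_cycleD(1)[OF e(3)] .
  obtain x where x: "y1 = x @ b" "c @ w = y2 @ e @ x"
    using disjoint_from_start[OF bc(1) ce e(1), of "c @ w" y2 y1] y by auto
  obtain u where u: "y2 = c @ u"
    using disjoint_from_end[OF bc(2) ce e(2), of "w @ b" y2 y1] y by auto
  show ?thesis using shrinks_removal[of e x b y2 c w "u @ x"] e(3) y x u by simp
qed

text \<open>The band \<open>e\<close> can overlap an end band only if it is a rotation of it, and
  then the copy of \<open>e\<close> that is kept is long enough to preserve this end. The copy to
  the right also puts the deleted one on its cycle.\<close>

lemma shrinks_double:
  assumes bc: "turn_band b" "turn_band c" "c \<notin> cyclic_perms b" and e: "cband e"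
    and y: "S (c @ w @ b)" "c @ w @ b = y2 @ e @ e @ y1"
  shows "shrinks b c (y2 @ e @ e @ y1) (y2 @ e @ y1)"
proof -
  have "S (e @ y1)" using S_suffix[of "y2 @ e" "e @ y1"] y cband_not_Nil[OF e] by simp
  then have on_e: "on_cycle e (e @ y1)" using on_cycle_append[OF e] by blast
  have "length e > 0" using cband_not_Nil[OF e] by simp
  consider "e \<in> cyclic_perms b" "e \<notin> cyclic_perms c" | "e \<in> cyclic_perms c" "e \<notin> cyclic_perms b"
    | "e \<notin> cyclic_perms b" "e \<notin> cyclic_perms c"
    using bc(3) cyclic_perms_sym cyclic_perms_trans by blast
  then show ?thesis
  proof cases
    case 1
    have "length b \<le> length (e @ y1)" using cyclic_perms_length[OF 1(1)] by simp
    moreover have "(c @ w) @ b = (y2 @ e) @ (e @ y1)" using y by simp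
    ultimately obtain x where x: "e @ y1 = x @ b" "c @ w = (y2 @ e) @ x" using append_eq_shorter_suffix by metis
    obtain u where u: "y2 = c @ u"
      using disjoint_from_end[OF bc(2) e 1(2), of "w @ b" y2 "e @ y1"] y by auto
    show ?thesis using shrinks_removal[of e x b y2 c w "u @ x"] on_e y x u by simp
  next
    case 2
    obtain x where x: "y1 = x @ b" "c @ w = y2 @ e @ e @ x"
      using disjoint_from_start[OF bc(1) e 2(2), of "c @ w" "y2 @ e" y1] y by auto
    have "length e = length c" using cyclic_perms_length[OF 2(1)] .
    moreover have "prefix (y2 @ e) (c @ w)" unfolding x(2) prefix_def by (metis append.assoc)
    ultimately have "prefix c (y2 @ e)"
      using prefix_length_prefix[of c "c @ w" "y2 @ e"] by simp
    then obtain u where u: "y2 @ e = c @ u" unfolding prefix_def by blast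
    then have "y2 @ e @ x = c @ u @ x" by (metis append.assoc)
    then show ?thesis using shrinks_removal[of e "e @ x" b y2 c w "u @ x"] on_e y x by simp
  next
    case 3
    show ?thesis by (rule shrinks_removal_other[OF bc(1,2) 3 on_e]) (use y in auto)
  qed
qed

end

section \<open>Bridges\<close>

locale band_representatives = domestic_turn_language S dir
  for S :: "'l list \<Rightarrow> bool" and dir :: "'l \<Rightarrow> bool" +
  fixes reps :: "'l list set"
  assumes reps_band: "b \<in> reps \<Longrightarrow> turn_band b"
    and reps_unique: "turn_band b \<Longrightarrow> \<exists>!b'. b' \<in> reps \<and> b' \<in> cyclic_perms b"
begin

lemma reps_cband: "b \<in> reps \<Longrightarrow> cband b"
  using reps_band turn_band_cband by blast

lemma reps_eq: "b \<in> reps \<Longrightarrow> c \<in> reps \<Longrightarrow> c \<in> cyclic_perms b \<Longrightarrow> c = b"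
  using reps_unique[of b] reps_band cyclic_perms_refl by blast

lemma rep_exists: assumes "cband e" obtains d where "d \<in> reps" "d \<in> cyclic_perms e"
proof -
  obtain b where b: "turn_band b" "e \<in> cyclic_perms b" using assms unfolding cband_def by blast
  obtain d where "d \<in> reps" "d \<in> cyclic_perms b" using reps_unique[OF b(1)] by blast
  then show thesis using that b(2) cyclic_perms_sym cyclic_perms_trans by blast
qed

definition bridge :: "'l list \<Rightarrow> 'l list \<Rightarrow> 'l list \<Rightarrow> bool" where
  "bridge b l c \<longleftrightarrow> b \<in> reps \<and> c \<in> reps \<and> S (c @ l @ b) \<and> loop_free_word l \<and> \<not> (b = c \<and> l = [])"

text \<open>Irreducibility in terms of states: the bridge meets no cycle but those of its two ends.
  Arch bridges have this property by \<open>arch_bridge_direct\<close>.\<close>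

definition direct_bridge :: "'l list \<Rightarrow> 'l list \<Rightarrow> 'l list \<Rightarrow> bool" where
  "direct_bridge b l c \<longleftrightarrow> bridge b l c \<and>
     (\<forall>w2 w1 d. c @ l = w2 @ w1 \<and> on_cycle d (w1 @ b) \<longrightarrow> d \<in> cyclic_perms b \<or> d \<in> cyclic_perms c)"

lemma bridgeD:
  assumes "bridge b l c"
  shows "b \<in> reps" "c \<in> reps" "S (c @ l @ b)" "on_cycle c ((c @ l) @ b)" "on_cycle b b"
proof -
  show *: "b \<in> reps" "c \<in> reps" "S (c @ l @ b)" using assms unfolding bridge_def by auto
  then show "on_cycle b b" using on_cycle_self reps_cband by blast
  show "on_cycle c ((c @ l) @ b)" using on_cycle_append[of c "l @ b"] reps_cband * by simp
qed

lemma loop_free_wordD: "loop_free_word l \<Longrightarrow> cband e \<Longrightarrow> \<not> sublist e l"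
  unfolding loop_free_word_def by blast

text \<open>A path from the cycle of \<open>b\<close> back to it never leaves it, so
  \<open>b @ l\<close> would be a power of \<open>b\<close>. Then \<open>l\<close> is either empty,
  which is the excluded trivial bridge, or contains a band.\<close>

lemma bridge_neq:
  assumes "bridge b l c" shows "b \<noteq> c"
proof
  assume bc: "b = c"
  note B = bridgeD[OF assms]
  have cb: "cband b" using reps_cband B by blast
  obtain r s m where rs: "b = s @ r" "s \<noteq> []" "b = r @ s" "b @ l = r @ list_pow b m"
    using on_cycle_stay[OF B(5), of b "b @ l"] B(4) bc cyclic_perms_refl by metis
  have "r = []"
    using primitive_rotation_unique[of b s r b "[]"] cband_primitive[OF cb] rs cband_not_Nil[OF cb] by auto
  then have m: "b @ l = list_pow b m" using rs by simp
  have "m \<noteq> 0" using m cband_not_Nil[OF cb] by (cases m) auto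
  then obtain k where k: "m = Suc k" by (cases m) auto
  then have l: "l = list_pow b k" using m by simp
  have "k \<noteq> 0" using l assms bc unfolding bridge_def by auto
  then have "sublist b l" using l by (cases k) auto
  then show False using loop_free_wordD cb assms unfolding bridge_def by blast
qed

lemma bridge_not_cyclic: "bridge b l c \<Longrightarrow> c \<notin> cyclic_perms b" "bridge b l c \<Longrightarrow> b \<notin> cyclic_perms c"
  using bridge_neq bridgeD reps_eq by metis+

section \<open>Walks of bridges and their traces\<close>

fun walk :: "'l list \<Rightarrow> ('l list \<times> 'l list \<times> 'l list) list \<Rightarrow> 'l list \<Rightarrow> bool" where
  "walk b [] b' \<longleftrightarrow> b = b'"
| "walk b ((b0, l, c) # P) b' \<longleftrightarrow> b0 = b \<and> bridge b l c \<and> walk c P b'"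

text \<open>The path string without its starting band, so that its trace can be taken from the state
  of that band and concatenated along the walk.\<close>

fun body :: "('l list \<times> 'l list \<times> 'l list) list \<Rightarrow> 'l list" where
  "body [] = []"
| "body ((b, l, c) # P) = body P @ c @ l"

lemma body_append: "body (P @ P') = body P' @ body P"
  by (induction P rule: body.induct) auto

lemma Res_bridge: "bridge b l c \<Longrightarrow> Res ((c @ l) @ b) = Res c"
  using bridgeD unfolding on_cycle_def by blast

lemma walk_on_cycle:
  "walk b P b' \<Longrightarrow> b \<in> reps \<Longrightarrow> b' \<in> reps \<and> on_cycle b' (body P @ b)"
proof (induction b P b' rule: walk.induct)
  case (1 b b')
  then show ?case using on_cycle_self reps_cband by simp
next
  case (2 b b0 l c P b')
  then have br: "bridge b l c" and w: "walk c P b'" by auto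
  then have "b' \<in> reps \<and> on_cycle b' (body P @ c)" using 2 bridgeD by blast
  moreover have "Res (body P @ (c @ l) @ b) = Res (body P @ c)" by (rule Res_append[OF Res_bridge[OF br]])
  ultimately show ?case using 2 unfolding on_cycle_def by auto
qed

lemma walk_neq: assumes "walk b P b'" "P \<noteq> []" shows "b \<noteq> b'"
proof
  assume bb: "b = b'"
  obtain l c P' where P: "P = (b, l, c) # P'" "bridge b l c" "walk c P' b'"
    using assms by (cases P) auto
  note B = bridgeD[OF P(2)]
  have "on_cycle b (body P @ b)" using walk_on_cycle[OF assms(1) B(1)] bb by simp
  then have "on_cycle b (body P' @ (c @ l) @ b)" using P by simp
  from on_cycle_no_return[OF B(5,4) this cyclic_perms_refl]
  show False using bridge_not_cyclic[OF P(2)] by blast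
qed

lemma walk_append: "walk b (L1 @ L2) c \<longleftrightarrow> (\<exists>d. walk b L1 d \<and> walk d L2 c)"
  by (induction b L1 c rule: walk.induct) auto

text \<open>H-reductions are applied only at the inner vertices of a path; being different from both
  end bands, these bands cannot damage the ends of the string.\<close>

lemma walk_inner_band:
  assumes "walk b L c" "(x, l, d) \<in> set (butlast L)"
  shows "d \<in> reps \<and> d \<noteq> b \<and> d \<noteq> c"
proof -
  obtain B t where B: "L = B @ [t]" using assms(2) by (cases L rule: rev_cases) auto
  then have "(x, l, d) \<in> set B" using assms(2) by simp
  then obtain L1 L2 where "B = L1 @ (x, l, d) # L2" by (meson split_list)
  with B have "L = (L1 @ [(x, l, d)]) @ (L2 @ [t])" by simp
  with assms(1) have "walk b ((L1 @ [(x, l, d)]) @ (L2 @ [t])) c" by simp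
  then obtain d' where d': "walk b (L1 @ [(x, l, d)]) d'" "walk d' (L2 @ [t]) c"
    unfolding walk_append[of b "L1 @ [(x, l, d)]"] by blast
  from d'(1) obtain y where "d' = d" "bridge y l d" unfolding walk_append by auto
  then show ?thesis using walk_neq[OF d'(1)] walk_neq[OF d'(2)] bridgeD(2)[of y l d] by simp
qed

lemma walk_body_prefix:
  assumes "walk b L c" "L \<noteq> []"
  shows "\<exists>w. body L = c @ w"
proof -
  obtain L1 t where t: "L = L1 @ [t]" using assms(2) by (cases L rule: rev_cases) auto
  obtain x l d where "t = (x, l, d)" by (cases t)
  with t have L: "L = L1 @ [(x, l, d)]" by simp
  then have "d = c" using assms(1) unfolding L walk_append by auto
  then show ?thesis unfolding L body_append by simp
qed

lemma bridge_occurrence: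
  assumes "bridge b l c" "cband e" "sublist e (c @ l @ b)"
  shows "e \<in> cyclic_perms c \<or> e \<in> cyclic_perms b"
proof -
  note B = bridgeD[OF assms(1)]
  have nl: "\<not> sublist e l" using assms loop_free_wordD unfolding bridge_def by blast
  have ne: "e \<noteq> []" using assms cband_not_Nil by blast
  have lb: "S (l @ b @ [])" using S_suffix[of c "l @ b"] B(3) cband_not_Nil[OF reps_cband[OF B(1)]] by simp
  show ?thesis
    using band_occurrence[OF reps_band[OF B(2)] assms(2), of "[]" "l @ b"] B(3) assms(3) ne
      band_occurrence[OF reps_band[OF B(1)] assms(2) lb] nl by auto
qed

text \<open>The band \<open>e\<close> is a rotation of only one of the ends, so the square avoids
  the other one. It is twice as long as the end it may overlap, so one of its copies falls into the
  band-free word \<open>l\<close>.\<close>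

lemma bridge_no_square:
  assumes "bridge b l c" "cband e"
  shows "\<not> sublist (e @ e) (c @ l @ b)"
proof
  assume sq: "sublist (e @ e) (c @ l @ b)"
  note B = bridgeD[OF assms(1)]
  have nl: "\<not> sublist e l" using assms loop_free_wordD unfolding bridge_def by blast
  have ne: "e \<noteq> []" using assms cband_not_Nil by blast
  have lb: "S (l @ b @ [])" using S_suffix[of c "l @ b"] B(3) cband_not_Nil[OF reps_cband[OF B(1)]] by simp
  have "sublist e (c @ l @ b)" using sq sublist_order.order.trans[OF _ sq, of e] by auto
  then consider "e \<in> cyclic_perms c" "e \<notin> cyclic_perms b" | "e \<in> cyclic_perms b" "e \<notin> cyclic_perms c"
    using bridge_occurrence[OF assms] bridge_not_cyclic[OF assms(1)] cyclic_perms_sym cyclic_perms_trans by blast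
  then show False
  proof cases
    case 1
    have "sublist (e @ e) (c @ l)"
      using band_square_occurrence[OF reps_band[OF B(1)] assms(2), of "c @ l" "[]"] B(3) sq 1(2) ne by auto
    then obtain C D where C: "c @ l = C @ e @ e @ D" unfolding sublist_def by auto
    have "length (e @ D) \<le> length l"
      using arg_cong[OF C, of length] cyclic_perms_length[OF 1(1)] by simp
    moreover have "(C @ e) @ (e @ D) = c @ l" using C by simp
    ultimately obtain t where "l = t @ e @ D" using append_eq_shorter_suffix by metis
    then show False using nl unfolding sublist_def by blast
  next
    case 2
    have "sublist (e @ e) (l @ b)"
      using band_square_occurrence[OF reps_band[OF B(2)] assms(2), of "[]" "l @ b"] B(3) sq 2(2) ne by auto
    then obtain C D where C: "l @ b = C @ e @ e @ D" unfolding sublist_def by auto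
    have "length b \<le> length (e @ D)" using cyclic_perms_length[OF 2(1)] by simp
    moreover have "l @ b = (C @ e) @ (e @ D)" using C by simp
    ultimately obtain t where "l = (C @ e) @ t" using append_eq_shorter_suffix by metis
    then show False using nl unfolding sublist_def by auto
  qed
qed

text \<open>A loop around the starting band would produce a square by \<open>loop_on_start\<close>.
  The final band can be a loop, namely when \<open>l\<close> already reaches its cycle.\<close>

lemma bridge_loop:
  assumes "bridge b l c" "loop b (c @ l) e"
  shows "e \<in> cyclic_perms c"
proof -
  obtain w2 w1 where w: "c @ l = w2 @ e @ w1" "on_cycle e (w1 @ b)" using assms(2) unfolding loop_def by blast
  have e: "cband e" using w on_cycleD(1) by blast
  have "c @ l @ b = w2 @ e @ (w1 @ b)" using w(1) by (metis append.assoc)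
  then have "sublist e (c @ l @ b)" unfolding sublist_def by blast
  moreover have "e \<notin> cyclic_perms b"
    using loop_on_start[OF reps_cband[OF bridgeD(1)[OF assms(1)]] assms(2)] bridge_no_square[OF assms(1) e] by auto
  ultimately show ?thesis using bridge_occurrence[OF assms(1) e] by blast
qed

lemma bridge_not_prefix: "bridge b l c \<Longrightarrow> \<not> prefix c l"
  using loop_free_wordD[of l c] reps_cband prefix_imp_sublist unfolding bridge_def by blast

lemma bridge_trace_unique:
  assumes "bridge b l c" "bridge b l' c" "trace b (c @ l) = trace b (c @ l')"
  shows "l = l'"
proof (rule reduced_unique[OF assms(3)])
  show "on_cycle c (c @ l @ b)" "on_cycle c (c @ l' @ b)" using bridgeD(4) assms(1,2) by fastforce+
qed (use assms bridge_loop bridge_not_prefix in blast)+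

lemma bridge_trace_nonempty:
  assumes "bridge b l c" shows "trace b (c @ l) \<noteq> []"
proof
  note B = bridgeD[OF assms]
  assume "trace b (c @ l) = []"
  moreover have "c @ l \<noteq> []" using cband_not_Nil[OF reps_cband[OF B(2)]] by simp
  ultimately obtain d e where d: "on_cycle d b" "e \<in> cyclic_perms d" "on_cycle e ((c @ l) @ b)"
    using trace_Nil_cycle by blast
  then have "d = b" "e = c" using on_cycle_unique B by blast+
  then show False using d bridge_not_cyclic[OF assms] by blast
qed

lemma trace_body_Cons:
  assumes "bridge b l c"
  shows "trace b (body ((b, l, c) # P)) = trace c (body P) @ trace b (c @ l)"
  using trace_append[of b "body P" "c @ l"] trace_cong[OF Res_bridge[OF assms]] by simp

text \<open>The first traversed edge of a trace is its last entry. Everything read before it is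
  cyclic, so this edge departs from the cycle of \<open>c\<close>.\<close>

lemma last_trace_source:
  assumes "trace c w = xs" "xs \<noteq> []" "c \<in> reps"
  obtains v a e where "last xs = (Res (v @ c), a)" "e \<in> cyclic_perms c" "on_cycle e (v @ c)"
proof -
  have c: "on_cycle c c" using on_cycle_self reps_cband assms(3) by blast
  obtain x a v where v: "last xs = (Res (v @ c), a)" "trace c v = []"
    using trace_split[of c w xs "[]"] assms by auto
  have "\<exists>e\<in>cyclic_perms c. on_cycle e (v @ c)"
  proof (cases "v = []")
    case True
    then show ?thesis using c cyclic_perms_refl by auto
  next
    case False
    then obtain d e where "on_cycle d c" "e \<in> cyclic_perms d" "on_cycle e (v @ c)"
      using trace_Nil_cycle[OF v(2)] by blast
    then show ?thesis using on_cycle_unique c by blast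
  qed
  then show thesis using that v(1) by blast
qed

text \<open>In the trace of a walk of direct bridges, a new bridge begins exactly at the edges whose source lies
  on a cycle; this is why traces of two such walks are cut at the same places.\<close>

lemma direct_bridge_trace_length:
  assumes d: "bridge b l c" "direct_bridge b l' c'"
    and eq: "trace c w @ trace b (c @ l) = ts @ trace b (c' @ l')"
  shows "\<not> length (trace b (c @ l)) < length (trace b (c' @ l'))"
proof
  assume "length (trace b (c @ l)) < length (trace b (c' @ l'))"
  note B = bridgeD[OF d(1)]
  have d': "bridge b l' c'" using d(2) unfolding direct_bridge_def by blast
  note B' = bridgeD[OF d']
  from append_eq_shorter_suffix[OF eq] \<open>length _ < _\<close>
  obtain xs where xs: "trace b (c' @ l') = xs @ trace b (c @ l)" "trace c w = ts @ xs" by force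
  have ne: "xs \<noteq> []" using xs(1) \<open>length _ < _\<close> by auto
  obtain v a e where v: "last xs = (Res (v @ c), a)" "e \<in> cyclic_perms c" "on_cycle e (v @ c)"
    using last_trace_source[of c w "ts @ xs"] xs(2) ne B(2) by auto
  obtain x' a' v' where v': "c' @ l' = x' @ a' # v'" "last xs = (Res (v' @ b), a')" "\<not> cycle_edge (v' @ b) a'"
    using trace_split[OF xs(1) ne] by blast
  \<comment> \<open>A trace entry records the state before its edge, so the bridge to
    \<open>c'\<close> itself passes through the cycle of \<open>c\<close>.\<close>
  have "Res (v' @ b) = Res (v @ c)" using v v' by simp
  then have e: "on_cycle e (v' @ b)" using v(3) on_cycle_cong by blast
  have "c' @ l' = (x' @ [a']) @ v'" using v' by simp
  then consider "e \<in> cyclic_perms b" | "e \<in> cyclic_perms c'"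
    using d(2) e unfolding direct_bridge_def by blast
  then show False
  proof cases
    case 1
    then have "c \<in> cyclic_perms b" using v(2) cyclic_perms_sym cyclic_perms_trans by blast
    then show False using bridge_not_cyclic[OF d(1)] by blast
  next
    case 2
    have "on_cycle c' ((x' @ [a']) @ v' @ b)" using B'(4) v'(1) by simp
    from trace_stay[OF e this cyclic_perms_sym[OF 2]] have "trace (v' @ b) (x' @ [a']) = []" .
    then show False using v'(3) by (simp add: trace_append)
  qed
qed

text \<open>After its last non-cyclic edge a bridge stays on one cycle, which is determined by the
  target state of that edge and must be the cycle of the final band.\<close>

lemma trace_target_unique:
  assumes "bridge b l c" "bridge b l' c'" "trace b (c @ l) = trace b (c' @ l')"
  shows "c = c'"
proof -
  note B = bridgeD[OF assms(1)] and B' = bridgeD[OF assms(2)]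
  obtain t T where t: "trace b (c @ l) = t # T" using bridge_trace_nonempty[OF assms(1)] by (cases "trace b (c @ l)") auto
  obtain x a v where 1: "c @ l = x @ a # v" "t = (Res (v @ b), a)" "trace (a # v @ b) x = []"
    using trace_Cons_split[OF t] by metis
  obtain x' a' v' where 2: "c' @ l' = x' @ a' # v'" "t = (Res (v' @ b), a')" "trace (a' # v' @ b) x' = []"
    using trace_Cons_split[of b "c' @ l'" t T] t assms(3) by metis
  have start: "\<exists>g. on_cycle g y \<and> c \<in> cyclic_perms g" if "trace y x = []" "on_cycle c (x @ y)" for x y c
  proof (cases "x = []")
    case True
    then show ?thesis using that(2) cyclic_perms_refl by auto
  next
    case False
    then show ?thesis using trace_Nil_cycle[OF that(1)] that(2) on_cycle_unique by blast
  qed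
  have "on_cycle c (x @ a # v @ b)" "on_cycle c' (x' @ a' # v' @ b)" using B(4) B'(4) 1(1) 2(1) by auto
  then obtain g g' where g: "on_cycle g (a # v @ b)" "c \<in> cyclic_perms g"
    "on_cycle g' (a' # v' @ b)" "c' \<in> cyclic_perms g'"
    using start 1(3) 2(3) by blast
  have "a = a'" "Res (v @ b) = Res (v' @ b)" using 1 2 by auto
  then have "Res ([a] @ v @ b) = Res ([a'] @ v' @ b)" using Res_append by blast
  then have "on_cycle g' (a # v @ b)" using g(3) on_cycle_cong[of "a # v @ b" "a' # v' @ b"] by simp
  then have "g = g'" using g(1) on_cycle_unique by blast
  then have "c' \<in> cyclic_perms c" using g cyclic_perms_sym cyclic_perms_trans by blast
  then show ?thesis using reps_eq B(2) B'(2) by blast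
qed

lemma direct_walk_unique:
  assumes "walk b P b1" "walk b P' b2" "b \<in> reps"
    and "\<And>x l y. (x, l, y) \<in> set P \<union> set P' \<Longrightarrow> direct_bridge x l y"
    and "trace b (body P) = trace b (body P')"
  shows "P = P'"
  using assms
proof (induction P arbitrary: b P')
  case Nil
  show ?case
  proof (cases P')
    case (Cons e P'')
    then obtain l c where P': "P' = (b, l, c) # P''" "bridge b l c" using Nil.prems by (cases e) auto
    then show ?thesis using Nil.prems(5) trace_body_Cons[OF P'(2), of P''] bridge_trace_nonempty[OF P'(2)] by simp
  qed simp
next
  case (Cons e P1)
  obtain l c where e: "e = (b, l, c)" "bridge b l c" "walk c P1 b1" using Cons.prems by (cases e) auto
  note tr = trace_body_Cons[OF e(2), of P1]
  show ?case
  proof (cases P')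
    case Nil
    then show ?thesis using Cons.prems(5) tr e(1) bridge_trace_nonempty[OF e(2)] by simp
  next
    case (Cons e' P1')
    obtain l' c' where e': "P' = (b, l', c') # P1'" "bridge b l' c'" "walk c' P1' b2"
      using Cons Cons.prems by (cases e') auto
    note tr' = trace_body_Cons[OF e'(2), of P1']
    have eq: "trace c (body P1) @ trace b (c @ l) = trace c' (body P1') @ trace b (c' @ l')"
      using Cons.prems(5) tr tr' e(1) e'(1) by simp
    have dir: "direct_bridge b l c" "direct_bridge b l' c'" using Cons.prems(4) e(1) e'(1) by auto
    have len: "length (trace b (c @ l)) = length (trace b (c' @ l'))"
      using direct_bridge_trace_length[OF e(2) dir(2) eq] direct_bridge_trace_length[OF e'(2) dir(1) eq[symmetric]] by simp
    then have eqs: "trace b (c @ l) = trace b (c' @ l')" "trace c (body P1) = trace c' (body P1')"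
      using eq by auto
    have c: "c' = c" using trace_target_unique[OF e(2) e'(2) eqs(1)] by simp
    have l: "l' = l" using bridge_trace_unique[OF e(2)] e'(2) eqs(1) c by simp
    have "P1 = P1'"
    proof (rule Cons.IH)
      show "walk c P1 b1" "walk c P1' b2" "c \<in> reps" using e e' c bridgeD by auto
      show "trace c (body P1) = trace c (body P1')" using eqs c by simp
      show "direct_bridge x l y" if "(x, l, y) \<in> set P1 \<union> set P1'" for x l y
        using Cons.prems(4) that e'(1) by auto
    qed
    then show ?thesis using e e' c l by simp
  qed
qed

section \<open>Refinement of bridges\<close>

lemma last_foreign_cycle:
  assumes br: "bridge b l c" and nd: "\<not> direct_bridge b l c"
  obtains l2 l1 d where "l = l2 @ l1" "on_cycle d (l1 @ b)" "d \<notin> cyclic_perms b" "d \<notin> cyclic_perms c"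
    "\<And>k2 k1 e. l2 = k2 @ k1 \<Longrightarrow> k1 \<noteq> [] \<Longrightarrow> on_cycle e (k1 @ l1 @ b) \<Longrightarrow> e \<in> cyclic_perms b \<or> e \<in> cyclic_perms c"
proof -
  note B = bridgeD[OF br]
  define P where "P w1 \<longleftrightarrow> (\<exists>w2 d. c @ l = w2 @ w1 \<and> on_cycle d (w1 @ b) \<and>
    d \<notin> cyclic_perms b \<and> d \<notin> cyclic_perms c)" for w1
  obtain w where "P w" using nd br unfolding direct_bridge_def P_def by blast
  moreover have "\<forall>w. P w \<longrightarrow> length w < Suc (length (c @ l))"
    unfolding P_def by (intro allI impI, elim exE conjE, drule arg_cong[where f = length]) simp
  ultimately have "\<exists>x. P x \<and> (\<forall>y. P y \<longrightarrow> length y \<le> length x)"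
    by (rule ex_has_greatest_nat)
  then obtain l1 where l1: "P l1" "\<And>w. P w \<Longrightarrow> length w \<le> length l1" by blast
  obtain w2 d where w2: "c @ l = w2 @ l1" "on_cycle d (l1 @ b)" "d \<notin> cyclic_perms b" "d \<notin> cyclic_perms c"
    using l1(1) unfolding P_def by blast
  \<comment> \<open>A visit strictly inside the final band \<open>c\<close> would, by
    \<open>cycle_inside_band\<close>, be a visit to the cycle of \<open>c\<close> itself.\<close>
  have "length l1 \<le> length l"
  proof (rule ccontr)
    assume "\<not> length l1 \<le> length l"
    then have le: "length l \<le> length l1" "l1 \<noteq> l" by auto
    obtain p where p: "l1 = p @ l" "c = w2 @ p" using append_eq_shorter_suffix[OF w2(1) le(1)] .
    then have "p \<noteq> []" using le(2) by auto
    have "on_cycle d (p @ l @ b)" using w2(2) p(1) by simp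
    from cycle_inside_band[OF reps_band[OF B(2)] B(3) p(2) \<open>p \<noteq> []\<close> this] show False using w2(4) by blast
  qed
  from append_eq_shorter_suffix[OF w2(1)[symmetric] this]
  obtain l2 where l2: "l = l2 @ l1" "w2 = c @ l2" .
  show thesis
  proof (rule that[OF l2(1) w2(2-4)])
    fix k2 k1 e assume k: "l2 = k2 @ k1" "k1 \<noteq> []" "on_cycle e (k1 @ l1 @ b)"
    show "e \<in> cyclic_perms b \<or> e \<in> cyclic_perms c"
    proof (rule ccontr)
      assume "\<not> ?thesis"
      moreover have "c @ l = (c @ k2) @ (k1 @ l1)" using l2 k(1) by simp
      moreover have "on_cycle e ((k1 @ l1) @ b)" using k(3) by simp
      ultimately have "P (k1 @ l1)" unfolding P_def by blast
      then show False using l1(2)[of "k1 @ l1"] k(2) by simp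
    qed
  qed
qed

text \<open>Splitting at the last visit to a foreign cycle leaves no further foreign band in the second half, and
  the first half is part of the loop-free word \<open>l\<close> up to turns around \<open>d\<close>.\<close>

lemma refine_bridge:
  assumes br: "bridge b l c" and nd: "\<not> direct_bridge b l c"
  obtains d u' u'' where "bridge b u' d" "bridge d u'' c" "trace b (c @ u'' @ d @ u') = trace b (c @ l)"
proof -
  note B = bridgeD[OF br]
  have lf: "loop_free_word l" using br unfolding bridge_def by blast
  obtain l2 l1 d' where l: "l = l2 @ l1" and d': "on_cycle d' (l1 @ b)" "d' \<notin> cyclic_perms b" "d' \<notin> cyclic_perms c"
    and last: "\<And>k2 k1 e. l2 = k2 @ k1 \<Longrightarrow> k1 \<noteq> [] \<Longrightarrow> on_cycle e (k1 @ l1 @ b) \<Longrightarrow>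
      e \<in> cyclic_perms b \<or> e \<in> cyclic_perms c"
    using last_foreign_cycle[OF br nd] by blast
  have cd': "cband d'" using on_cycleD(1)[OF d'(1)] .
  obtain d where d: "d \<in> reps" "d \<in> cyclic_perms d'" using rep_exists[OF cd'] by blast
  \<comment> \<open>If the representative \<open>d\<close> is already based at this state, a full
    turn is taken as \<open>r\<close>. With \<open>r\<close> nonempty, \<open>s\<close> is a proper
    part of the cycle and too short to contain a band.\<close>
  obtain s r where sr: "d' = s @ r" "d = r @ s" "r \<noteq> []"
  proof -
    obtain r s where rs: "d' = s @ r" "d = r @ s" using d(2) unfolding cyclic_perms_iff by blast
    show thesis
    proof (cases "r = []")
      case True
      then show thesis using that[of "[]" d] rs cband_not_Nil[OF cd'] by simp
    qed (use that rs in blast)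
  qed
  have cd: "cband d" "d \<noteq> []" using reps_cband cband_not_Nil d(1) by blast+
  have cc: "c \<noteq> []" using reps_cband cband_not_Nil B(2) by blast
  have dn: "d \<notin> cyclic_perms b" "d \<notin> cyclic_perms c"
    using d(2) d'(2,3) cyclic_perms_sym cyclic_perms_trans by blast+
  have on_d: "on_cycle d (r @ l1 @ b)" using on_cycle_rotate[of s r "l1 @ b"] d'(1) sr by simp
  have "on_cycle (r @ s) d" using on_cycle_self[OF cd(1)] sr(2) by simp
  from on_cycle_rotate[OF this] have on_s: "on_cycle d' (s @ d)" using sr by simp
  have Rs: "Res (s @ d) = Res (l1 @ b)" using on_s d'(1) unfolding on_cycle_def by simp
  have S2: "S (c @ l2 @ s @ d)" using Res_S[OF Rs, of "c @ l2"] B(3) l by simp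
  \<comment> \<open>Going to the base point of \<open>d\<close> and on from there may create copies
    of \<open>d\<close> at the head of the first half or of \<open>c\<close> at the head of the
    second. They are stripped, which keeps the trace.\<close>
  obtain i u' where u': "r @ l1 = list_pow d i @ u'" "\<not> prefix d u'" using strip_prefix_power[OF cd(2)] by blast
  obtain j u'' where u'': "l2 @ s = list_pow c j @ u''" "\<not> prefix c u''" using strip_prefix_power[OF cc] by blast
  have e1: "d @ r @ l1 = list_pow d i @ d @ u'" using u'(1) by (metis append.assoc list_pow_commute)
  have e2: "c @ l2 @ s = list_pow c j @ c @ u''" using u''(1) by (metis append.assoc list_pow_commute)
  have "S (d @ r @ l1 @ b)" using on_cycleD(4)[OF on_d] .
  then have "S (list_pow d i @ d @ u' @ b)" using e1 by (metis append.assoc)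
  then have Su': "S (d @ u' @ b)" using S_suffix cd(2) by (metis Nil_is_append_conv)
  have "S (list_pow c j @ c @ u'' @ d)" using S2 e2 by (metis append.assoc)
  then have Su'': "S (c @ u'' @ d)" using S_suffix cc by (metis Nil_is_append_conv)
  have on_u': "on_cycle d (d @ u' @ b)" using on_cycle_append[OF cd(1) Su'] .
  have on_u'': "on_cycle c (c @ u'' @ d)" using on_cycle_append[OF reps_cband[OF B(2)] Su''] .
  have "loop_free_word u'" unfolding loop_free_word_def
  proof
    assume "\<exists>e. cband e \<and> sublist e u'"
    then obtain e g2 g1 where e: "cband e" "u' = g2 @ e @ g1" unfolding sublist_def by blast
    show False
    proof (cases "length (e @ g1) \<le> length l1")
      case True
      have "(list_pow d i @ g2) @ (e @ g1) = r @ l1" using u'(1) e(2) by simp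
      from append_eq_shorter_suffix[OF this True] obtain t where "l1 = t @ e @ g1" by metis
      then have "l = (l2 @ t) @ e @ g1" using l by simp
      then show False using lf e(1) unfolding loop_free_word_def sublist_def by blast
    next
      case False
      \<comment> \<open>A band reaching into \<open>r\<close> ends on the cycle of \<open>d\<close>,
        so it is a rotation of \<open>d\<close>. It then slides to the head of \<open>u'\<close>,
        where no copy of \<open>d\<close> is left.\<close>
      then have "length l1 \<le> length (e @ g1)" by simp
      moreover have "r @ l1 = (list_pow d i @ g2) @ (e @ g1)" using u'(1) e(2) by simp
      ultimately obtain r1 where r1: "e @ g1 = r1 @ l1" "r = (list_pow d i @ g2) @ r1"
        using append_eq_shorter_suffix by metis
      obtain r2 where r2: "r = r2 @ r1" using r1(2) by blast
      have "on_cycle ((s @ r2) @ r1) (l1 @ b)" using d'(1) sr(1) r2 by simp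
      from on_cycle_rotate[OF this] have on1: "on_cycle (r1 @ s @ r2) ((e @ g1) @ b)" using r1(1) by simp
      have "S ((d @ g2) @ (e @ g1 @ b))" using Su' e(2) by simp
      then have "S (e @ g1 @ b)" using S_suffix cband_not_Nil[OF e(1)] by (metis Nil_is_append_conv)
      then have on2: "on_cycle e (e @ g1 @ b)" using on_cycle_append e(1) by blast
      have "e = (r1 @ s) @ r2" using on_cycle_unique[OF on2] on1 by simp
      moreover have "d = r2 @ (r1 @ s)" using sr(2) r2 by simp
      ultimately have "d \<in> cyclic_perms e" unfolding cyclic_perms_iff by blast
      moreover have "on_cycle d ((d @ g2) @ (e @ g1 @ b))" using on_u' e(2) by simp
      ultimately have "(d @ g2) @ e = d @ (d @ g2)" using on_cycle_shift[OF on2] by blast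
      then have "g2 @ e = d @ g2" by simp
      then have "u' = d @ g2 @ g1" using e(2) by (metis append.assoc)
      then show False using u'(2) by simp
    qed
  qed
  moreover have "loop_free_word u''" unfolding loop_free_word_def
  proof
    assume "\<exists>e. cband e \<and> sublist e u''"
    then obtain e g2 g1 where e: "cband e" "u'' = g2 @ e @ g1" unfolding sublist_def by blast
    have "S ((c @ g2) @ (e @ g1 @ d))" using Su'' e(2) by simp
    then have "S (e @ g1 @ d)" using S_suffix cband_not_Nil[OF e(1)] by (metis Nil_is_append_conv)
    then have on_e: "on_cycle e (e @ g1 @ d)" using on_cycle_append e(1) by blast
    have split: "(list_pow c j @ g2) @ (e @ g1) = l2 @ s" using u''(1) e(2) by simp
    show False
    proof (cases "length (e @ g1) \<le> length s")
      case True
      from append_eq_shorter_suffix[OF split True] obtain t where t: "s = t @ e @ g1" by metis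
      have "on_cycle ((r @ t) @ (e @ g1)) d" using on_cycle_self[OF cd(1)] sr(2) t by simp
      from on_cycle_rotate[OF this] have "on_cycle ((e @ g1) @ (r @ t)) (e @ g1 @ d)" by simp
      then have "e = (e @ g1) @ (r @ t)" using on_cycle_unique[OF on_e] by blast
      then show False using sr(3) by simp
    next
      case False
      then have "length s \<le> length (e @ g1)" by simp
      from append_eq_shorter_suffix[OF split[symmetric] this]
      obtain k where k: "e @ g1 = k @ s" "l2 = (list_pow c j @ g2) @ k" by metis
      have "k \<noteq> []" using False k(1) by auto
      \<comment> \<open>As \<open>s @ d\<close> and \<open>l1 @ b\<close> have the same state, the
        end of \<open>e\<close> is a state of the original bridge after its last foreign
        visit.\<close>
      have "Res (k @ l1 @ b) = Res (k @ s @ d)" using Res_append[OF Rs] by simp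
      moreover have "e @ g1 @ d = k @ s @ d" using k(1) by (metis append.assoc)
      ultimately have on_k: "on_cycle e (k @ l1 @ b)" using on_e on_cycle_cong by metis
      consider "e \<in> cyclic_perms b" | "e \<in> cyclic_perms c" using last[OF k(2) \<open>k \<noteq> []\<close> on_k] by blast
      then show False
      proof cases
        case 1
        from on_cycle_no_return[OF B(5) d'(1) on_k 1] show False using d'(2) by blast
      next
        case 2
        have "on_cycle c ((c @ g2) @ (e @ g1 @ d))" using on_u'' e(2) by simp
        from on_cycle_shift[OF on_e this cyclic_perms_sym[OF 2]] have "g2 @ e = c @ g2" by simp
        then have "u'' = c @ g2 @ g1" using e(2) by (metis append.assoc)
        then show False using u''(2) by simp
      qed
    qed
  qed
  ultimately have "bridge b u' d" "bridge d u'' c"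
    unfolding bridge_def using B d(1) Su' Su'' dn cyclic_perms_refl by auto
  moreover have "trace b (c @ u'' @ d @ u') = trace b (c @ l)"
  proof -
    have "trace b (list_pow d i @ d @ u') = trace b (d @ u')"
      using trace_append[of b "list_pow d i" "d @ u'"] trace_cycle_pow[OF on_u'] by simp
    then have "trace b (d @ u') = trace b (d @ r @ l1)" using e1 by simp
    also have "\<dots> = trace (l1 @ b) (d @ r) @ trace b l1" using trace_append[of b "d @ r" l1] by simp
    also have "trace (l1 @ b) (d @ r) = []"
      by (rule trace_stay[OF d'(1) _ d(2)]) (use on_cycle_rotate[of "[]" d "r @ l1 @ b"] on_d in simp)
    finally have T1: "trace b (d @ u') = trace b l1" by simp
    have "trace d (list_pow c j @ c @ u'') = trace d (c @ u'')"
      using trace_append[of d "list_pow c j" "c @ u''"] trace_cycle_pow[OF on_u''] by simp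
    then have "trace d (c @ u'') = trace d (c @ l2 @ s)" using e2 by simp
    also have "\<dots> = trace (s @ d) (c @ l2) @ trace d s" using trace_append[of d "c @ l2" s] by simp
    also have "trace d s = []"
      by (rule trace_cycle_part[of r]) (use on_cycle_self[OF cd(1)] sr(2) in simp)
    also have "trace (s @ d) (c @ l2) = trace (l1 @ b) (c @ l2)" by (rule trace_cong[OF Rs])
    finally have T2: "trace d (c @ u'') = trace (l1 @ b) (c @ l2)" by simp
    have "Res ((d @ u') @ b) = Res d" using on_u' unfolding on_cycle_def by simp
    then have "trace b ((c @ u'') @ (d @ u')) = trace d (c @ u'') @ trace b (d @ u')"
      using trace_append trace_cong by metis
    also have "\<dots> = trace b (c @ l)" using T1 T2 trace_append[of b "c @ l2" l1] l by simp
    finally show ?thesis by simp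
  qed
  ultimately show thesis using that by blast
qed

text \<open>The operation \<open>h_red\<close> on plain lists: the H-equivalence of
  \<open>e @ y1\<close> and \<open>y1\<close> becomes the condition that \<open>y1\<close> already
  lies on the cycle of \<open>e\<close>.\<close>

definition h_step :: "'l list \<Rightarrow> 'l list \<Rightarrow> 'l list \<Rightarrow> bool" where
  "h_step d z f \<longleftrightarrow>
     (\<exists>y2 e y1. e \<in> cyclic_perms d \<and> on_cycle e y1 \<and> z = y2 @ e @ y1 \<and> f = y2 @ y1) \<or>
     f = z \<and> \<not> (\<exists>y2 e y1. e \<in> cyclic_perms d \<and> on_cycle e y1 \<and> z = y2 @ e @ y1)"

lemma shrinks_h_step:
  assumes "turn_band b" "turn_band c" "d \<notin> cyclic_perms b" "d \<notin> cyclic_perms c"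
    and y: "S (c @ w @ b)" and h: "h_step d (c @ w @ b) f"
  shows "shrinks b c (c @ w @ b) f"
proof -
  consider "f = c @ w @ b" | y2 e y1 where "e \<in> cyclic_perms d" "on_cycle e y1" "c @ w @ b = y2 @ e @ y1" "f = y2 @ y1"
    using h unfolding h_step_def by blast
  then show ?thesis
  proof cases
    case 1
    then show ?thesis using shrinks_refl[OF y] by simp
  next
    case 2
    have "e \<notin> cyclic_perms b" "e \<notin> cyclic_perms c"
      using 2(1) assms(3,4) cyclic_perms_sym cyclic_perms_trans by blast+
    from shrinks_removal_other[OF assms(1,2) this 2(2) y 2(3)] show ?thesis using 2 by simp
  qed
qed

text \<open>Since \<open>f\<close> has the trace of the bridge \<open>l\<close>, only the hypotheses
  of \<open>reduced_unique\<close> need checking. The exponent bounds of the skeleton exclude loops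
  around \<open>b\<close>, the H-reduction excludes loops around \<open>d\<close>, and a doubled
  \<open>c\<close> at the head is excluded both before and after the H-reduction.\<close>

lemma refined_unique:
  assumes br: "bridge b l c" "bridge b u' d" "bridge d u'' c"
    and tr: "trace b (c @ u'' @ d @ u') = trace b (c @ l)"
    and z: "shrinks b c (c @ u'' @ d @ u' @ b) z"
      "power_count b z \<le> 1" "power_count c z \<le> 1" "power_count d z \<le> 1"
    and f: "h_step d z f"
  shows "f = c @ l @ b"
proof -
  note B1 = bridgeD[OF br(1)] and B2 = bridgeD[OF br(2)]
  note nc = bridge_not_cyclic[OF br(1)] bridge_not_cyclic[OF br(2)] bridge_not_cyclic[OF br(3)]
  have tb: "turn_band b" "turn_band c" "turn_band d" using reps_band B1 B2 by auto
  then have cb: "cband b" "cband c" "cband d" using turn_band_cband by auto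
  then have ne: "b \<noteq> []" "c \<noteq> []" "d \<noteq> []" using cband_not_Nil by auto
  have two: "\<not> sublist (e @ e) z" if "x \<in> {b, c, d}" "e \<in> cyclic_perms x" for x e
  proof
    assume "sublist (e @ e) z"
    then have "sublist (list_pow e 2) z" by (simp add: numeral_2_eq_2)
    then have "2 \<le> power_count x z" using power_count_ge[of x 2 z] that ne by auto
    then show False using z that by auto
  qed
  obtain w0 where w0: "z = c @ w0 @ b" "S (c @ w0 @ b)" using z(1) unfolding shrinks_def by blast
  have sf: "shrinks b c z f" using shrinks_h_step[OF tb(1,2) nc(3,6)] w0 f by auto
  obtain w' where w': "f = c @ w' @ b" "\<And>e. loop b (c @ w') e \<Longrightarrow> loop b (c @ w0) e" and Sf: "S f"
    using sf w0 unfolding shrinks_def by auto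
  have yf: "shrinks b c (c @ u'' @ d @ u' @ b) f" using shrinks_trans[OF z(1) sf] .
  have y: "c @ u'' @ d @ u' @ b = c @ (u'' @ d @ u') @ b" by simp
  have yf': "trace b (c @ w') = trace b (c @ l)" "\<And>e. loop b (c @ w') e \<Longrightarrow> loop b (c @ u'' @ d @ u') e"
    using yf w'(1) tr unfolding y shrinks_def by auto
  have Sy: "S ((c @ u'') @ d @ (u' @ b))"
    using Res_S[of "(d @ u') @ b" d "c @ u''"] bridgeD(3)[OF br(3)] B2(4) unfolding on_cycle_def by simp
  have "w' = l"
  proof (rule reduced_unique[OF yf'(1)])
    show "on_cycle c (c @ w' @ b)" using on_cycle_append[OF cb(2)] Sf w'(1) by simp
    show "on_cycle c (c @ l @ b)" using B1(4) by simp
    show "loop b (c @ l) e \<Longrightarrow> e \<in> cyclic_perms c" for e using bridge_loop[OF br(1)] by blast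
    show "\<not> prefix c l" using bridge_not_prefix[OF br(1)] .
    show "e \<in> cyclic_perms c" if lp: "loop b (c @ w') e" for e
    proof -
      obtain w2 w1 where w: "c @ w' = w2 @ e @ w1" "on_cycle e (w1 @ b)" using lp unfolding loop_def by blast
      obtain v2 v1 where v: "c @ w0 = v2 @ e @ v1" "on_cycle e (v1 @ b)" using w'(2)[OF lp] unfolding loop_def by blast
      obtain y2 y1 where y: "c @ u'' @ d @ u' = y2 @ e @ y1" "on_cycle e (y1 @ b)"
        using yf'(2)[OF lp] unfolding loop_def by blast
      have ce: "cband e" using on_cycleD(1)[OF w(2)] .
      have "(c @ u'') @ d @ (u' @ b) = y2 @ e @ (y1 @ b)" using y(1) by (metis append.assoc)
      then have "sublist e ((c @ u'') @ d @ (u' @ b))" unfolding sublist_def by blast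
      then consider "e \<in> cyclic_perms d" | "sublist e (c @ u'')" | "sublist e (u' @ b)"
        using band_occurrence[OF tb(3) ce Sy] by blast
      then have "e \<in> cyclic_perms d \<or> e \<in> cyclic_perms c \<or> e \<in> cyclic_perms b"
      proof cases
        case 2
        then have "sublist e (c @ u'' @ d)" by (metis append.assoc sublist_append sublist_appendI)
        then show ?thesis using bridge_occurrence[OF br(3) ce] by blast
      next
        case 3
        then have "sublist e (d @ u' @ b)" by (simp add: sublist_append)
        then show ?thesis using bridge_occurrence[OF br(2) ce] by blast
      qed simp
      moreover have "e \<notin> cyclic_perms b"
        using loop_on_start[OF cb(1) w'(2)[OF lp]] two[of b e] w0(1) by auto
      \<comment> \<open>A loop around \<open>d\<close> in \<open>f\<close> comes from one in
        \<open>z\<close>, so the H-reduction did remove a turn. Reinserting it next to the remaining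
        one gives exponent at least two in \<open>z\<close>.\<close>
      moreover have "e \<notin> cyclic_perms d"
      proof
        assume ed: "e \<in> cyclic_perms d"
        have z': "z = v2 @ e @ (v1 @ b)" using v(1) w0(1) by (metis append.assoc)
        then obtain y2 g y1 where g: "g \<in> cyclic_perms d" "on_cycle g y1" "z = y2 @ g @ y1" "f = y2 @ y1"
          using f v(2) ed unfolding h_step_def by blast
        have "f = w2 @ e @ w1 @ b" using w(1) w'(1) by (metis append.assoc)
        then have "sublist (list_pow e 1) f" by simp
        then have "1 \<le> power_count d (y2 @ y1)" using power_count_ge[of d 1] ne ed g(4) by auto
        then have "Suc 1 \<le> power_count d z"
          using power_count_insert[OF on_cycleD(1)[OF g(2)] g(1) _ g(2), of y2 1] w0 g(3) by simp
        then show False using z(4) by simp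
      qed
      ultimately show ?thesis by blast
    qed
    show "\<not> prefix c w'"
    proof
      assume "prefix c w'"
      then obtain v where v: "w' = c @ v" unfolding prefix_def by blast
      consider "f = z" | y2 g y1 where "g \<in> cyclic_perms d" "on_cycle g y1" "z = y2 @ g @ y1" "f = y2 @ y1"
        using f unfolding h_step_def by blast
      then show False
      proof cases
        case 1
        then have "z = [] @ (c @ c) @ (v @ b)" using w'(1) v by simp
        then have "sublist (c @ c) z" unfolding sublist_def by blast
        then show False using two[of c c] by simp
      next
        case 2
        have gn: "g \<notin> cyclic_perms c" using 2(1) nc(6) cyclic_perms_sym cyclic_perms_trans by blast
        have "S (c @ (w0 @ b))" "c @ (w0 @ b) = y2 @ g @ y1" using w0 2 by auto
        from disjoint_from_end[OF tb(2) on_cycleD(1)[OF 2(2)] gn this]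
        obtain x where x: "y2 = c @ x" by blast
        have eq: "x @ y1 = c @ (v @ b)" using 2(4) x w'(1) v by simp
        show False
        proof (cases "length y1 \<le> length (v @ b)")
          case True
          from append_eq_shorter_suffix[OF eq True] obtain t where "x = c @ t" by metis
          then have "z = [] @ (c @ c) @ (t @ g @ y1)" using 2(3) x by simp
          then have "sublist (c @ c) z" unfolding sublist_def by blast
          then show False using two[of c c] by simp
        next
          case False
          then have "length (v @ b) \<le> length y1" by simp
          from append_eq_shorter_suffix[OF eq[symmetric] this]
          obtain t where t: "y1 = t @ (v @ b)" "c = x @ t" by metis
          \<comment> \<open>The removed loop \<open>g\<close> was attached at an inner state of the
            second copy of \<open>c\<close>, which \<open>cycle_inside_band\<close> forbids.\<close>
          have "t \<noteq> []" using False t(1) by auto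
          have "S (c @ (c @ v @ b))" using Sf w'(1) v by simp
          then have "S (c @ v @ b)" using S_suffix ne(2) by (metis Nil_is_append_conv)
          from cycle_inside_band[OF tb(2) this t(2) \<open>t \<noteq> []\<close>, of g] 2(2) t(1) gn show False by simp
        qed
      qed
    qed
  qed
  then show ?thesis using w'(1) by simp
qed

end

section \<open>Strings of a string algebra\<close>

fun is_direct :: "'a syllable \<Rightarrow> bool" where
  "is_direct (Direct a) \<longleftrightarrow> True"
| "is_direct (Inverse a) \<longleftrightarrow> False"

context string_algebra
begin

lemma relation_words_pure:
  "r \<in> relation_words \<Longrightarrow> (\<forall>x\<in>set r. is_direct x) \<or> (\<forall>x\<in>set r. \<not> is_direct x)"
  unfolding relation_words_def by auto

lemma is_string_factor:
  assumes "is_string (Word (x @ y @ z))" "y \<noteq> []"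
  shows "is_string (Word y)"
proof -
  have "sublist r (x @ y @ z)" if "sublist r y" for r
    using that sublist_order.order.trans sublist_appendI by blast
  then show ?thesis using assms by (auto simp: successively_append_iff)
qed

text \<open>A relation crossing the junction would contain both a direct and an inverse
  syllable.\<close>

lemma is_string_turn:
  assumes "is_string (Word x)" "is_string (Word y)" "is_string (Word [last x, hd y])"
    and "is_direct (last x) \<noteq> is_direct (hd y)"
  shows "is_string (Word (x @ y))"
proof -
  have "\<not> sublist r (x @ y)" if r: "r \<in> relation_words" for r
  proof
    assume "sublist r (x @ y)"
    then obtain r1 r2 where r12: "r = r1 @ r2" "suffix r1 x" "prefix r2 y"
      using assms(1,2) r by (auto simp: sublist_append)
    show False
    proof (cases "r1 = [] \<or> r2 = []")
      case True
      then have "sublist r x \<or> sublist r y" using r12 suffix_imp_sublist prefix_imp_sublist by auto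
      then show False using assms(1,2) r by auto
    next
      case False
      then have "last r1 = last x" "hd r2 = hd y"
        using r12 by (auto simp: suffix_def prefix_def)
      then have "last x \<in> set r" "hd y \<in> set r" using False r12 last_in_set hd_in_set
        by (metis Un_iff set_append)+
      then show False using relation_words_pure[OF r] assms(4) by blast
    qed
  qed
  then show ?thesis using assms(1-3) by (auto simp: successively_append_iff)
qed

lemma pure_strings_bounded:
  "\<exists>n. \<forall>w. is_string (Word w) \<and> ((\<forall>a\<in>set w. is_direct a) \<or> (\<forall>a\<in>set w. \<not> is_direct a)) \<longrightarrow> length w < n"
proof -
  obtain n where n: "\<And>p. quiver_path Q p \<Longrightarrow> length p \<ge> n \<Longrightarrow> \<exists>r\<in>\<rho>. sublist r p"
    using long_paths_vanish by blast
  have "length w < n" if w: "is_string (Word w)" "\<forall>a\<in>set w. is_direct a" for w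
  proof (rule ccontr)
    assume "\<not> length w < n"
    have "\<exists>a. x = Direct a" if "x \<in> set w" for x using w(2) that by (cases x) auto
    then obtain p where p: "w = map Direct p" by (metis ex_map_conv)
    have "successively (\<lambda>x y. tail Q x = head Q y \<and> Direct x \<noteq> Inverse y) p"
      using w(1) unfolding p by (simp add: successively_map)
    then have "successively (\<lambda>x y. tail Q x = head Q y) p" by (rule successively_mono) simp
    then have "quiver_path Q p" using w(1) unfolding quiver_path_def p by auto
    then obtain r where r: "r \<in> \<rho>" "sublist r p" using n[of p] \<open>\<not> length w < n\<close> p by auto
    obtain ps ss where "p = ps @ r @ ss" using r(2) unfolding sublist_def by blast
    then have "w = map Direct ps @ map Direct r @ map Direct ss" using p by simp
    then have "sublist (map Direct r) w" unfolding sublist_def by blast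
    moreover have "map Direct r \<in> relation_words" unfolding relation_words_def using r(1) by blast
    ultimately show False using w(1) by auto
  qed
  moreover have "length w < n" if w: "is_string (Word w)" "\<forall>a\<in>set w. \<not> is_direct a" for w
  proof (rule ccontr)
    assume "\<not> length w < n"
    define arrow where "arrow x = (case x of Direct a \<Rightarrow> a | Inverse a \<Rightarrow> a)" for x :: "'a syllable"
    define p where "p = rev (map arrow w)"
    have "Inverse (arrow x) = x" if "x \<in> set w" for x using w(2) that by (cases x) (auto simp: arrow_def)
    then have "map (\<lambda>x. Inverse (arrow x)) w = w" by (rule map_idI)
    then have p: "w = rev (map Inverse p)" unfolding p_def by (simp add: rev_map comp_def)
    define adj where "adj \<alpha> \<beta> \<longleftrightarrow> src_syl \<alpha> = tgt_syl \<beta> \<and> \<alpha> \<noteq> inv_syl \<beta>" for \<alpha> \<beta>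
    have "successively adj (rev (map Inverse p))"
      using w(1) unfolding p is_string.simps adj_def[abs_def] by blast
    then have "successively (\<lambda>\<alpha> \<beta>. adj \<beta> \<alpha>) (map Inverse p)" using successively_rev[of adj] by blast
    then have "successively (\<lambda>x y. adj (Inverse y) (Inverse x)) p" unfolding successively_map .
    then have "successively (\<lambda>x y. tail Q x = head Q y) p" by (rule successively_mono) (simp add: adj_def)
    then have "quiver_path Q p" using w(1) unfolding quiver_path_def p by auto
    then obtain r where r: "r \<in> \<rho>" "sublist r p" using n[of p] \<open>\<not> length w < n\<close> p by auto
    obtain ps ss where "p = ps @ r @ ss" using r(2) unfolding sublist_def by blast
    then have "w = rev (map Inverse ss) @ rev (map Inverse r) @ rev (map Inverse ps)" using p by simp
    then have "sublist (rev (map Inverse r)) w" unfolding sublist_def by blast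
    moreover have "rev (map Inverse r) \<in> relation_words" unfolding relation_words_def using r(1) by blast
    ultimately show False using w(1) by auto
  qed
  ultimately show ?thesis by blast
qed

lemma turn_language_strings: "turn_language (\<lambda>w. is_string (Word w)) is_direct"
proof
  show "is_string (Word (x @ y @ z)) \<Longrightarrow> y \<noteq> [] \<Longrightarrow> is_string (Word y)" for x y z
    by (rule is_string_factor)
  show "\<not> is_string (Word [])" by simp
  show "is_string (Word x) \<Longrightarrow> is_string (Word y) \<Longrightarrow> is_string (Word [last x, hd y]) \<Longrightarrow>
    is_direct (last x) \<noteq> is_direct (hd y) \<Longrightarrow> is_string (Word (x @ y))" for x y
    by (rule is_string_turn)
qed (rule pure_strings_bounded)

lemma turn_band_iff_band: "turn_language.turn_band (\<lambda>w. is_string (Word w)) is_direct b \<longleftrightarrow> band b"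
proof -
  interpret turn_language "\<lambda>w. is_string (Word w)" is_direct by (rule turn_language_strings)
  have dir: "is_direct x \<longleftrightarrow> (\<exists>a. x = Direct a)" "\<not> is_direct x \<longleftrightarrow> (\<exists>a. x = Inverse a)" for x :: "'a syllable"
    by (cases x; simp)+
  have "src_syl (last b) = tgt_syl (hd b)" if "turn_band b"
  proof -
    have "is_string (Word (b @ b))" "b \<noteq> []"
      using cband_SS cband_not_Nil turn_band_cband that by blast+
    then show ?thesis by (auto simp: successively_append_iff)
  qed
  then show ?thesis unfolding band_def turn_band_def using dir by blast
qed

end

context signed_string_algebra
begin

lemma sign_adjacent:
  assumes "is_string (Word [x, y])" shows "src_syl x = tgt_syl y" "sigma_syl x = - epsilon_syl y"
proof -
  show s: "src_syl x = tgt_syl y" using assms by auto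
  have ne: "x \<noteq> inv_syl y" using assms by auto
  have rel: "\<not> [x, y] \<in> relation_words" using assms by auto
  show "sigma_syl x = - epsilon_syl y"
  proof (cases x)
    case xa: (Direct a)
    show ?thesis
    proof (cases y)
      case (Direct b)
      have "[a, b] \<notin> \<rho>" using rel xa Direct unfolding relation_words_def by force
      then show ?thesis using sigma_epsilon[of a b] assms s xa Direct by auto
    next
      case (Inverse b)
      then show ?thesis using sigma_opposite[of a b] assms s ne xa by auto
    qed
  next
    case xa: (Inverse a)
    show ?thesis
    proof (cases y)
      case (Direct b)
      then show ?thesis using epsilon_opposite[of a b] assms s ne xa by auto
    next
      case (Inverse b)
      have "(\<lambda>r. rev (map Inverse r)) [b, a] = [x, y]" using xa Inverse by simp
      then have "[b, a] \<notin> \<rho>" using rel unfolding relation_words_def by (metis Un_iff image_eqI)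
      then have "\<sigma> b = - \<epsilon> a" using sigma_epsilon[of b a] assms s xa Inverse by auto
      then show ?thesis using xa Inverse by simp
    qed
  qed
qed

text \<open>Hence a trivial string that composes with one side of an admissible junction also
  composes with the other side, and either side determines it.\<close>

lemma sign_junction:
  assumes "is_string (Word (x @ y))" "x \<noteq> []" "y \<noteq> []"
  shows "src (Word x) = tgt (Word y)" "sgn_src (Word x) = - sgn_tgt (Word y)"
proof -
  have "x @ y = butlast x @ [last x, hd y] @ tl y" using assms by simp
  then have *: "is_string (Word [last x, hd y])" using is_string_factor assms(1) by (metis list.distinct(1))
  show "src (Word x) = tgt (Word y)" "sgn_src (Word x) = - sgn_tgt (Word y)"
    using sign_adjacent[OF *] by simp_all
qed

text \<open>The string with underlying list \<open>l\<close> that can be composed with \<open>c\<close> on its left; it is trivial for \<open>l = []\<close>.\<close>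

definition before :: "'a syllable list \<Rightarrow> 'a syllable list \<Rightarrow> ('v, 'a) word" where
  "before c l = (if l = [] then Triv (src (Word c)) (- sgn_src (Word c)) else Word l)"

definition after :: "'a syllable list \<Rightarrow> 'a syllable list \<Rightarrow> ('v, 'a) word" where
  "after c l = (if l = [] then Triv (tgt (Word c)) (sgn_tgt (Word c)) else Word l)"

lemma before_inject: "before c l = before c l' \<longleftrightarrow> l = l'"
  by (auto simp: before_def)

lemma comp_before: "Word c \<cdot> before c l = Word (c @ l)"
  by (simp add: before_def)

lemma is_string_ends:
  assumes "is_string (Word c)"
  shows "is_string (Triv (src (Word c)) (- sgn_src (Word c)))" "is_string (Triv (tgt (Word c)) (sgn_tgt (Word c)))"
proof -
  have s: "src_syl x \<in> verts Q" "tgt_syl x \<in> verts Q" "sigma_syl x \<in> {1, -1}" "epsilon_syl x \<in> {1, -1}"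
    if "x \<in> set c" for x
  proof -
    have "x \<in> Direct ` arcs Q \<union> Inverse ` arcs Q" using that assms by auto
    then obtain a where a: "a \<in> arcs Q" "x = Direct a \<or> x = Inverse a" by blast
    then show "src_syl x \<in> verts Q" "tgt_syl x \<in> verts Q" by auto
    show "sigma_syl x \<in> {1, -1}" "epsilon_syl x \<in> {1, -1}" using a sigma_sign[OF a(1)] epsilon_sign[OF a(1)] by auto
  qed
  have "c \<noteq> []" using assms by auto
  then show "is_string (Triv (src (Word c)) (- sgn_src (Word c)))" "is_string (Triv (tgt (Word c)) (sgn_tgt (Word c)))"
    using s[of "last c"] s[of "hd c"] by auto
qed

lemma is_string_before:
  assumes "is_string (Word (c @ l @ b))" "c \<noteq> []" shows "is_string (before c l)"
  using assms is_string_factor[of c l b] is_string_factor[of "[]" c "l @ b"] is_string_ends(1)[of c]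
  unfolding before_def by (auto simp del: is_string.simps)

lemma is_string_after:
  assumes "is_string (Word (l @ c))" "c \<noteq> []" shows "is_string (after c l)"
  using assms is_string_factor[of "[]" l c] is_string_factor[of l c "[]"] is_string_ends(2)[of c]
  unfolding after_def by (auto simp del: is_string.simps)

text \<open>The formal word \<open>Word []\<close> also composes with both neighbours, but it is not
  a string; once \<open>u\<close> is known to be a string, only the first case remains.\<close>

lemma comp_string_cases:
  assumes "Word c \<cdot> u \<cdot> Word b = Word y"
  obtains l where "u = before c l" "y = c @ l @ b" | "u = Word []"
proof (cases u)
  case (Word l)
  then show thesis using assms that(1)[of l] that(2) by (cases "l = []") (auto simp: before_def)
next
  case (Triv v i)
  then have "v = src (Word c)" "i = - sgn_src (Word c)" "y = c @ b"
    using assms by (auto split: if_splits)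
  then show thesis using Triv that(1)[of "[]"] by (simp add: before_def)
qed (use assms in simp)

lemma factorization_before_after:
  assumes "is_string (Word (l2 @ w @ l1))" "w \<noteq> []"
  shows "factorization (Word (l2 @ w @ l1)) (after w l2) w (before w l1)"
proof -
  have "is_string (Word (l2 @ w))" "is_string (Word (w @ l1))"
    using is_string_factor[of "[]" "l2 @ w" l1] is_string_factor[of l2 "w @ l1" "[]"] assms
    by (auto simp del: is_string.simps)
  then have "is_string (after w l2)" "is_string (before w l1)"
    using is_string_after is_string_before[of w l1 "[]"] assms(2) by (auto simp del: is_string.simps)
  moreover have "after w l2 \<cdot> Word w \<cdot> before w l1 = Word (l2 @ w @ l1)"
    using assms(2) by (auto simp: after_def before_def)
  ultimately show ?thesis unfolding factorization_def using assms(1) by simp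
qed

lemma factorizationD:
  assumes "factorization (Word y) y2 w y1" "w \<noteq> []"
  obtains l2 l1 where "y = l2 @ w @ l1" "is_string (Word y)"
    "if l2 = [] then \<exists>v i. y2 = Triv v i else y2 = Word l2"
    "if l1 = [] then \<exists>v i. y1 = Triv v i else y1 = Word l1"
proof -
  have s: "is_string (Word y)" "is_string y2" "is_string y1" and e: "Word y = y2 \<cdot> Word w \<cdot> y1"
    using assms(1) unfolding factorization_def by blast+
  have ne: "y2 \<noteq> Word []" "y1 \<noteq> Word []" "y2 \<noteq> Undef" "y1 \<noteq> Undef" using s by auto
  obtain l2 where l2: "y2 \<cdot> Word w = Word (l2 @ w)" "if l2 = [] then \<exists>v i. y2 = Triv v i else y2 = Word l2"
  proof (cases y2)
    case (Word l)
    then show thesis using that[of l] ne by auto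
  next
    case (Triv v i)
    then show thesis using that[of "[]"] e by (auto split: if_splits)
  qed (use ne in simp)
  obtain l1 where l1: "y = l2 @ w @ l1" "if l1 = [] then \<exists>v i. y1 = Triv v i else y1 = Word l1"
  proof (cases y1)
    case (Word l)
    then show thesis using that[of l] ne e l2(1) by auto
  next
    case (Triv v i)
    then show thesis using that[of "[]"] e l2(1) by (auto split: if_splits)
  qed (use ne in simp)
  show thesis using that[OF l1(1) s(1) l2(2) l1(2)] .
qed

lemma not_factorization_Triv: "\<not> factorization (Triv v i) y2 w y1"
  unfolding factorization_def by (cases y2; cases y1) (auto split: if_splits)

lemma factorization_power_iff:
  assumes "is_string (Word y)" "w \<noteq> []"
  shows "(\<exists>y2 y1. factorization (Word y) y2 w y1) \<longleftrightarrow> sublist w y"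
proof
  assume "\<exists>y2 y1. factorization (Word y) y2 w y1"
  then obtain y2 y1 where "factorization (Word y) y2 w y1" by blast
  then obtain l2 l1 where "y = l2 @ w @ l1" using factorizationD[OF _ assms(2)] by metis
  then show "sublist w y" unfolding sublist_def by blast
next
  assume "sublist w y"
  then obtain l2 l1 where "y = l2 @ w @ l1" unfolding sublist_def by blast
  then show "\<exists>y2 y1. factorization (Word y) y2 w y1" using factorization_before_after assms by blast
qed

end

section \<open>Reductions of strings\<close>

locale domestic_string_algebra_bands = string_algebra_bands K Q \<rho> \<sigma> \<epsilon> Q0Ba
  for K :: "('k, 'm) ring_scheme"
    and Q :: "('v, 'a) pre_digraph"
    and \<rho> :: "'a list set"
    and \<sigma> \<epsilon> :: "'a \<Rightarrow> int"
    and Q0Ba :: "'a syllable list set" +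
  assumes is_domestic: domestic
begin

declare is_string.simps [simp del]

sublocale lang: band_representatives "\<lambda>w. is_string (Word w)" is_direct Q0Ba
proof -
  have 1: "domestic_turn_language (\<lambda>w. is_string (Word w)) is_direct"
    by (intro domestic_turn_language.intro turn_language_strings domestic_turn_language_axioms.intro)
      (use is_domestic in \<open>simp add: domestic_def turn_band_iff_band\<close>)
  show "band_representatives (\<lambda>w. is_string (Word w)) is_direct Q0Ba"
    by (intro band_representatives.intro 1 band_representatives_axioms.intro)
      (simp_all add: turn_band_iff_band representatives_band representatives_unique)
qed

lemma is_string_not_Undef: "is_string z \<Longrightarrow> z \<noteq> Undef" "is_string z \<Longrightarrow> z \<noteq> Word []"
  by (auto simp: is_string.simps)

lemma cband_iff: "lang.cband e \<longleftrightarrow> (\<exists>b. band b \<and> e \<in> cyclic_perms b)"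
  unfolding lang.cband_def turn_band_iff_band ..

lemma N_eq_power_count:
  assumes "is_string (Word y)" "b \<noteq> []"
  shows "N b (Word y) = lang.power_count b y"
proof -
  have "(n \<ge> 1 \<and> (\<exists>b' y2 y1. b' \<in> cyclic_perms b \<and> factorization (Word y) y2 (list_pow b' n) y1)) \<longleftrightarrow>
    (n \<ge> 1 \<and> (\<exists>b'\<in>cyclic_perms b. sublist (list_pow b' n) y))" for n
  proof -
    have "list_pow b' n \<noteq> []" if "b' \<in> cyclic_perms b" "n \<ge> 1" for b'
      using that assms(2) cyclic_perms_length by fastforce
    then show ?thesis using factorization_power_iff[OF assms(1)] by metis
  qed
  then show ?thesis unfolding N_def lang.power_count_def by simp
qed

lemma band_free_before:
  assumes "is_string (before c l)"
  shows "band_free (before c l) \<longleftrightarrow> lang.loop_free_word l"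
proof (cases "l = []")
  case True
  moreover have "\<not> lang.cband []" using lang.cband_not_Nil by blast
  ultimately show ?thesis
    unfolding band_free_def lang.loop_free_word_def before_def
    using not_factorization_Triv by simp
next
  case False
  then have l: "is_string (Word l)" "before c l = Word l" using assms by (auto simp: before_def)
  have "(\<exists>b b' y2 y1. band b \<and> b' \<in> cyclic_perms b \<and> factorization (Word l) y2 b' y1) \<longleftrightarrow>
    (\<exists>e. lang.cband e \<and> (\<exists>y2 y1. factorization (Word l) y2 e y1))"
    unfolding cband_iff by blast
  also have "\<dots> \<longleftrightarrow> (\<exists>e. lang.cband e \<and> sublist e l)"
    using factorization_power_iff[OF l(1)] lang.cband_not_Nil by blast
  finally show ?thesis unfolding band_free_def lang.loop_free_word_def l(2) by blast
qed

text \<open>The excluded trivial bridge is formed from the target of \<open>b\<close>, whereas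
  \<open>before\<close> uses the source; the two agree because \<open>b\<close> composes with
  itself.\<close>

lemma band_ends: "b \<in> Q0Ba \<Longrightarrow> before b [] = Triv (tgt (Word b)) (sgn_tgt (Word b))"
  using sign_junction[OF lang.cband_SS[OF lang.reps_cband]] lang.cband_not_Nil[OF lang.reps_cband]
  by (simp add: before_def)

definition to_bridge :: "'a syllable list \<times> 'a syllable list \<times> 'a syllable list \<Rightarrow> ('v, 'a) bridge" where
  "to_bridge = (\<lambda>(b, l, c). (b, before c l, c))"

lemma to_bridge_simps [simp]:
  "bridge_src (to_bridge (b, l, c)) = b" "bridge_str (to_bridge (b, l, c)) = before c l"
  "bridge_tgt (to_bridge (b, l, c)) = c"
  by (simp_all add: to_bridge_def bridge_src_def bridge_str_def bridge_tgt_def)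

lemma to_bridge_inject: "to_bridge x = to_bridge y \<longleftrightarrow> x = y"
  by (cases x; cases y) (auto simp: to_bridge_def before_inject)

lemma weak_bridge_to_bridge: "weak_bridge (to_bridge (b, l, c)) \<longleftrightarrow> lang.bridge b l c"
proof -
  have "is_string (before c l)" if "is_string (Word (c @ l @ b))" "c \<in> Q0Ba"
    using is_string_before that lang.cband_not_Nil lang.reps_cband by blast
  moreover have "Word c \<cdot> before c l \<cdot> Word b = Word (c @ l @ b)" by (simp add: comp_before)
  moreover have "b \<in> Q0Ba \<Longrightarrow> b = c \<Longrightarrow> before c l = Triv (tgt (Word b)) (sgn_tgt (Word b)) \<longleftrightarrow> l = []"
    using band_ends before_inject by metis
  ultimately show ?thesis
    unfolding weak_bridge_def lang.bridge_def to_bridge_def prod.case using band_free_before by metis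
qed

lemma weak_bridgeE:
  assumes "weak_bridge e"
  obtains b l c where "e = to_bridge (b, l, c)" "lang.bridge b l c"
proof -
  obtain b u c where e: "e = (b, u, c)" by (cases e)
  have u: "is_string u" "is_string (Word c \<cdot> u \<cdot> Word b)" using assms e unfolding weak_bridge_def by auto
  have "Word c \<cdot> u \<cdot> Word b \<noteq> Undef" using u(2) by (auto simp: is_string.simps)
  then obtain y where "Word c \<cdot> u \<cdot> Word b = Word y" by (cases u) (auto split: if_splits)
  then obtain l where "u = before c l" using comp_string_cases u(1) is_string_not_Undef by metis
  then have "e = to_bridge (b, l, c)" using e by (simp add: to_bridge_def)
  then show thesis using that assms weak_bridge_to_bridge by blast
qed

text \<open>H-equivalence tests strings that start at the common end vertex, residual languages test
  all lists. A list that yields a string starts at that vertex by \<open>sign_junction\<close>;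
  trivial strings are settled by the equality of the end signs.\<close>

lemma H_equivalent_iff_on_cycle:
  assumes e: "lang.cband e" and s: "is_string (Word (e @ y))" and y: "y \<noteq> []"
  shows "H_equivalent (Word (e @ y)) (Word y) \<longleftrightarrow> lang.on_cycle e y"
proof
  have ne: "e \<noteq> []" using lang.cband_not_Nil e by blast
  assume H: "H_equivalent (Word (e @ y)) (Word y)"
  have "is_string (Word (x @ e @ y)) \<longleftrightarrow> is_string (Word (x @ y))" for x
  proof (cases "x = []")
    case True
    then show ?thesis using H unfolding H_equivalent_def by simp
  next
    case False
    have *: "is_string (Word x) \<Longrightarrow> src (Word x) = tgt (Word (e @ y)) \<Longrightarrow>
      is_string (Word (x @ e @ y)) \<longleftrightarrow> is_string (Word (x @ y))"
      using H comp.simps(1) unfolding H_equivalent_def by metis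
    have "tgt (Word (e @ y)) = tgt (Word y)" using H unfolding H_equivalent_def by blast
    then show ?thesis
      using * sign_junction(1)[of x "e @ y"] sign_junction(1)[of x y] lang.S_prefix False y ne
      by (metis Nil_is_append_conv)
  qed
  then have "lang.Res (e @ y) = lang.Res y" unfolding lang.Res_def by blast
  then show "lang.on_cycle e y" unfolding lang.on_cycle_def using lang.cband_Res[OF e s] e by simp
next
  assume on: "lang.on_cycle e y"
  have ne: "e \<noteq> []" using lang.cband_not_Nil e by blast
  note j = sign_junction[OF s ne y] sign_junction[OF lang.cband_SS[OF e] ne ne]
  have t: "tgt (Word (e @ y)) = tgt (Word y)" "sgn_tgt (Word (e @ y)) = sgn_tgt (Word y)"
    using j ne by auto
  have sy: "is_string (Word y)" using lang.on_cycleD(3)[OF on] .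
  have "is_string (x \<cdot> Word (e @ y)) \<longleftrightarrow> is_string (x \<cdot> Word y)" for x
  proof (cases x)
    case (Word l)
    then show ?thesis using lang.Res_S[OF lang.on_cycle_loop[OF on], of l] by simp
  next
    case (Triv v i)
    then show ?thesis using t s sy by (simp add: is_string.simps(3) del: tgt.simps sgn_tgt.simps)
  qed simp
  then show "H_equivalent (Word (e @ y)) (Word y)"
    unfolding H_equivalent_def using t(1) s sy by blast
qed

section \<open>One-step reductions\<close>

lemma band_reduction_WordD:
  assumes "band_reduction b (Word y) z" "lang.cband b"
  obtains k2 g k1 where "g \<in> cyclic_perms b" "y = k2 @ g @ k1" "k2 @ k1 \<noteq> [] \<Longrightarrow> z = Word (k2 @ k1)"
proof -
  obtain g y2 y1 where z: "is_string z" "z = y2 \<cdot> y1" and g: "g \<in> cyclic_perms b" "factorization (Word y) y2 g y1"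
    using assms(1) unfolding band_reduction_def by blast
  have "g \<noteq> []" using lang.cband_not_Nil lang.cband_cyclic assms(2) g(1) by blast
  from factorizationD[OF g(2) this] obtain k2 k1 where k: "y = k2 @ g @ k1"
    "if k2 = [] then \<exists>v i. y2 = Triv v i else y2 = Word k2"
    "if k1 = [] then \<exists>v i. y1 = Triv v i else y1 = Word k1" by metis
  have "k2 @ k1 \<noteq> [] \<Longrightarrow> z = Word (k2 @ k1)"
    using k(2,3) z is_string_not_Undef(1)[OF z(1)] by (auto split: if_splits)
  then show thesis using that g(1) k(1) by blast
qed

text \<open>With both outer parts nonempty the result is a word of positive length, so every
  admissible choice in \<open>R\<close> is a deletion on lists, and \<open>removal_unique\<close>
  makes all of them equal.\<close>

lemma R_removal:
  assumes s: "is_string (Word (l2 @ e @ l1))" "is_string (Word (l2 @ l1))"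
    and e: "lang.cband e" "e \<in> cyclic_perms b" and ne: "l2 \<noteq> []" "l1 \<noteq> []"
  shows "band_reduction b (Word (l2 @ e @ l1)) (Word (l2 @ l1))" "R b (Word (l2 @ e @ l1)) = Word (l2 @ l1)"
proof -
  have en: "e \<noteq> []" using lang.cband_not_Nil e(1) by blast
  have cb: "lang.cband b" using lang.cband_cyclic e cyclic_perms_sym by blast
  have "factorization (Word (l2 @ e @ l1)) (Word l2) e (Word l1)"
    using factorization_before_after[OF s(1) en] ne by (simp add: after_def before_def)
  then show red: "band_reduction b (Word (l2 @ e @ l1)) (Word (l2 @ l1))"
    unfolding band_reduction_def using s(2) e(2) by (metis comp.simps(1))
  have "z = Word (l2 @ l1)" if red: "band_reduction b (Word (l2 @ e @ l1)) z" for z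
  proof -
    obtain k2 g k1 where k: "g \<in> cyclic_perms b" "l2 @ e @ l1 = k2 @ g @ k1" "k2 @ k1 \<noteq> [] \<Longrightarrow> z = Word (k2 @ k1)"
      using band_reduction_WordD[OF red cb] by metis
    have "g \<in> cyclic_perms e" using k(1) e(2) cyclic_perms_sym cyclic_perms_trans by blast
    then have "l2 @ l1 = k2 @ k1" using lang.removal_unique[OF s(1) k(2) e(1)] by blast
    then show ?thesis using k(3) ne by (metis Nil_is_append_conv)
  qed
  then show "R b (Word (l2 @ e @ l1)) = Word (l2 @ l1)"
    unfolding R_def using red by (rule some_equality[rotated])
qed

lemma R_double:
  assumes bc: "b \<in> Q0Ba" "c \<in> Q0Ba" "b \<noteq> c" and y: "is_string (Word y)" "y = c @ w @ b"
    and d: "d \<in> Q0Ba" "2 \<le> lang.power_count d y"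
  obtains z where "R d (Word y) = Word z" "lang.shrinks b c y z"
    "lang.power_count d y = Suc (lang.power_count d z)"
    "\<And>g. g \<in> Q0Ba \<Longrightarrow> g \<noteq> d \<Longrightarrow> lang.power_count g z = lang.power_count g y"
proof -
  have tb: "lang.turn_band b" "lang.turn_band c" and cbd: "c \<notin> cyclic_perms b"
    using bc lang.reps_band lang.reps_eq by blast+
  have ne: "b \<noteq> []" "c \<noteq> []" "d \<noteq> []" using bc d(1) lang.cband_not_Nil lang.reps_cband by auto
  obtain e where e: "e \<in> cyclic_perms d" "sublist (list_pow e 2) y"
    using lang.power_count_ge[of d 2 y] ne d(2) by auto
  then obtain y2 y1 where y12: "y = y2 @ e @ e @ y1" unfolding sublist_def by (auto simp: numeral_2_eq_2)
  have ce: "lang.cband e" using lang.cband_cyclic lang.reps_cband d(1) e(1) by blast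
  have eq: "c @ w @ b = y2 @ e @ e @ y1" using y(2) y12 by metis
  have sc: "is_string (Word (c @ w @ b))" "is_string (Word (y2 @ e @ e @ y1))"
    using y(1) unfolding y(2) eq by simp_all
  have sh: "lang.shrinks b c y (y2 @ e @ y1)"
    unfolding y12 by (rule lang.shrinks_double[OF tb cbd ce sc(1) eq])
  then have s: "is_string (Word (y2 @ e @ y1))" unfolding lang.shrinks_def by blast
  \<comment> \<open>Deleting either copy gives the same word. The one is chosen for which both
    remaining parts are visibly nonempty, because one of them contains an end band and the other the
    second copy.\<close>
  have "R d (Word y) = Word (y2 @ e @ y1)"
  proof (cases "e \<in> cyclic_perms b")
    case False
    obtain x where "y1 = x @ b"
      using lang.disjoint_from_start[OF tb(1) ce False, of "c @ w" "y2 @ e" y1] sc(1) eq by auto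
    then have "y1 \<noteq> []" using ne by simp
    then show ?thesis
      unfolding y12 using R_removal(2)[of "y2 @ e" e y1 d] sc(2) s ce e(1) lang.cband_not_Nil[OF ce] by simp
  next
    case True
    then have "e \<notin> cyclic_perms c" using cbd cyclic_perms_sym cyclic_perms_trans by blast
    then obtain x where "y2 = c @ x"
      using lang.disjoint_from_end[OF tb(2) ce, of "w @ b" y2 "e @ y1"] sc(1) eq by metis
    then have "y2 \<noteq> []" using ne by simp
    then show ?thesis
      unfolding y12 using R_removal(2)[of y2 e "e @ y1" d] sc(2) s ce e(1) lang.cband_not_Nil[OF ce] by simp
  qed
  moreover have "lang.power_count d y = Suc (lang.power_count d (y2 @ e @ y1))"
    unfolding y12 by (rule lang.power_count_double[OF ce e(1) sc(2)])
  moreover have "lang.power_count g (y2 @ e @ y1) = lang.power_count g y" if "g \<in> Q0Ba" "g \<noteq> d" for g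
  proof -
    have "g \<notin> cyclic_perms e" using e(1) that d(1) lang.reps_eq cyclic_perms_trans by blast
    then show ?thesis
      unfolding y12 using lang.power_count_double_other[OF ce lang.reps_cband[OF that(1)] _ sc(2)] by simp
  qed
  ultimately show thesis using that sh by blast
qed

lemma R_power:
  assumes bc: "b \<in> Q0Ba" "c \<in> Q0Ba" "b \<noteq> c" and d: "d \<in> Q0Ba"
    and "is_string (Word y)" "y = c @ w @ b" "lang.power_count d y = Suc k"
  shows "\<exists>z. (R d ^^ k) (Word y) = Word z \<and> lang.shrinks b c y z \<and> lang.power_count d z = 1 \<and>
    (\<forall>g\<in>Q0Ba. g \<noteq> d \<longrightarrow> lang.power_count g z = lang.power_count g y)"
  using assms(5-)
proof (induction k arbitrary: y w)
  case 0
  then have "lang.shrinks b c y y" using lang.shrinks_refl by blast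
  then show ?case using 0 by auto
next
  case (Suc k)
  have two: "2 \<le> lang.power_count d y" using Suc.prems(3) by simp
  obtain z where z: "R d (Word y) = Word z" "lang.shrinks b c y z" "lang.power_count d y = Suc (lang.power_count d z)"
    "\<And>g. g \<in> Q0Ba \<Longrightarrow> g \<noteq> d \<Longrightarrow> lang.power_count g z = lang.power_count g y"
    using R_double[OF bc Suc.prems(1,2) d two] by blast
  obtain w' where w': "z = c @ w' @ b" "is_string (Word z)" using z(2) unfolding lang.shrinks_def by blast
  obtain z' where z': "(R d ^^ k) (Word z) = Word z'" "lang.shrinks b c z z'" "lang.power_count d z' = 1"
    "\<forall>g\<in>Q0Ba. g \<noteq> d \<longrightarrow> lang.power_count g z' = lang.power_count g z"
    using Suc.IH[OF w'(2,1)] z(3) Suc.prems(3) by (metis nat.inject)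
  have "(R d ^^ Suc k) (Word y) = Word z'" using z(1) z'(1) by (simp add: funpow_swap1)
  moreover have "lang.shrinks b c y z'" using lang.shrinks_trans z(2) z'(2) by blast
  ultimately show ?case using z(4) z'(3,4) by auto
qed

section \<open>Skeletons\<close>

lemma finite_bands_of: "finite (bands_of y)"
proof (rule finite_subset)
  show "bands_of y \<subseteq> {b. band b}" unfolding bands_of_def using representatives_band by blast
qed (use is_domestic domestic_def in simp)

lemma skeleton_foldr:
  obtains bs where "distinct bs" "set bs = bands_of y"
    "skeleton y = foldr (\<lambda>b z. (R b ^^ (N b y - 1)) z) bs y"
proof -
  define bs where "bs = (SOME bs. distinct bs \<and> set bs = bands_of y)"
  have "\<exists>bs. distinct bs \<and> set bs = bands_of y" using finite_distinct_list[OF finite_bands_of] by blast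
  then have "distinct bs \<and> set bs = bands_of y" unfolding bs_def by (rule someI_ex)
  then show thesis using that[of bs] unfolding skeleton_def Let_def bs_def[symmetric] by blast
qed

text \<open>The exponents are read off the original string. They remain the right ones throughout,
  because reducing one band changes the exponent of no other band; this also makes the order
  irrelevant.\<close>

lemma skeleton_shrinks:
  assumes bc: "b \<in> Q0Ba" "c \<in> Q0Ba" "b \<noteq> c" and y: "is_string (Word y)" "y = c @ w @ b"
  obtains z where "skeleton (Word y) = Word z" "lang.shrinks b c y z"
    "\<And>d. d \<in> Q0Ba \<Longrightarrow> lang.power_count d z \<le> 1"
proof -
  obtain bs where bs: "distinct bs" "set bs = bands_of (Word y)"
    "skeleton (Word y) = foldr (\<lambda>b z. (R b ^^ (N b (Word y) - 1)) z) bs (Word y)"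
    using skeleton_foldr by blast
  have N: "N d (Word y) = lang.power_count d y" if "d \<in> Q0Ba" for d
    using N_eq_power_count[OF y(1)] that lang.cband_not_Nil lang.reps_cband by blast
  have "\<exists>z. foldr (\<lambda>b z. (R b ^^ (N b (Word y) - 1)) z) ds (Word y) = Word z \<and> lang.shrinks b c y z \<and>
    (\<forall>d\<in>Q0Ba. lang.power_count d z = (if d \<in> set ds then 1 else lang.power_count d y))"
    if "distinct ds" "set ds \<subseteq> bands_of (Word y)" for ds
    using that
  proof (induction ds)
    case Nil
    have "lang.shrinks b c y y" using lang.shrinks_refl y by blast
    then show ?case by auto
  next
    case (Cons d ds)
    then obtain z where z: "foldr (\<lambda>b z. (R b ^^ (N b (Word y) - 1)) z) ds (Word y) = Word z" "lang.shrinks b c y z"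
      "\<forall>d\<in>Q0Ba. lang.power_count d z = (if d \<in> set ds then 1 else lang.power_count d y)" by auto
    have d: "d \<in> Q0Ba" "N d (Word y) > 0" "d \<notin> set ds" using Cons.prems unfolding bands_of_def by auto
    obtain k where k: "lang.power_count d y = Suc k" "N d (Word y) = Suc k"
      using d N[OF d(1)] by (cases "lang.power_count d y") auto
    obtain w' where w': "z = c @ w' @ b" "is_string (Word z)" using z(2) unfolding lang.shrinks_def by blast
    have kz: "lang.power_count d z = Suc k" using z(3) d(1,3) k(1) by simp
    obtain z' where z': "(R d ^^ k) (Word z) = Word z'" "lang.shrinks b c z z'" "lang.power_count d z' = 1"
      "\<forall>g\<in>Q0Ba. g \<noteq> d \<longrightarrow> lang.power_count g z' = lang.power_count g z"
      using R_power[OF bc d(1) w'(2,1) kz] by blast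
    show ?case
    proof (intro exI conjI ballI)
      show "foldr (\<lambda>b z. (R b ^^ (N b (Word y) - 1)) z) (d # ds) (Word y) = Word z'"
        using z(1) z'(1) k(2) by simp
      show "lang.shrinks b c y z'" using lang.shrinks_trans z(2) z'(2) by blast
      fix g assume "g \<in> Q0Ba"
      then show "lang.power_count g z' = (if g \<in> set (d # ds) then 1 else lang.power_count g y)"
        using z(3) z'(3,4) by (cases "g = d") simp_all
    qed
  qed
  note foldr = this
  have "set bs \<subseteq> bands_of (Word y)" using bs(2) by simp
  from foldr[OF bs(1) this] obtain z where z: "skeleton (Word y) = Word z" "lang.shrinks b c y z"
    "\<forall>d\<in>Q0Ba. lang.power_count d z = (if d \<in> set bs then 1 else lang.power_count d y)"
    unfolding bs(3) by blast
  have "lang.power_count d z \<le> 1" if "d \<in> Q0Ba" for d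
    using z(3) that N[OF that] bs(2) unfolding bands_of_def by auto
  then show thesis using that z by blast
qed

lemma skeleton_eq_self:
  assumes "is_string (Word y)" "\<And>e. lang.cband e \<Longrightarrow> \<not> sublist (e @ e) y"
  shows "skeleton (Word y) = Word y"
proof -
  obtain bs where "distinct bs" and bs: "set bs = bands_of (Word y)"
    "skeleton (Word y) = foldr (\<lambda>b z. (R b ^^ (N b (Word y) - 1)) z) bs (Word y)"
    by (rule skeleton_foldr)
  have "N d (Word y) - 1 = 0" if "d \<in> set bs" for d
  proof (rule ccontr)
    have d: "d \<in> Q0Ba" using that bs(1) unfolding bands_of_def by blast
    then have cd: "lang.cband d" "d \<noteq> []" using lang.reps_cband lang.cband_not_Nil by blast+
    assume "N d (Word y) - 1 \<noteq> 0"
    then have "2 \<le> lang.power_count d y" using N_eq_power_count[OF assms(1) cd(2)] by simp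
    then have "\<exists>e\<in>cyclic_perms d. sublist (list_pow e 2) y"
      using lang.power_count_ge[OF cd(2), of 2 y] by simp
    then obtain e where e: "e \<in> cyclic_perms d" "sublist (e @ e) y" by (auto simp: numeral_2_eq_2)
    show False using assms(2)[OF lang.cband_cyclic[OF cd(1) e(1)]] e(2) by contradiction
  qed
  then have "foldr (\<lambda>b z. (R b ^^ (N b (Word y) - 1)) z) bs (Word y) = Word y"
  proof (induction bs)
    case (Cons d bs)
    then have "N d (Word y) - 1 = 0" "foldr (\<lambda>b z. (R b ^^ (N b (Word y) - 1)) z) bs (Word y) = Word y" by simp_all
    then show ?case by simp
  qed simp
  then show ?thesis unfolding bs(2) .
qed

lemma h_red_step:
  assumes bc: "b \<in> Q0Ba" "c \<in> Q0Ba" and d: "d \<in> Q0Ba" "d \<noteq> b" "d \<noteq> c"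
    and z: "is_string (Word z)" "z = c @ w @ b"
  obtains f where "h_red d (Word z) = Word f" "lang.h_step d z f"
proof -
  have tb: "lang.turn_band b" "lang.turn_band c" using bc lang.reps_band by auto
  have ne: "b \<noteq> []" "c \<noteq> []" "d \<noteq> []" using bc d(1) lang.cband_not_Nil lang.reps_cband by auto
  have cd: "lang.cband d" using lang.reps_cband d(1) .
  have other: "lang.cband e" "e \<notin> cyclic_perms b" "e \<notin> cyclic_perms c" "e \<noteq> []" if "e \<in> cyclic_perms d" for e
  proof -
    show ce: "lang.cband e" using lang.cband_cyclic[OF cd that] .
    show "e \<noteq> []" using lang.cband_not_Nil[OF ce] .
    have "d \<notin> cyclic_perms b" "d \<notin> cyclic_perms c" using lang.reps_eq bc d by blast+
    then show "e \<notin> cyclic_perms b" "e \<notin> cyclic_perms c"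
      using that cyclic_perms_sym cyclic_perms_trans by blast+
  qed
  \<comment> \<open>Since \<open>d\<close> differs from both end bands, each of its occurrences is
    disjoint from them and has one on either side.\<close>
  have frame: "y2 \<noteq> [] \<and> y1 \<noteq> []" if e: "e \<in> cyclic_perms d" and eq: "z = y2 @ e @ y1" for y2 e y1
  proof -
    have cz: "is_string (Word ((c @ w) @ b))" "(c @ w) @ b = y2 @ e @ y1"
      "is_string (Word (c @ (w @ b)))" "c @ (w @ b) = y2 @ e @ y1"
      using z eq by simp_all
    obtain x where "y1 = x @ b"
      using lang.disjoint_from_start[OF tb(1) other(1,2)[OF e] cz(1,2)] .
    moreover obtain u where "y2 = c @ u"
      using lang.disjoint_from_end[OF tb(2) other(1,3)[OF e] cz(3,4)] .
    ultimately show ?thesis using ne by simp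
  qed
  show thesis
  proof (cases "d \<in> bands_of (Word z) \<and> (\<exists>z'. band_reduction d (Word z) z') \<and> H_reduction (Word z) (R d (Word z))")
    case True
    then have hR: "h_red d (Word z) = R d (Word z)" unfolding h_red_def by simp
    have "band_reduction d (Word z) (R d (Word z))" unfolding R_def using True by (blast intro: someI_ex)
    from band_reduction_WordD[OF this cd] obtain l2 e l1 where l: "e \<in> cyclic_perms d" "z = l2 @ e @ l1"
      "l2 @ l1 \<noteq> [] \<Longrightarrow> R d (Word z) = Word (l2 @ l1)" by metis
    then have RW: "R d (Word z) = Word (l2 @ l1)" using frame by blast
    obtain g y2 y1 where g: "lang.cband g" "factorization (Word z) y2 g y1" "R d (Word z) = y2 \<cdot> y1"
      "H_equivalent (Word g \<cdot> y1) y1"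
      using True unfolding H_reduction_def cband_iff by blast
    obtain k2 k1 where k: "z = k2 @ g @ k1" "if k2 = [] then \<exists>v i. y2 = Triv v i else y2 = Word k2"
      "if k1 = [] then \<exists>v i. y1 = Triv v i else y1 = Word k1"
      using factorizationD[OF g(2) lang.cband_not_Nil[OF g(1)]] by metis
    \<comment> \<open>\<open>H_reduction\<close> admits any band as its witness, so \<open>g\<close>
      is not yet related to \<open>d\<close>. The equal results of the two deletions make it a
      rotation of \<open>e\<close>.\<close>
    have eq: "l2 @ l1 = k2 @ k1" using g(3) RW k(2,3) by (auto split: if_splits)
    have "g \<in> cyclic_perms e" using equal_removals_conjugate[of l2 e l1 k2 g k1] l(2) k(1) eq by simp
    then have gd: "g \<in> cyclic_perms d" using l(1) cyclic_perms_trans by blast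
    then have "k1 \<noteq> []" using frame k(1) by blast
    then have "H_equivalent (Word (g @ k1)) (Word k1)" using g(4) k(3) by simp
    moreover have "is_string (Word (g @ k1))" using lang.S_suffix[of k2 "g @ k1"] z(1) k(1) \<open>k1 \<noteq> []\<close> by simp
    ultimately have "lang.on_cycle g k1" using H_equivalent_iff_on_cycle[OF g(1)] \<open>k1 \<noteq> []\<close> by blast
    then have "lang.h_step d z (l2 @ l1)" unfolding lang.h_step_def using gd k(1) eq by blast
    then show thesis using that hR RW by simp
  next
    case False
    then have hz: "h_red d (Word z) = Word z" unfolding h_red_def by auto
    have "\<not> (\<exists>y2 e y1. e \<in> cyclic_perms d \<and> lang.on_cycle e y1 \<and> z = y2 @ e @ y1)"
    proof
      assume "\<exists>y2 e y1. e \<in> cyclic_perms d \<and> lang.on_cycle e y1 \<and> z = y2 @ e @ y1"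
      then obtain y2 e y1 where e: "e \<in> cyclic_perms d" "lang.on_cycle e y1" "z = y2 @ e @ y1" by blast
      note ce = other[OF e(1)]
      have yne: "y2 \<noteq> []" "y1 \<noteq> []" using frame[OF e(1,3)] by auto
      have "is_string (Word (y2 @ e))" using lang.S_prefix[of "y2 @ e" y1] z(1) e(3) ce by simp
      then have s: "is_string (Word (y2 @ y1))" using lang.on_cycleD(6)[OF e(2), of y2] by simp
      note R = R_removal[OF z(1)[unfolded e(3)] s ce(1) e(1) yne, folded e(3)]
      have "sublist (list_pow e 1) z" using e(3) by simp
      then have "1 \<le> lang.power_count d z" using lang.power_count_ge[OF ne(3), of 1 z] e(1) by blast
      then have "d \<in> bands_of (Word z)" unfolding bands_of_def using N_eq_power_count[OF z(1) ne(3)] d(1) by simp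
      moreover have "H_reduction (Word z) (R d (Word z))"
      proof -
        have "factorization (Word z) (Word y2) e (Word y1)"
          using factorization_before_after[of y2 e y1] z(1) e(3) ce yne by (simp add: after_def before_def)
        moreover have "is_string (Word (e @ y1))" using lang.on_cycleD(4)[OF e(2)] .
        then have "H_equivalent (Word e \<cdot> Word y1) (Word y1)"
          using H_equivalent_iff_on_cycle[OF ce(1) _ yne(2)] e(2) by simp
        moreover have "R d (Word z) = Word y2 \<cdot> Word y1" using R(2) by simp
        moreover have "is_string (R d (Word z))" using R(2) s by simp
        moreover obtain b' where "band b'" "e \<in> cyclic_perms b'" using ce(1) cband_iff by blast
        ultimately show ?thesis unfolding H_reduction_def by blast
      qed
      ultimately show False using False R(1) by blast
    qed
    then have "lang.h_step d z z" unfolding lang.h_step_def by blast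
    then show thesis using that hz by blast
  qed
qed

section \<open>Paths of arch bridges\<close>

lemma cas_to_bridge:
  assumes "tail G = bridge_src" "head G = bridge_tgt" "pre_digraph.cas G b P c"
    and "\<And>e. e \<in> set P \<Longrightarrow> \<exists>b l c. e = to_bridge (b, l, c) \<and> lang.bridge b l c"
  shows "\<exists>L. P = map to_bridge L \<and> lang.walk b L c"
  using assms(3,4)
proof (induction P arbitrary: b)
  case Nil
  then show ?case by (simp add: pre_digraph.cas.simps)
next
  case (Cons e P)
  have "e \<in> set (e # P)" by simp
  from Cons.prems(2)[OF this] obtain x l d where e: "e = to_bridge (x, l, d)" "lang.bridge x l d" by blast
  have "tail G e = b \<and> pre_digraph.cas G (head G e) P c"
    using Cons.prems(1) unfolding pre_digraph.cas.simps .
  then have "x = b" and cas: "pre_digraph.cas G d P c" unfolding assms(1,2) e(1) by simp_all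
  have "\<exists>L. P = map to_bridge L \<and> lang.walk d L c"
    by (rule Cons.IH[OF cas], rule Cons.prems(2)) simp
  then obtain L where "P = map to_bridge L" "lang.walk d L c" by blast
  then show ?case using e \<open>x = b\<close> by (intro exI[of _ "(b, l, d) # L"]) simp
qed

lemma awalk_weak_iff:
  "pre_digraph.awalk weak_bridge_quiver b P c \<longleftrightarrow>
     b \<in> Q0Ba \<and> (\<exists>L. P = map to_bridge L \<and> lang.walk b L c)"
proof
  assume "pre_digraph.awalk weak_bridge_quiver b P c"
  then have a: "b \<in> Q0Ba" "pre_digraph.cas weak_bridge_quiver b P c" "\<And>e. e \<in> set P \<Longrightarrow> weak_bridge e"
    by (auto simp: pre_digraph.awalk_def weak_bridge_quiver_def)
  have "\<exists>L. P = map to_bridge L \<and> lang.walk b L c"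
    by (rule cas_to_bridge[OF _ _ a(2)]) (auto simp: weak_bridge_quiver_def dest!: a(3) elim!: weak_bridgeE)
  then show "b \<in> Q0Ba \<and> (\<exists>L. P = map to_bridge L \<and> lang.walk b L c)" using a(1) by blast
next
  have "pre_digraph.cas weak_bridge_quiver b (map to_bridge L) c \<and> (\<forall>e\<in>set (map to_bridge L). weak_bridge e)"
    if "lang.walk b L c" for b L
    using that
  proof (induction L arbitrary: b)
    case (Cons e L)
    then show ?case
      by (cases e) (auto simp: pre_digraph.cas.simps weak_bridge_quiver_def weak_bridge_to_bridge)
  qed (simp add: pre_digraph.cas.simps)
  then show "b \<in> Q0Ba \<and> (\<exists>L. P = map to_bridge L \<and> lang.walk b L c) \<Longrightarrow>
    pre_digraph.awalk weak_bridge_quiver b P c"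
    by (fastforce simp: pre_digraph.awalk_def weak_bridge_quiver_def)
qed

lemma path_string_to_bridge:
  assumes "lang.walk b L c" "L \<noteq> []"
  shows "path_string (map to_bridge L) = Word (lang.body L @ b)"
proof -
  have "foldl (\<lambda>z e. Word (bridge_tgt e) \<cdot> bridge_str e \<cdot> z) (Word x) (map to_bridge L) = Word (lang.body L @ x)" for x
    by (induction L arbitrary: x rule: lang.body.induct) (simp_all add: comp_before)
  moreover have "bridge_src (hd (map to_bridge L)) = b" using assms by (cases L) auto
  ultimately show ?thesis unfolding path_string_def by simp
qed

lemma h_path_eq:
  assumes "lang.walk b L c" "L \<noteq> []" "b \<in> Q0Ba"
    and f: "foldr (\<lambda>e z. h_red (bridge_tgt e) z) (butlast (map to_bridge L)) (skeleton (path_string (map to_bridge L))) =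
      Word (c @ w @ b)"
    and s: "is_string (Word (c @ w @ b))"
  shows "h_path (map to_bridge L) = before c w"
proof -
  have c: "c \<noteq> []" using lang.walk_on_cycle[OF assms(1,3)] lang.reps_cband lang.cband_not_Nil by blast
  have hd: "bridge_src (hd (map to_bridge L)) = b" using assms(1,2) by (cases L) auto
  obtain L1 t where t: "L = L1 @ [t]" using assms(2) by (cases L rule: rev_cases) auto
  obtain x l d where "t = (x, l, d)" by (cases t)
  with t have L: "L = L1 @ [(x, l, d)]" by simp
  then have "d = c" using assms(1) unfolding L lang.walk_append by auto
  then have last: "bridge_tgt (last (map to_bridge L)) = c" using L by simp
  show ?thesis unfolding h_path_def hd last f
  proof (rule the_equality)
    show "is_string (before c w) \<and> Word c \<cdot> before c w \<cdot> Word b = Word (c @ w @ b)"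
      using is_string_before[OF s c] by (simp add: comp_before)
    fix u assume u: "is_string u \<and> Word c \<cdot> u \<cdot> Word b = Word (c @ w @ b)"
    then obtain l where "u = before c l" "c @ w @ b = c @ l @ b"
      using comp_string_cases[of c u b "c @ w @ b"] is_string_not_Undef(2) by metis
    then show "u = before c w" by simp
  qed
qed

lemma walk_string:
  assumes "lang.walk b L c" "L \<noteq> []" "b \<in> Q0Ba"
  obtains w where "lang.body L = c @ w" "is_string (Word (c @ w @ b))" "lang.body L @ b = c @ w @ b"
    "c \<in> Q0Ba" "b \<noteq> c"
proof -
  obtain w where w: "lang.body L = c @ w" using lang.walk_body_prefix assms by blast
  have "c \<in> Q0Ba" "lang.on_cycle c (lang.body L @ b)" using lang.walk_on_cycle assms by blast+
  then show thesis using that[OF w] lang.on_cycleD(3) w lang.walk_neq[OF assms(1,2)] by fastforce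
qed

text \<open>The skeleton and then each H-reduction at an inner vertex keep both end bands and the
  trace, so the description defining \<open>h_path\<close> has a solution with the trace of the
  whole walk.\<close>

lemma h_path_shrinks:
  assumes w: "lang.walk b L c" "L \<noteq> []" "b \<in> Q0Ba"
  obtains w where "h_path (map to_bridge L) = before c w" "is_string (Word (c @ w @ b))"
    "lang.trace b (c @ w) = lang.trace b (lang.body L)"
proof -
  obtain w0 where w0: "lang.body L = c @ w0" "is_string (Word (c @ w0 @ b))" "lang.body L @ b = c @ w0 @ b"
    and c: "c \<in> Q0Ba" "b \<noteq> c" using walk_string[OF assms] by blast
  obtain z where z: "skeleton (Word (lang.body L @ b)) = Word z" "lang.shrinks b c (lang.body L @ b) z"
    using skeleton_shrinks[OF w(3) c(1,2), of "lang.body L @ b" w0] w0 by auto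
  have "\<exists>f. foldr (\<lambda>e z. h_red (bridge_tgt e) z) (map to_bridge L1) (Word z) = Word f \<and>
      lang.shrinks b c (lang.body L @ b) f"
    if "\<And>x l d. (x, l, d) \<in> set L1 \<Longrightarrow> d \<in> Q0Ba \<and> d \<noteq> b \<and> d \<noteq> c" for L1
    using that
  proof (induction L1)
    case Nil
    then show ?case using z(2) by simp
  next
    case (Cons e L1)
    obtain x l d where e: "e = (x, l, d)" by (cases e)
    have d: "d \<in> Q0Ba" "d \<noteq> b" "d \<noteq> c" using Cons.prems[of x l d] e by auto
    obtain g where g: "foldr (\<lambda>e z. h_red (bridge_tgt e) z) (map to_bridge L1) (Word z) = Word g"
      "lang.shrinks b c (lang.body L @ b) g" using Cons.IH Cons.prems by fastforce
    obtain v where v: "is_string (Word g)" "g = c @ v @ b" using g(2) unfolding lang.shrinks_def by blast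
    obtain f where f: "h_red d (Word g) = Word f" "lang.h_step d g f" using h_red_step[OF w(3) c(1) d v] by blast
    have "lang.shrinks b c g f"
      using lang.shrinks_h_step[of b c d v f] f(2) v w(3) c(1) d lang.reps_band lang.reps_eq by blast
    then have "lang.shrinks b c (lang.body L @ b) f" using g(2) lang.shrinks_trans by blast
    then show ?case using g(1) f(1) e by simp
  qed
  from this[of "butlast L"] obtain f where
    f: "foldr (\<lambda>e z. h_red (bridge_tgt e) z) (map to_bridge (butlast L)) (Word z) = Word f"
      "lang.shrinks b c (lang.body L @ b) f"
    using lang.walk_inner_band[OF w(1)] by blast
  obtain v where v: "f = c @ v @ b" "is_string (Word f)" "lang.trace b (c @ v) = lang.trace b (c @ w0)"
    using f(2) unfolding lang.shrinks_def w0(3) by auto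
  have "h_path (map to_bridge L) = before c v"
    by (rule h_path_eq[OF w]) (use f(1) v z(1) path_string_to_bridge[OF w(1,2)] in \<open>simp_all add: map_butlast\<close>)
  then show thesis using that v w0 by metis
qed

text \<open>A bridge with its two end bands contains no square of a band, so the skeleton changes
  nothing, and a path of length one has no inner vertex to reduce at.\<close>

lemma h_path_single:
  assumes br: "lang.bridge b l c"
  shows "h_path [to_bridge (b, l, c)] = before c l"
proof -
  note B = lang.bridgeD[OF br]
  have "skeleton (Word (c @ l @ b)) = Word (c @ l @ b)"
    by (rule skeleton_eq_self[OF B(3) lang.bridge_no_square[OF br]])
  moreover have "path_string (map to_bridge [(b, l, c)]) = Word (c @ l @ b)"
    using path_string_to_bridge[of b "[(b, l, c)]" c] br by simp
  ultimately show ?thesis using h_path_eq[of b "[(b, l, c)]" c l] br B by simp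
qed

lemma h_path_refined:
  assumes br: "lang.bridge b l c" "lang.bridge b u' d" "lang.bridge d u'' c"
    and tr: "lang.trace b (c @ u'' @ d @ u') = lang.trace b (c @ l)"
  shows "h_path [to_bridge (b, u', d), to_bridge (d, u'', c)] = before c l"
proof -
  note B = lang.bridgeD[OF br(1)] and B2 = lang.bridgeD[OF br(2)]
  let ?L = "[(b, u', d), (d, u'', c)]"
  let ?y = "c @ (u'' @ d @ u') @ b"
  have w: "lang.walk b ?L c" using br by simp
  obtain w0 where w0: "lang.body ?L = c @ w0" "is_string (Word (c @ w0 @ b))"
    using walk_string[OF w _ B(1)] by blast
  have sy: "is_string (Word ?y)" using w0 by simp
  obtain z where z: "skeleton (Word ?y) = Word z" "lang.shrinks b c ?y z"
    "\<And>g. g \<in> Q0Ba \<Longrightarrow> lang.power_count g z \<le> 1"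
    using skeleton_shrinks[OF B(1,2) lang.bridge_neq[OF br(1)] sy] by blast
  obtain v where v: "is_string (Word z)" "z = c @ v @ b" using z(2) unfolding lang.shrinks_def by blast
  obtain f where f: "h_red d (Word z) = Word f" "lang.h_step d z f"
    using h_red_step[OF B(1,2) B2(2) _ _ v] lang.bridge_neq[OF br(2)] lang.bridge_neq[OF br(3)] by metis
  have "f = c @ l @ b"
    by (rule lang.refined_unique[OF br tr _ _ _ _ f(2)]) (use z(2) z(3) B B2 in auto)
  moreover have "path_string (map to_bridge ?L) = Word ?y" using path_string_to_bridge[OF w] by simp
  ultimately show ?thesis using h_path_eq[OF w _ B(1), of l] B(3) z(1) f(1) by simp
qed

lemma arch_bridge_direct:
  assumes "arch_bridge e"
  obtains b l c where "e = to_bridge (b, l, c)" "lang.direct_bridge b l c"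
proof -
  obtain b u c where e: "e = (b, u, c)" by (cases e)
  obtain P where P: "P \<noteq> []" "pre_digraph.awalk weak_bridge_quiver b P c" "u = h_path P"
    using assms e unfolding arch_bridge_def weak_arch_bridge_def by auto
  have none: "\<not> (length P \<ge> 2 \<and> pre_digraph.awalk weak_bridge_quiver b P c \<and> u = h_path P)" for P
    using assms e unfolding arch_bridge_def by auto
  then have "length P < 2" using none[of P] P(2,3) by linarith
  then have "length P = 1" using P(1) by (cases P) auto
  obtain L where b: "b \<in> Q0Ba" and L: "P = map to_bridge L" "lang.walk b L c" using P(2) awalk_weak_iff by blast
  obtain t where t: "L = [t]" using \<open>length P = 1\<close> L(1) by (cases L) auto
  obtain x l d where "t = (x, l, d)" by (cases t)
  with L t have br: "lang.bridge b l c" and P': "P = [to_bridge (b, l, c)]" by auto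
  have u: "u = before c l" using P(3) P' h_path_single[OF br] by simp
  have "lang.direct_bridge b l c"
  proof (rule ccontr)
    assume "\<not> lang.direct_bridge b l c"
    then obtain d u' u'' where d: "lang.bridge b u' d" "lang.bridge d u'' c"
      "lang.trace b (c @ u'' @ d @ u') = lang.trace b (c @ l)"
      using lang.refine_bridge[OF br] by metis
    have "h_path [to_bridge (b, u', d), to_bridge (d, u'', c)] = u"
      using h_path_refined[OF br d] u by simp
    moreover have "pre_digraph.awalk weak_bridge_quiver b [to_bridge (b, u', d), to_bridge (d, u'', c)] c"
      unfolding awalk_weak_iff using b d by (intro conjI exI[of _ "[(b, u', d), (d, u'', c)]"]) auto
    ultimately show False using none[of "[to_bridge (b, u', d), to_bridge (d, u'', c)]"] by simp
  qed
  then show thesis using that e u unfolding to_bridge_def by simp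
qed

section \<open>From paths of arch bridges to walks of direct bridges\<close>

lemma arch_awalk_to_walk:
  assumes "pre_digraph.awalk arch_bridge_quiver b P c"
  obtains L where "b \<in> Q0Ba" "P = map to_bridge L" "lang.walk b L c"
    "\<And>x l y. (x, l, y) \<in> set L \<Longrightarrow> lang.direct_bridge x l y"
proof -
  have a: "b \<in> Q0Ba" "pre_digraph.cas arch_bridge_quiver b P c" "\<And>e. e \<in> set P \<Longrightarrow> arch_bridge e"
    using assms by (auto simp: pre_digraph.awalk_def arch_bridge_quiver_def)
  have "\<exists>b l c. e = to_bridge (b, l, c) \<and> lang.bridge b l c" if "e \<in> set P" for e
    using arch_bridge_direct[OF a(3)[OF that]] unfolding lang.direct_bridge_def by metis
  then obtain L where L: "P = map to_bridge L" "lang.walk b L c"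
    using cas_to_bridge[OF _ _ a(2)] unfolding arch_bridge_quiver_def by auto
  have "lang.direct_bridge x l y" if "(x, l, y) \<in> set L" for x l y
  proof -
    have "arch_bridge (to_bridge (x, l, y))" using a(3) L(1) that by auto
    then show ?thesis using arch_bridge_direct to_bridge_inject by (metis prod.inject)
  qed
  then show thesis using that a(1) L by blast
qed

lemma arch_path_unique:
  assumes "pre_digraph.awalk arch_bridge_quiver b P c" "P \<noteq> []"
    and "pre_digraph.awalk arch_bridge_quiver b P' c" "P' \<noteq> []"
    and "h_path P = h_path P'"
  shows "P = P'"
proof -
  obtain L where b: "b \<in> Q0Ba" and L: "P = map to_bridge L" "lang.walk b L c"
    "\<And>x l y. (x, l, y) \<in> set L \<Longrightarrow> lang.direct_bridge x l y" using arch_awalk_to_walk[OF assms(1)] by metis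
  obtain L' where L': "P' = map to_bridge L'" "lang.walk b L' c"
    "\<And>x l y. (x, l, y) \<in> set L' \<Longrightarrow> lang.direct_bridge x l y" using arch_awalk_to_walk[OF assms(3)] by metis
  have "L \<noteq> []" "L' \<noteq> []" using assms L(1) L'(1) by auto
  obtain w where w: "h_path P = before c w" "lang.trace b (c @ w) = lang.trace b (lang.body L)"
    using h_path_shrinks[OF L(2) \<open>L \<noteq> []\<close> b] L(1) by metis
  obtain w' where w': "h_path P' = before c w'" "lang.trace b (c @ w') = lang.trace b (lang.body L')"
    using h_path_shrinks[OF L'(2) \<open>L' \<noteq> []\<close> b] L'(1) by metis
  have "w = w'" using w(1) w'(1) assms(5) before_inject by metis
  then have "lang.trace b (lang.body L) = lang.trace b (lang.body L')" using w(2) w'(2) by simp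
  then have "L = L'" by (intro lang.direct_walk_unique[OF L(2) L'(2) b]) (use L(3) L'(3) in auto)
  then show ?thesis using L(1) L'(1) by simp
qed

end

theorem theorem7p5:
  fixes K :: "('k, 'm) ring_scheme"
    and Q :: "('v, 'a) pre_digraph"
    and \<rho> :: "'a list set"
    and \<sigma> \<epsilon> :: "'a \<Rightarrow> int"
    and Q0Ba :: "'a syllable list set"
    and b\<^sub>1 b\<^sub>2 :: "'a syllable list"
    and P P' :: "('v, 'a) bridge list"
  assumes "string_algebra_bands K Q \<rho> \<sigma> \<epsilon> Q0Ba"
    and "string_algebra.domestic Q \<rho>"
    and "pre_digraph.awalk (string_algebra_bands.arch_bridge_quiver Q \<rho> \<sigma> \<epsilon> Q0Ba) b\<^sub>1 P b\<^sub>2"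
    and "P \<noteq> []"
    and "pre_digraph.awalk (string_algebra_bands.arch_bridge_quiver Q \<rho> \<sigma> \<epsilon> Q0Ba) b\<^sub>1 P' b\<^sub>2"
    and "P' \<noteq> []"
    and "string_algebra_bands.h_path Q \<rho> \<sigma> \<epsilon> Q0Ba P =
         string_algebra_bands.h_path Q \<rho> \<sigma> \<epsilon> Q0Ba P'"
  shows "P = P'"
proof -
  interpret domestic_string_algebra_bands K Q \<rho> \<sigma> \<epsilon> Q0Ba
    by (intro domestic_string_algebra_bands.intro domestic_string_algebra_bands_axioms.intro assms(1,2))
  show ?thesis using arch_path_unique assms(3-7) by blast
qed

end
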